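(* Let $\Theta$ be a compact metric space, $T:\Theta\to\Theta$ a homeomorphism, $\mu$ a $T$-ergodic Borel probability measure on $\Theta$, and let $A:\Theta\to\mathrm{HSp}(2m,\mathbb{C})$ be continuous and homotopic to the identity. Let $\tilde F_{T,A}$ be a lift of the cocycle $(T,A)$ acting on $\Theta\times\mathbf{U}(m)$, and let $f:\Theta\times\mathbf{U}(m)\to\mathbb{R}$ be the associated displacement function. Then the limit $$\lim_{n\to+\infty}\frac1n\sum_{k=0}^{n-1}f\bigl((T,A)^k(\theta,W_\Lambda)\bigr)\mod\mu(C(\Theta,\mathbb{Z}))$$ exists for $\mu$-a.e. $\theta\in\Theta$ and all $W_\Lambda\in\mathbf{U}(m)$, and coincides with $$\operatorname{rot}_f(T,A)=\int_{\Theta\times\mathbf{U}(m)}f\,d\nu\mod\mu(C(\Theta,\mathbb{Z})),$$ where $\nu$ is any probability measure on $\Theta\times\mathbf{U}(m)$ which is invariant under $(T,A)$ and projects to $\mu$ on $\Theta$. The class $\operatorname{rot}_f(T,A)$ is independent of the choice of the lift. Moreover, if $(\Theta,T,\mu)$ is uniquely ergodic, the limit is uniform in all $(\theta,W_\Lambda)\in\Theta\times\mathbf{U}(m)$.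
   Context: $J=\begin{pmatrix}0&I_m\\ -I_m&0\end{pmatrix}$, $\mathrm{HSp}(2m,\mathbb{C})=\{M\in\mathrm{GL}(2m,\mathbb{C}):M^*JM=J\}$. A Lagrangian subspace $\Lambda$ of $\mathbb{C}^{2m}$ is the column span of a rank-$m$ matrix $\begin{pmatrix}X\\ Y\end{pmatrix}$, $X,Y\in\mathbb{C}^{m\times m}$, $X^*Y=Y^*X$; $W_\Lambda=(X+iY)(X-iY)^{-1}\in\mathbf{U}(m)$ is independent of the frame, and $\Lambda\mapsto W_\Lambda$ is a homeomorphism from the Lagrangian Grassmannian onto $\mathbf{U}(m)$. The cocycle is $(T,A):\Theta\times\mathbf{U}(m)\to\Theta\times\mathbf{U}(m)$, $(\theta,W_\Lambda)\mapsto(T\theta,W_{A(\theta)\Lambda})$. $A$ is homotopic to the identity if there is a continuous $H:[0,1]\times\Theta\to\mathrm{HSp}(2m,\mathbb{C})$ with $H(0,\cdot)=A$, $H(1,\cdot)=I_{2m}$. Let $q:\Theta\times\mathbb{R}\times\mathbf{SU}(m)\to\Theta\times\mathbf{U}(m)$, $q(\theta,x,S)=(\theta,e^{2\pi ix}S)$. A lift of $(T,A)$ is a continuous self-map $\tilde F_{T,A}$ of $\Theta\times\mathbb{R}\times\mathbf{SU}(m)$ with $q\circ\tilde F_{T,A}=(T,A)\circ q$ (lifts exist under the homotopy assumption). The associated displacement function is $f(\theta,e^{2\pi ix}S)=m\,\bigl(p_2\tilde F_{T,A}(\theta,x,S)-x\bigr)$, where $p_2$ is the projection onto $\mathbb{R}$;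 it is well defined on $\Theta\times\mathbf{U}(m)$ and continuous. $C(\Theta,\mathbb{Z})$ is the set of continuous integer-valued functions on $\Theta$ and $\mu(C(\Theta,\mathbb{Z}))=\{\int p\,d\mu:p\in C(\Theta,\mathbb{Z})\}$. *)

theory Defs
  imports "HOL-Probability.Probability"
begin

text \<open>The dimension \<open>m\<close> is \<open>CARD('m)\<close>; \<open>2m\<close>-dimensional objects are indexed by \<open>'m + 'm\<close>,
  the first summand carrying the first \<open>m\<close> coordinates.\<close>

definition adj :: "complex^'n^'k \<Rightarrow> complex^'k^'n" where
  "adj M = (\<chi> i j. cnj (M $ j $ i))"

definition scale_mat :: "complex \<Rightarrow> complex^'n^'k \<Rightarrow> complex^'n^'k" where
  "scale_mat c M = (\<chi> i j. c * M $ i $ j)"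

definition sympJ :: "complex^('m::finite + 'm)^('m + 'm)" where
  "sympJ = (\<chi> i j. case (i, j) of
       (Inl a, Inr b) \<Rightarrow> (if a = b then 1 else 0)
     | (Inr a, Inl b) \<Rightarrow> (if a = b then - 1 else 0)
     | _ \<Rightarrow> 0)"

definition HSp :: "(complex^('m::finite + 'm)^('m + 'm)) set" where
  "HSp = {M. invertible M \<and> adj M ** sympJ ** M = sympJ}"

definition unitary_group :: "(complex^'m^'m) set" where
  "unitary_group = {W. adj W ** W = mat 1 \<and> W ** adj W = mat 1}"

definition special_unitary_group :: "(complex^'m^'m) set" where
  "special_unitary_group = {S \<in> unitary_group. det S = 1}"

definition stack :: "complex^'m^'m \<Rightarrow> complex^'m^'m \<Rightarrow> complex^'m^('m::finite + 'm)" where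
  "stack X Y = (\<chi> i. case i of Inl a \<Rightarrow> X $ a | Inr a \<Rightarrow> Y $ a)"

definition lagrangian_frame :: "complex^'m^'m \<Rightarrow> complex^'m^'m \<Rightarrow> bool" where
  "lagrangian_frame X Y \<longleftrightarrow> rank (stack X Y) = CARD('m) \<and> adj X ** Y = adj Y ** X"

definition frame_span :: "complex^'m^'m \<Rightarrow> complex^'m^'m \<Rightarrow> (complex^('m::finite + 'm)) set" where
  "frame_span X Y = vec.span (columns (stack X Y))"

definition lagrangian :: "(complex^('m::finite + 'm)) set \<Rightarrow> bool" where
  "lagrangian L \<longleftrightarrow> (\<exists>X Y. lagrangian_frame X Y \<and> L = frame_span X Y)"

definition unitary_of :: "(complex^('m::finite + 'm)) set \<Rightarrow> complex^'m^'m" where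
  "unitary_of L = (THE W. \<exists>X Y. lagrangian_frame X Y \<and> L = frame_span X Y \<and>
      W = (X + scale_mat \<i> Y) ** matrix_inv (X - scale_mat \<i> Y))"

definition lagrangian_of :: "complex^'m^'m \<Rightarrow> (complex^('m::finite + 'm)) set" where
  "lagrangian_of = the_inv_into (Collect lagrangian) unitary_of"

definition cocycle ::
  "('a \<Rightarrow> 'a) \<Rightarrow> ('a \<Rightarrow> complex^('m::finite + 'm)^('m + 'm)) \<Rightarrow>
     'a \<times> (complex^'m^'m) \<Rightarrow> 'a \<times> (complex^'m^'m)" where
  "cocycle T A = (\<lambda>(\<theta>, W). (T \<theta>, unitary_of ((*v) (A \<theta>) ` lagrangian_of W)))"

definition covering :: "'a \<times> real \<times> (complex^'m^'m) \<Rightarrow> 'a \<times> (complex^'m^'m)" where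
  "covering = (\<lambda>(\<theta>, x, S). (\<theta>, scale_mat (exp (2 * of_real pi * \<i> * of_real x)) S))"

definition is_lift ::
  "('a::metric_space \<Rightarrow> 'a) \<Rightarrow> ('a \<Rightarrow> complex^('m::finite + 'm)^('m + 'm)) \<Rightarrow>
     ('a \<times> real \<times> (complex^'m^'m) \<Rightarrow> 'a \<times> real \<times> (complex^'m^'m)) \<Rightarrow> bool" where
  "is_lift T A F \<longleftrightarrow>
     (let E = UNIV \<times> UNIV \<times> special_unitary_group in
        continuous_on E F \<and> F ` E \<subseteq> E \<and>
        (\<forall>e\<in>E. covering (F e) = cocycle T A (covering e)))"

definition displacement ::
  "('a \<times> real \<times> (complex^'m^'m) \<Rightarrow> 'a \<times> real \<times> (complex^'m^'m)) \<Rightarrow>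
     'a \<times> (complex^'m^'m) \<Rightarrow> real" where
  "displacement F = (\<lambda>(\<theta>, W). THE y. \<exists>x. \<exists>S\<in>special_unitary_group.
      (\<theta>, W) = covering (\<theta>, x, S) \<and> y = real CARD('m) * (fst (snd (F (\<theta>, x, S))) - x))"

definition invariant_prob :: "'b measure \<Rightarrow> ('b \<Rightarrow> 'b) \<Rightarrow> bool" where
  "invariant_prob N G \<longleftrightarrow> prob_space N \<and> G \<in> N \<rightarrow>\<^sub>M N \<and> distr N N G = N"

definition ergodic_prob :: "'b measure \<Rightarrow> ('b \<Rightarrow> 'b) \<Rightarrow> bool" where
  "ergodic_prob N G \<longleftrightarrow> invariant_prob N G \<and>
     (\<forall>B\<in>sets N. G -` B \<inter> space N = B \<longrightarrow> measure N B = 0 \<or> measure N B = 1)"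

definition uniquely_ergodic :: "('a::topological_space) measure \<Rightarrow> ('a \<Rightarrow> 'a) \<Rightarrow> bool" where
  "uniquely_ergodic \<mu> T \<longleftrightarrow>
     (\<forall>\<mu>'. sets \<mu>' = sets borel \<and> invariant_prob \<mu>' T \<longleftrightarrow> \<mu>' = \<mu>)"

definition invariant_over ::
  "'a::topological_space measure \<Rightarrow> ('a \<times> (complex^'m^'m) \<Rightarrow> 'a \<times> (complex^'m^'m)) \<Rightarrow>
     ('a \<times> (complex^'m^'m)) measure set" where
  "invariant_over \<mu> \<Phi> = {\<nu>. sets \<nu> = sets (restrict_space borel (UNIV \<times> unitary_group)) \<and>
     invariant_prob \<nu> \<Phi> \<and> distr \<nu> borel fst = \<mu>}"

definition integer_periods :: "'a::topological_space measure \<Rightarrow> real set" where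
  "integer_periods \<mu> = {\<integral>\<theta>. real_of_int (p \<theta>) \<partial>\<mu> | p :: 'a \<Rightarrow> int. continuous_on UNIV p}"

text \<open>The class of a real number in \<open>\<real> / \<mu>(C(\<Theta>, \<int>))\<close>, as a coset.\<close>

definition mod_periods :: "'a::topological_space measure \<Rightarrow> real \<Rightarrow> real set" where
  "mod_periods \<mu> x = (+) x ` integer_periods \<mu>"

definition birkhoff_average :: "('b \<Rightarrow> 'b) \<Rightarrow> ('b \<Rightarrow> real) \<Rightarrow> nat \<Rightarrow> 'b \<Rightarrow> real" where
  "birkhoff_average \<Phi> f n z = (\<Sum>k<n. f ((\<Phi> ^^ k) z)) / real n"

end

theory Submission
  imports Defs "HOL-Computational_Algebra.Fundamental_Theorem_Algebra"
begin

text \<open>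
  Write the action of \<open>HSp\<close> on \<open>U(m)\<close> as a Moebius map \<open>W \<mapsto> (aW + b) (cW + d)^(-1)\<close>. Its
  determinant is \<open>det W\<close> times the quotient of \<open>det (a + b W^*)\<close> and \<open>det (cW + d)\<close>. Because elements of \<open>HSp\<close>
  preserve \<open>|X + iY|^2 - |X - iY|^2\<close>, both determinants remain nonzero when \<open>W\<close> is replaced by any
  contraction. They therefore have continuous logarithms on the convex set of contractions, and since they are
  polynomials of degree at most \<open>m\<close> without zeros in the unit disc along each complex line through \<open>0\<close>, the imaginary
  parts of these logarithms vary by a bounded amount (\<open>log_det_bounded_variation\<close>, \<open>moebius_det_phase\<close>). The bound
  is the same for all elements of \<open>HSp\<close>, in particular for all iterates of the cocycle. As \<open>U(m)\<close> is connected, the sum of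
  the displacement function \<open>f\<close> over \<open>n\<close> steps agrees on every fibre, up to a constant, with the phase of the
  \<open>n\<close>-th iterate divided by \<open>2 pi\<close>. So these sums oscillate by at most \<open>2m\<close> on a fibre, uniformly in \<open>n\<close> (\<open>displacement_sum_oscillation\<close>).

  Let \<open>\<nu>\<close> be invariant over \<open>\<mu>\<close> and \<open>c = \<integral>f d\<nu>\<close>. For \<open>\<phi> = f - c - \<epsilon>\<close> the set of base points over which the sums
  of \<open>\<phi>\<close> are unbounded above is well defined and invariant, so it has measure \<open>0\<close> or \<open>1\<close>. It cannot have measure \<open>1\<close>, since sums of a
  bounded function that are almost everywhere unbounded above force a nonnegative integral
  (\<open>integral_nonneg_if_sums_unbounded\<close>). The same holds for \<open>c - f - \<epsilon>\<close>, and so the averages of \<open>f\<close> converge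
  to \<open>c\<close> over almost every base point, for every \<open>W\<close>. In particular \<open>c\<close> does not depend on \<open>\<nu>\<close>.

  Invariant measures over \<open>\<mu>\<close> exist by the Krylov-Bogoliubov argument on the compact space \<open>\<Theta> \<times> U(m)\<close>. The weak compactness
  that it requires is reduced to Helly's theorem on the line by coding points by ternary expansions
  (\<open>weak_sequential_compactness\<close>). The same argument applied to empirical measures gives uniform convergence in the uniquely
  ergodic case. Finally, two lifts have displacements that differ by a continuous integer function of \<open>\<theta>\<close>, whose integral is a
  period (\<open>displacement_difference\<close>).
\<close>

section \<open>Complex matrices and the unitary group\<close>

lemma sum_UNIV_sum_type:
  fixes f :: "'m::finite + 'm \<Rightarrow> 'b::comm_monoid_add"
  shows "(\<Sum>x\<in>UNIV. f x) = (\<Sum>a\<in>UNIV. f (Inl a)) + (\<Sum>a\<in>UNIV. f (Inr a))"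
  by (simp flip: UNIV_Plus_UNIV add: sum.Plus)

lemma adj_mult: "adj (P ** Q) = adj Q ** adj P"
  by (simp add: adj_def matrix_matrix_mult_def vec_eq_iff mult.commute)

lemma adj_adj [simp]: "adj (adj P) = P"
  by (simp add: adj_def vec_eq_iff)

lemma adj_mat_1 [simp]: "adj (mat 1) = mat 1"
  by (rule vec_eq_iff[THEN iffD2], rule allI, rule vec_eq_iff[THEN iffD2], rule allI) (auto simp: adj_def mat_def)

lemma adj_scale_mat: "adj (scale_mat c P) = scale_mat (cnj c) (adj P)"
  by (simp add: adj_def scale_mat_def vec_eq_iff)

lemma scale_mat_mult_left: "scale_mat c P ** Q = scale_mat c (P ** Q)"
  by (simp add: scale_mat_def matrix_matrix_mult_def vec_eq_iff sum_distrib_left mult.assoc)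

lemma scale_mat_mult_right: "P ** scale_mat c Q = scale_mat c (P ** Q)"
  by (simp add: scale_mat_def matrix_matrix_mult_def vec_eq_iff sum_distrib_left mult_ac)

lemma scale_mat_scale_mat: "scale_mat c (scale_mat d P) = scale_mat (c * d) P"
  by (simp add: scale_mat_def vec_eq_iff mult.assoc)

lemma scale_mat_1 [simp]: "scale_mat 1 P = P"
  by (simp add: scale_mat_def vec_eq_iff)

lemma det_adj: "det (adj P) = cnj (det P)"
proof -
  have "adj P = transpose (\<chi> i j. cnj (P $ i $ j))"
    by (simp add: adj_def transpose_def vec_eq_iff)
  then show ?thesis
    by (simp add: det_transpose) (simp add: det_def)
qed

lemma det_scale_mat: "det (scale_mat c P) = c ^ CARD('m) * det P" for P :: "complex^'m^'m"
  by (simp add: det_def scale_mat_def prod.distrib sum_distrib_left mult_ac)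

lemma unitary_group_det: "W \<in> unitary_group \<Longrightarrow> norm (det W) = 1"
proof -
  assume "W \<in> unitary_group"
  then have "det (adj W ** W) = 1" by (simp add: unitary_group_def)
  then have "cnj (det W) * det W = 1" by (simp add: det_mul det_adj)
  then have "norm (cnj (det W) * det W) = 1" by simp
  then have "norm (det W) * norm (det W) = 1" by (simp add: norm_mult)
  then show ?thesis by (simp add: square_eq_1_iff) (smt (verit) norm_ge_zero)
qed

lemma unitary_groupI: "adj W ** W = mat 1 \<Longrightarrow> W \<in> unitary_group"
  by (simp add: unitary_group_def matrix_left_right_inverse)

lemma mat_1_in_unitary_group [simp]: "mat 1 \<in> unitary_group"
  by (simp add: unitary_group_def)

lemma adj_in_unitary_group: "W \<in> unitary_group \<Longrightarrow> adj W \<in> unitary_group"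
  by (simp add: unitary_group_def)

lemma unitary_group_mult:
  assumes "V \<in> unitary_group" "W \<in> unitary_group"
  shows "V ** W \<in> unitary_group"
proof (rule unitary_groupI)
  have "adj (V ** W) ** (V ** W) = adj W ** (adj V ** V) ** W"
    by (simp only: adj_mult matrix_mul_assoc)
  then show "adj (V ** W) ** (V ** W) = mat 1"
    using assms by (simp add: unitary_group_def)
qed

lemma unitary_group_scale:
  assumes "W \<in> unitary_group" "norm c = 1"
  shows "scale_mat c W \<in> unitary_group"
proof (rule unitary_groupI)
  have "c * cnj c = 1" using assms(2) by (simp add: complex_norm_square[symmetric] mult.commute)
  then show "adj (scale_mat c W) ** scale_mat c W = mat 1"
    using assms(1)
    by (simp add: adj_scale_mat scale_mat_mult_left scale_mat_mult_right scale_mat_scale_mat unitary_group_def)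
qed

definition herm_dot :: "complex^'n \<Rightarrow> complex^'n \<Rightarrow> complex" where
  "herm_dot v w = (\<Sum>i\<in>UNIV. cnj (v $ i) * w $ i)"

lemma norm_herm_dot: "(norm v)\<^sup>2 = Re (herm_dot v v)"
  by (simp add: norm_vec_def L2_set_def herm_dot_def sum_nonneg cmod_power2) (simp add: power2_eq_square)

lemma herm_dot_adj: "herm_dot (P *v v) w = herm_dot v (adj P *v w)"
  unfolding herm_dot_def matrix_vector_mult_def adj_def
  by (simp add: sum_distrib_left sum_distrib_right mult_ac) (rule sum.swap)

lemma norm_matrix_vector: "(norm (P *v v))\<^sup>2 = Re (herm_dot v ((adj P ** P) *v v))"
  by (simp add: norm_herm_dot herm_dot_adj matrix_vector_mul_assoc)

lemma unitary_group_norm: "W \<in> unitary_group \<Longrightarrow> norm (W *v v) = norm v"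
  by (rule power2_eq_imp_eq) (simp_all add: norm_matrix_vector unitary_group_def, simp add: norm_herm_dot)

section \<open>The Cayley coordinates of a frame\<close>

text \<open>In the coordinates \<open>X + iY\<close> and \<open>X - iY\<close> of a frame with blocks \<open>X\<close> and \<open>Y\<close>, the symplectic
  form becomes the difference of two Hermitian squares, and \<open>W_\<Lambda>\<close> is a quotient of the coordinates.\<close>
definition plus_part :: "complex^'n^('m::finite + 'm) \<Rightarrow> complex^'n^'m" where
  "plus_part S = (\<chi> a. S $ Inl a + \<i> *s S $ Inr a)"

definition minus_part :: "complex^'n^('m::finite + 'm) \<Rightarrow> complex^'n^'m" where
  "minus_part S = (\<chi> a. S $ Inl a - \<i> *s S $ Inr a)"

definition from_parts :: "complex^'n^'m \<Rightarrow> complex^'n^'m \<Rightarrow> complex^'n^('m::finite + 'm)" where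
  "from_parts P Q = (\<chi> i. case i of Inl a \<Rightarrow> (1/2) *s (P $ a + Q $ a) | Inr a \<Rightarrow> (- \<i>/2) *s (P $ a - Q $ a))"

lemma plus_part_from_parts [simp]: "plus_part (from_parts P Q) = P"
  by (simp add: plus_part_def from_parts_def vec_eq_iff field_simps)

lemma minus_part_from_parts [simp]: "minus_part (from_parts P Q) = Q"
  by (simp add: minus_part_def from_parts_def vec_eq_iff field_simps)

lemma from_parts_plus_part_minus_part [simp]: "from_parts (plus_part S) (minus_part S) = S"
  by (simp add: minus_part_def plus_part_def from_parts_def vec_eq_iff field_simps split: sum.split)

lemma plus_part_mult: "plus_part (S ** G) = plus_part S ** G"
  by (simp add: plus_part_def matrix_matrix_mult_def vec_eq_iff sum_distrib_left sum.distrib ring_distribs mult_ac)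

lemma minus_part_mult: "minus_part (S ** G) = minus_part S ** G"
  by (simp add: minus_part_def matrix_matrix_mult_def vec_eq_iff sum_distrib_left sum_subtractf ring_distribs mult_ac)

lemma from_parts_mult: "from_parts P Q ** G = from_parts (P ** G) (Q ** G)"
  using from_parts_plus_part_minus_part[of "from_parts P Q ** G"] by (simp add: plus_part_mult minus_part_mult)

lemma plus_part_add: "plus_part (S + S') = plus_part S + plus_part S'"
  by (simp add: plus_part_def vec_eq_iff ring_distribs)
lemma minus_part_add: "minus_part (S + S') = minus_part S + minus_part S'"
  by (simp add: minus_part_def vec_eq_iff ring_distribs)
lemma from_parts_add: "from_parts (P + P') (Q + Q') = from_parts P Q + from_parts P' Q'"
  using from_parts_plus_part_minus_part[of "from_parts P Q + from_parts P' Q'"] by (simp add: plus_part_add minus_part_add)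

lemma plus_part_stack: "plus_part (stack X Y) = X + scale_mat \<i> Y"
  by (simp add: plus_part_def stack_def scale_mat_def vec_eq_iff)
lemma minus_part_stack: "minus_part (stack X Y) = X - scale_mat \<i> Y"
  by (simp add: minus_part_def stack_def scale_mat_def vec_eq_iff)

lemma stack_surj: "\<exists>X Y. S = stack X Y"
  by (intro exI[of _ "\<chi> a. S $ Inl a"] exI[of _ "\<chi> a. S $ Inr a"])
     (simp add: stack_def vec_eq_iff split: sum.split)

text \<open>This turns \<open>HSp\<close> into a group preserving an indefinite Hermitian form of signature \<open>(m, m)\<close>,
  which is how all the estimates on \<open>HSp\<close> are obtained.\<close>
lemma cayley_form:
  "adj (plus_part S) ** plus_part S - adj (minus_part S) ** minus_part S = scale_mat (2 * \<i>) (adj S ** sympJ ** S)"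
  (is "?L = ?R")
proof (unfold vec_eq_iff, intro allI)
  fix i j
  have J: "(sympJ ** S) $ x $ j = (case x of Inl a \<Rightarrow> S $ Inr a $ j | Inr a \<Rightarrow> - S $ Inl a $ j)" for x
    by (cases x) (simp_all add: sympJ_def matrix_matrix_mult_def sum_UNIV_sum_type
        if_distrib[of "\<lambda>z. z * c" for c] cong: if_cong)
  have "?R $ i $ j = 2 * \<i> * (\<Sum>a\<in>UNIV. cnj (S $ Inl a $ i) * S $ Inr a $ j - cnj (S $ Inr a $ i) * S $ Inl a $ j)"
    unfolding matrix_mul_assoc[symmetric]
    by (subst matrix_matrix_mult_def[of "adj S"])
       (simp add: scale_mat_def J sum_UNIV_sum_type sum_subtractf sum_negf, simp add: adj_def)
  also have "\<dots> = ?L $ i $ j"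
    by (simp add: plus_part_def minus_part_def adj_def matrix_matrix_mult_def sum_distrib_left flip: sum_subtractf)
       (simp add: algebra_simps)
  finally show "?L $ i $ j = ?R $ i $ j" by simp
qed

lemma HSp_form:
  assumes "M \<in> HSp"
  shows "adj (plus_part (M ** S)) ** plus_part (M ** S) - adj (minus_part (M ** S)) ** minus_part (M ** S)
       = adj (plus_part S) ** plus_part S - adj (minus_part S) ** minus_part S"
proof -
  have "adj (M ** S) ** sympJ ** (M ** S) = adj S ** (adj M ** sympJ ** M) ** S"
    by (simp add: adj_mult matrix_mul_assoc)
  then show ?thesis
    using assms by (simp add: cayley_form HSp_def)
qed

lemma HSp_norm:
  fixes S :: "complex^'b^('m::finite + 'm)"
  assumes "M \<in> HSp"
  shows "(norm (plus_part (M ** S) *v v))\<^sup>2 - (norm (minus_part (M ** S) *v v))\<^sup>2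
       = (norm (plus_part S *v v))\<^sup>2 - (norm (minus_part S *v v))\<^sup>2"
proof -
  have *: "(norm (P *v v))\<^sup>2 - (norm (Q *v v))\<^sup>2 = Re (herm_dot v ((adj P ** P - adj Q ** Q) *v v))" for P Q :: "complex^'b^'m"
    by (simp add: norm_matrix_vector matrix_vector_mult_diff_rdistrib herm_dot_def sum_subtractf ring_distribs)
  show ?thesis
    unfolding * HSp_form[OF assms] ..
qed

lemma HSp_mult:
  assumes "M \<in> HSp" "M' \<in> HSp"
  shows "M' ** M \<in> HSp"
proof -
  have "adj (M' ** M) ** sympJ ** (M' ** M) = adj M ** (adj M' ** sympJ ** M') ** M"
    by (simp only: adj_mult matrix_mul_assoc)
  then show ?thesis
    using assms by (simp add: HSp_def invertible_mult)
qed

lemma mat_1_in_HSp [simp]: "mat 1 \<in> HSp"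
  by (simp add: HSp_def invertible_def)

lemma invertible_ker:
  fixes P :: "complex^'n^'n"
  assumes "\<And>v. P *v v = 0 \<Longrightarrow> v = 0"
  shows "invertible P"
  using assms by (simp add: invertible_left_inverse matrix_left_invertible_ker)

lemma matrix_vector_zero_iff_plus_part_minus_part:
  "S *v v = 0 \<longleftrightarrow> plus_part S *v v = 0 \<and> minus_part S *v v = 0"
  for S :: "complex^'n^('m::finite + 'm)"
proof -
  have 1: "(plus_part S *v v) $ a = (S *v v) $ Inl a + \<i> * (S *v v) $ Inr a"
    "(minus_part S *v v) $ a = (S *v v) $ Inl a - \<i> * (S *v v) $ Inr a" for a
    by (simp_all add: plus_part_def minus_part_def matrix_vector_mult_def sum_distrib_left flip: sum_subtractf sum.distrib)
       (simp_all add: algebra_simps)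
  have 2: "x + \<i> * y = 0 \<and> x - \<i> * y = 0 \<longleftrightarrow> x = 0 \<and> y = 0" for x y :: complex
    by (auto simp: complex_eq_iff)
  have "S *v v = 0 \<longleftrightarrow> (\<forall>a. (S *v v) $ Inl a = 0 \<and> (S *v v) $ Inr a = 0)"
    unfolding vec_eq_iff split_sum_all by (simp only: zero_index) blast
  also have "\<dots> \<longleftrightarrow> (\<forall>a. (plus_part S *v v) $ a = 0 \<and> (minus_part S *v v) $ a = 0)"
    by (simp only: 1 2)
  finally show ?thesis by (auto simp: vec_eq_iff)
qed

lemma matrix_eqI: "(\<And>i j. P $ i $ j = Q $ i $ j) \<Longrightarrow> P = Q" for P Q :: "'b^'n^'m"
  by (simp add: vec_eq_iff)

lemma symplectic_form_stack:
  "adj (stack X Y) ** sympJ ** stack X Y = adj X ** Y - adj Y ** X"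
proof (rule matrix_eqI)
  fix i j
  let ?S = "stack X Y"
  have J: "(sympJ ** ?S) $ x $ j = (case x of Inl a \<Rightarrow> Y $ a $ j | Inr a \<Rightarrow> - X $ a $ j)" for x
    by (cases x) (simp_all add: sympJ_def stack_def matrix_matrix_mult_def sum_UNIV_sum_type
        if_distrib[of "\<lambda>z. z * c" for c] cong: if_cong)
  have "(adj ?S ** (sympJ ** ?S)) $ i $ j = (adj X ** Y - adj Y ** X) $ i $ j"
    by (subst matrix_matrix_mult_def[of "adj ?S"])
       (simp add: J sum_UNIV_sum_type sum_negf, simp add: adj_def stack_def matrix_matrix_mult_def)
  then show "(adj ?S ** sympJ ** ?S) $ i $ j = (adj X ** Y - adj Y ** X) $ i $ j"
    by (simp add: matrix_mul_assoc)
qed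

lemma rank_full_iff_ker:
  fixes S :: "complex^'m^'n"
  shows "rank S = CARD('m) \<longleftrightarrow> (\<forall>v. S *v v = 0 \<longrightarrow> v = 0)"
proof -
  have "rank S = CARD('m) \<longleftrightarrow> vec.span (rows S) = UNIV"
    unfolding row_rank_def_gen vec.dim_eq_full[symmetric] by (simp add: vec.dimension_def card_cart_basis)
  then show ?thesis
    by (simp add: matrix_left_invertible_span_rows_gen[symmetric] matrix_left_invertible_ker)
qed

text \<open>The Lagrangian frames, in Cayley coordinates. Isotropy says that both coordinates have the same
  Gram matrix, so that full rank amounts to invertibility of one of them.\<close>
definition isotropic_frame :: "complex^'m^('m::finite + 'm) \<Rightarrow> bool" where
  "isotropic_frame S \<longleftrightarrow> invertible (minus_part S) \<and> adj (plus_part S) ** plus_part S = adj (minus_part S) ** minus_part S"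

lemma ker_invertible: "invertible P \<Longrightarrow> P *v v = 0 \<Longrightarrow> v = 0" for P :: "complex^'n^'n"
  by (metis invertible_left_inverse matrix_left_invertible_ker)

text \<open>A vector killed by the minus part has nonpositive form before the map and nonnegative
  form after it, so its image vanishes. The point is that all contractions are allowed here, and
  not only unitary matrices: they form a convex set, on which logarithms exist.\<close>
lemma HSp_minus_part_invertible:
  fixes P :: "complex^'m^'m"
  assumes M: "M \<in> HSp" and P: "\<And>v. norm (P *v v) \<le> norm v"
  shows "invertible (minus_part (M ** from_parts P (mat 1)))"
proof (rule invertible_ker)
  fix v assume v: "minus_part (M ** from_parts P (mat 1)) *v v = 0"
  have "(norm (plus_part (M ** from_parts P (mat 1)) *v v))\<^sup>2 - 0 = (norm (P *v v))\<^sup>2 - (norm v)\<^sup>2"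
    using HSp_norm[OF M, of "from_parts P (mat 1)" v] v by simp
  moreover have "(norm (P *v v))\<^sup>2 \<le> (norm v)\<^sup>2" using P[of v] by (simp add: power_mono)
  ultimately have "(norm (plus_part (M ** from_parts P (mat 1)) *v v))\<^sup>2 \<le> 0" by linarith
  then have "plus_part (M ** from_parts P (mat 1)) *v v = 0" by simp
  with v have "M *v (from_parts P (mat 1) *v v) = 0"
    by (simp add: matrix_vector_mul_assoc matrix_vector_zero_iff_plus_part_minus_part)
  then have "from_parts P (mat 1) *v v = 0"
    by (rule ker_invertible[rotated]) (use M in \<open>simp add: HSp_def\<close>)
  then show "v = 0" by (simp add: matrix_vector_zero_iff_plus_part_minus_part)
qed

lemma HSp_plus_part_invertible:
  fixes P :: "complex^'m^'m"
  assumes M: "M \<in> HSp" and P: "\<And>v. norm (P *v v) \<le> norm v"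
  shows "invertible (plus_part (M ** from_parts (mat 1) P))"
proof (rule invertible_ker)
  fix v assume v: "plus_part (M ** from_parts (mat 1) P) *v v = 0"
  have "0 - (norm (minus_part (M ** from_parts (mat 1) P) *v v))\<^sup>2 = (norm v)\<^sup>2 - (norm (P *v v))\<^sup>2"
    using HSp_norm[OF M, of "from_parts (mat 1) P" v] v by simp
  moreover have "(norm (P *v v))\<^sup>2 \<le> (norm v)\<^sup>2" using P[of v] by (simp add: power_mono)
  ultimately have "(norm (minus_part (M ** from_parts (mat 1) P) *v v))\<^sup>2 \<le> 0" by linarith
  then have "minus_part (M ** from_parts (mat 1) P) *v v = 0" by simp
  with v have "M *v (from_parts (mat 1) P *v v) = 0"
    by (simp add: matrix_vector_mul_assoc matrix_vector_zero_iff_plus_part_minus_part)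
  then have "from_parts (mat 1) P *v v = 0"
    by (rule ker_invertible[rotated]) (use M in \<open>simp add: HSp_def\<close>)
  then show "v = 0" by (simp add: matrix_vector_zero_iff_plus_part_minus_part)
qed

lemma norm_eq_if_gram_eq: "adj P ** P = adj Q ** Q \<Longrightarrow> norm (P *v v) = norm (Q *v v)"
  by (rule power2_eq_imp_eq) (simp_all add: norm_matrix_vector)

lemma lagrangian_frame_iff: "lagrangian_frame X Y \<longleftrightarrow> isotropic_frame (stack X Y)"
proof -
  let ?S = "stack X Y"
  have "adj X ** Y = adj Y ** X \<longleftrightarrow> adj ?S ** sympJ ** ?S = 0"
    by (simp add: symplectic_form_stack)
  also have "\<dots> \<longleftrightarrow> scale_mat (2 * \<i>) (adj ?S ** sympJ ** ?S) = 0"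
    by (simp add: scale_mat_def vec_eq_iff)
  also have "\<dots> \<longleftrightarrow> adj (plus_part ?S) ** plus_part ?S = adj (minus_part ?S) ** minus_part ?S"
    by (simp flip: cayley_form)
  finally have *: "adj X ** Y = adj Y ** X \<longleftrightarrow> adj (plus_part ?S) ** plus_part ?S = adj (minus_part ?S) ** minus_part ?S" .
  have "(\<forall>v. ?S *v v = 0 \<longrightarrow> v = 0) \<longleftrightarrow> invertible (minus_part ?S)"
    if "adj (plus_part ?S) ** plus_part ?S = adj (minus_part ?S) ** minus_part ?S"
  proof -
    have "plus_part ?S *v v = 0 \<longleftrightarrow> minus_part ?S *v v = 0" for v
      by (simp only: norm_eq_zero[of "plus_part ?S *v v", symmetric] norm_eq_zero[of "minus_part ?S *v v", symmetric]
          norm_eq_if_gram_eq[OF that, of v])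
    then show ?thesis
      using invertible_ker[of "minus_part ?S"] ker_invertible[of "minus_part ?S"]
      by (auto simp: matrix_vector_zero_iff_plus_part_minus_part)
  qed
  then have "(\<forall>v. ?S *v v = 0 \<longrightarrow> v = 0) \<and> adj (plus_part ?S) ** plus_part ?S = adj (minus_part ?S) ** minus_part ?S
    \<longleftrightarrow> invertible (minus_part ?S) \<and> adj (plus_part ?S) ** plus_part ?S = adj (minus_part ?S) ** minus_part ?S"
    by (intro iffI conjI; elim conjE; assumption?) blast+
  then show ?thesis
    unfolding lagrangian_frame_def isotropic_frame_def rank_full_iff_ker * .
qed

section \<open>Lagrangian subspaces and the Moebius action\<close>

definition cayley :: "complex^'m^('m::finite + 'm) \<Rightarrow> complex^'m^'m" where
  "cayley S = plus_part S ** matrix_inv (minus_part S)"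

lemma matrix_inv_inverse:
  assumes "invertible (B :: complex^'m^'m)"
  shows "B ** matrix_inv B = mat 1" "matrix_inv B ** B = mat 1"
  using someI_ex[OF assms[unfolded invertible_def]] by (simp_all add: matrix_inv_def)

lemma matrix_inv_cancel:
  fixes B :: "complex^'m^'m"
  assumes "invertible B"
  shows "P ** B ** matrix_inv B = P" "P ** matrix_inv B ** B = P"
  using matrix_inv_inverse[OF assms] by (simp_all flip: matrix_mul_assoc)

lemma cayley_eq_iff: "invertible (minus_part S) \<Longrightarrow> cayley S = W \<longleftrightarrow> plus_part S = W ** minus_part S"
  unfolding cayley_def using matrix_inv_cancel(1)[of "minus_part S" W] matrix_inv_cancel(2)[of "minus_part S" "plus_part S"] by auto

lemma cayley_mult: "invertible (minus_part S) \<Longrightarrow> invertible G \<Longrightarrow> cayley (S ** G) = cayley S"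
  by (subst cayley_eq_iff)
     (simp_all add: minus_part_mult invertible_mult plus_part_mult matrix_mul_assoc, simp add: cayley_def matrix_inv_cancel)

lemma cayley_unitary: "isotropic_frame S \<Longrightarrow> cayley S \<in> unitary_group"
proof (rule unitary_groupI)
  let ?B = "minus_part S"
  assume S: "isotropic_frame S"
  then have i: "invertible ?B" by (simp add: isotropic_frame_def)
  have "adj (cayley S) ** cayley S = adj (matrix_inv ?B) ** (adj (plus_part S) ** plus_part S) ** matrix_inv ?B"
    unfolding cayley_def by (simp only: adj_mult matrix_mul_assoc)
  also have "\<dots> = adj (?B ** matrix_inv ?B) ** (?B ** matrix_inv ?B)"
    using S unfolding isotropic_frame_def by (simp only: adj_mult matrix_mul_assoc)
  also have "\<dots> = mat 1" using matrix_inv_inverse[OF i] by simp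
  finally show "adj (cayley S) ** cayley S = mat 1" .
qed

lemma from_parts_isotropic: "W \<in> unitary_group \<Longrightarrow> isotropic_frame (from_parts W (mat 1))"
  by (simp add: isotropic_frame_def unitary_group_def) (simp add: invertible_def)

lemma matrix_inv_mat_1 [simp]: "matrix_inv (mat 1 :: complex^'m^'m) = mat 1"
  using matrix_inv_inverse(1)[of "mat 1"] by (simp add: invertible_def)

lemma cayley_from_parts [simp]: "cayley (from_parts W (mat 1)) = W"
  by (simp add: cayley_def)

lemma frame_eq_from_parts_cayley:
  assumes "invertible (minus_part S)"
  shows "S = from_parts (cayley S) (mat 1) ** minus_part S"
  using from_parts_plus_part_minus_part[of S] assms by (simp add: from_parts_mult cayley_def matrix_inv_cancel)

lemma range_mult_invertible:
  assumes "invertible (G :: complex^'n^'n)"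
  shows "range ((*v) (S ** G)) = range ((*v) S)"
proof -
  have "S *v v = (S ** G) *v (matrix_inv G *v v)" for v
    by (simp add: matrix_vector_mul_assoc matrix_inv_cancel assms)
  moreover have "(S ** G) *v v = S *v (G *v v)" for v by (simp add: matrix_vector_mul_assoc)
  ultimately show ?thesis by auto
qed

lemma column_eq_mult_axis: "column i S = S *v axis i 1" for S :: "complex^'n^'k"
  by (simp add: vec_eq_iff column_def matrix_vector_mult_def axis_def if_distrib[of "\<lambda>z. c * z" for c] cong: if_cong)

lemma frame_span_eq_range: "frame_span X Y = range ((*v) (stack X Y))"
proof -
  have "vec.span (columns S) = range ((*v) S)" for S :: "complex^'n^'k"
  proof
    have "columns S \<subseteq> range ((*v) S)"
      by (auto simp: columns_def column_eq_mult_axis)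
    then show "vec.span (columns S) \<subseteq> range ((*v) S)"
      by (rule vec.span_minimal) (rule vec.subspace_image[OF vec.subspace_UNIV])
    show "range ((*v) S) \<subseteq> vec.span (columns S)"
      using matrix_vector_mult_in_columnspace_gen by auto
  qed
  then show ?thesis by (simp add: frame_span_def)
qed

text \<open>Two frames of the same subspace differ by an invertible factor on the right, which cancels in the
  Cayley transform; hence \<open>unitary_of\<close> does not depend on the frame.\<close>
lemma range_eq_imp_factor:
  fixes S S' :: "complex^'m^'n"
  assumes "range ((*v) S') \<subseteq> range ((*v) S)"
  obtains G where "S' = S ** G"
proof -
  have "\<exists>g. \<forall>i. S' *v axis i 1 = S *v g i"
    using assms by (intro choice) blast
  then obtain g where g: "\<And>i. column i S' = S *v g i"
    by (auto simp: column_eq_mult_axis)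
  have "S' = S ** (\<chi> k i. g i $ k)"
  proof (rule matrix_eqI)
    fix a i
    show "S' $ a $ i = (S ** (\<chi> k i. g i $ k)) $ a $ i"
      using g[of i] by (simp add: vec_eq_iff column_def matrix_matrix_mult_def matrix_vector_mult_def)
  qed
  then show ?thesis by (rule that)
qed

lemma unitary_of_range:
  assumes "isotropic_frame S"
  shows "unitary_of (range ((*v) S)) = cayley S"
  unfolding unitary_of_def
proof (rule the_equality)
  obtain X Y where S: "S = stack X Y" using stack_surj by blast
  then show "\<exists>X Y. lagrangian_frame X Y \<and> range ((*v) S) = frame_span X Y \<and>
      cayley S = (X + scale_mat \<i> Y) ** matrix_inv (X - scale_mat \<i> Y)"
    using assms by (auto simp: lagrangian_frame_iff frame_span_eq_range cayley_def plus_part_stack minus_part_stack)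
next
  fix W assume "\<exists>X Y. lagrangian_frame X Y \<and> range ((*v) S) = frame_span X Y \<and>
      W = (X + scale_mat \<i> Y) ** matrix_inv (X - scale_mat \<i> Y)"
  then obtain S' where S': "isotropic_frame S'" "range ((*v) S) = range ((*v) S')" "W = cayley S'"
    by (auto simp: lagrangian_frame_iff frame_span_eq_range cayley_def plus_part_stack minus_part_stack)
  obtain G where G: "S = S' ** G" using S'(2) range_eq_imp_factor by (metis order_refl)
  have "minus_part S' ** G = minus_part S" using G by (simp add: minus_part_mult)
  then have "det (minus_part S') * det G = det (minus_part S)" by (simp flip: det_mul)
  then have "det G \<noteq> 0"
    using assms by (auto simp: isotropic_frame_def invertible_det_nz)
  then show "W = cayley S"
    using S' G by (simp add: cayley_mult isotropic_frame_def invertible_det_nz)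
qed

lemma lagrangian_iff: "lagrangian L \<longleftrightarrow> (\<exists>S. isotropic_frame S \<and> L = range ((*v) S))"
  unfolding lagrangian_def lagrangian_frame_iff frame_span_eq_range using stack_surj by metis

text \<open>Multiplying a frame on the right by the inverse of its minus part normalizes the minus part
  to the identity, and then the plus part is the unitary matrix itself.\<close>
lemma lagrangian_of_eq:
  fixes W :: "complex^'m^('m::finite)"
  assumes W: "W \<in> unitary_group"
  shows "lagrangian_of W = range ((*v) (from_parts W (mat 1)))"
proof -
  have rec: "L = range ((*v) (from_parts (unitary_of L) (mat 1)))" if lag: "lagrangian L" for L :: "(complex^('m+'m)) set"
  proof -
    obtain S where S: "isotropic_frame S" "L = range ((*v) S)" using lag by (auto simp: lagrangian_iff)
    have b: "invertible (minus_part S)" using S(1) by (simp add: isotropic_frame_def)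
    have "L = range ((*v) (from_parts (cayley S) (mat 1) ** minus_part S))"
      unfolding S(2) by (rule arg_cong[OF frame_eq_from_parts_cayley[OF b], of "\<lambda>S. range ((*v) S)"])
    also have "\<dots> = range ((*v) (from_parts (cayley S) (mat 1)))" by (rule range_mult_invertible[OF b])
    also have "cayley S = unitary_of L" unfolding S(2) by (rule unitary_of_range[OF S(1), symmetric])
    finally show ?thesis .
  qed
  show ?thesis
    unfolding lagrangian_of_def
  proof (rule the_inv_into_f_eq)
    show "inj_on unitary_of (Collect lagrangian :: (complex^('m+'m)) set set)"
      by (rule inj_onI) (metis rec mem_Collect_eq)
    show "unitary_of (range ((*v) (from_parts W (mat 1)))) = W"
      by (simp add: unitary_of_range from_parts_isotropic W)
    show "range ((*v) (from_parts W (mat 1))) \<in> Collect lagrangian"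
      using from_parts_isotropic[OF W] lagrangian_iff by blast
  qed
qed

definition moebius :: "complex^('m::finite + 'm)^('m + 'm) \<Rightarrow> complex^'m^'m \<Rightarrow> complex^'m^'m" where
  "moebius M W = cayley (M ** from_parts W (mat 1))"

lemma moebius_isotropic:
  assumes "M \<in> HSp" "W \<in> unitary_group"
  shows "isotropic_frame (M ** from_parts W (mat 1))"
  using HSp_form[OF assms(1), of "from_parts W (mat 1)"] assms HSp_minus_part_invertible[OF assms(1)]
  by (simp add: isotropic_frame_def unitary_group_norm) (simp add: unitary_group_def)

lemma cocycle_eq:
  assumes "range A \<subseteq> HSp" "W \<in> unitary_group"
  shows "cocycle T A (\<theta>, W) = (T \<theta>, moebius (A \<theta>) W)"
proof -
  have "(*v) (A \<theta>) ` lagrangian_of W = range ((*v) (A \<theta> ** from_parts W (mat 1)))"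
    by (simp add: lagrangian_of_eq assms(2) image_image matrix_vector_mul_assoc)
  moreover have "A \<theta> \<in> HSp" using assms(1) by auto
  ultimately show ?thesis
    using assms(2) by (simp add: cocycle_def unitary_of_range moebius_isotropic moebius_def)
qed

lemma moebius_unitary: "M \<in> HSp \<Longrightarrow> W \<in> unitary_group \<Longrightarrow> moebius M W \<in> unitary_group"
  by (simp add: moebius_def cayley_unitary moebius_isotropic)

lemma moebius_id [simp]: "moebius (mat 1) W = W"
  by (simp add: moebius_def)

lemma moebius_comp:
  assumes "M \<in> HSp" "M' \<in> HSp" "W \<in> unitary_group"
  shows "moebius M' (moebius M W) = moebius (M' ** M) W"
proof -
  let ?S = "M ** from_parts W (mat 1)"
  have b: "invertible (minus_part ?S)" using assms moebius_isotropic isotropic_frame_def by blast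
  have "M' ** M ** from_parts W (mat 1) = (M' ** from_parts (cayley ?S) (mat 1)) ** minus_part ?S"
    using arg_cong[OF frame_eq_from_parts_cayley[OF b], of "\<lambda>S. M' ** S"] by (simp only: matrix_mul_assoc)
  moreover have "invertible (minus_part (M' ** from_parts (cayley ?S) (mat 1)))"
    using moebius_isotropic[OF assms(2) moebius_unitary[OF assms(1,3)]] by (simp add: isotropic_frame_def moebius_def)
  ultimately show ?thesis using b by (simp add: moebius_def cayley_mult)
qed

section \<open>Topology of the unitary group\<close>

lemma continuous_on_matrix_mult [continuous_intros]:
  fixes f :: "'b::topological_space \<Rightarrow> complex^'n^'k" and g :: "'b \<Rightarrow> complex^'l^'n"
  assumes "continuous_on D f" "continuous_on D g"
  shows "continuous_on D (\<lambda>x. f x ** g x)"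
  unfolding matrix_matrix_mult_def by (intro continuous_intros assms)

lemma continuous_on_det [continuous_intros]:
  fixes f :: "'b::topological_space \<Rightarrow> complex^'n^'n"
  assumes "continuous_on D f"
  shows "continuous_on D (\<lambda>x. det (f x))"
  unfolding det_def by (intro continuous_intros assms)

lemma continuous_on_adj [continuous_intros]:
  assumes "continuous_on D f"
  shows "continuous_on D (\<lambda>x. adj (f x))"
  unfolding adj_def by (intro continuous_intros assms)

lemma continuous_on_scale_mat [continuous_intros]:
  assumes "continuous_on D c" "continuous_on D f"
  shows "continuous_on D (\<lambda>x. scale_mat (c x) (f x))"
  unfolding scale_mat_def by (intro continuous_intros assms)

lemma continuous_on_plus_part [continuous_intros]:
  assumes "continuous_on D f"
  shows "continuous_on D (\<lambda>x. plus_part (f x))"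
  unfolding plus_part_def vector_scalar_mult_def by (intro continuous_intros assms)

lemma continuous_on_minus_part [continuous_intros]:
  assumes "continuous_on D f"
  shows "continuous_on D (\<lambda>x. minus_part (f x))"
  unfolding minus_part_def vector_scalar_mult_def by (intro continuous_intros assms)

lemma continuous_on_from_parts [continuous_intros]:
  assumes "continuous_on D f" "continuous_on D g"
  shows "continuous_on D (\<lambda>x. from_parts (f x) (g x))"
proof -
  have "continuous_on D (\<lambda>x. case i of Inl a \<Rightarrow> (1/2) *s (f x $ a + g x $ a)
      | Inr a \<Rightarrow> (- \<i>/2) *s (f x $ a - g x $ a))" for i
    unfolding vector_scalar_mult_def
    by (cases i) (simp_all del: times_divide_eq_left mult_minus_left, (intro continuous_intros assms; simp)+)
  then show ?thesis unfolding from_parts_def by (rule continuous_on_vec_lambda)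
qed

lemma unitary_group_entry_le:
  assumes "W \<in> unitary_group"
  shows "norm (W $ i $ j) \<le> 1"
proof -
  have "norm (W $ i $ j) = norm ((W *v axis j 1) $ i)"
    unfolding column_eq_mult_axis[symmetric] by (simp add: column_def)
  also have "\<dots> \<le> norm (W *v axis j 1)" by (rule Finite_Cartesian_Product.norm_nth_le)
  also have "\<dots> = 1" by (simp add: unitary_group_norm assms norm_axis_1)
  finally show ?thesis .
qed

lemma compact_unitary_group: "compact (unitary_group :: (complex^'m^('m::finite)) set)"
proof -
  have "unitary_group = {W :: complex^'m^'m. adj W ** W = mat 1} \<inter> {W. W ** adj W = mat 1}"
    by (auto simp: unitary_group_def)
  moreover have "closed ({W :: complex^'m^'m. adj W ** W = mat 1} \<inter> {W. W ** adj W = mat 1})"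
    by (intro closed_Int closed_Collect_eq continuous_intros)
  ultimately have "closed (unitary_group :: (complex^'m^'m) set)" by (simp only:)
  moreover have "bounded (unitary_group :: (complex^'m^'m) set)"
  proof (rule boundedI)
    fix W :: "complex^'m^'m" assume W: "W \<in> unitary_group"
    have "norm (W $ i) \<le> real CARD('m)" for i
    proof -
      have "norm (W $ i) \<le> (\<Sum>j\<in>UNIV. norm (W $ i $ j))"
        unfolding norm_vec_def[of "W $ i"] by (rule L2_set_le_sum) simp
      also have "\<dots> \<le> (\<Sum>j\<in>(UNIV :: 'm set). 1)"
        by (intro sum_mono unitary_group_entry_le W)
      finally show ?thesis by simp
    qed
    then have "(\<Sum>i\<in>UNIV. norm (W $ i)) \<le> (\<Sum>i\<in>(UNIV :: 'm set). real CARD('m))"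
      by (intro sum_mono) auto
    then show "norm W \<le> real CARD('m) * real CARD('m)"
      unfolding norm_vec_def[of W] by (intro order_trans[OF L2_set_le_sum]) auto
  qed
  ultimately show ?thesis by (simp add: compact_eq_bounded_closed)
qed

lemma compact_special_unitary_group: "compact (special_unitary_group :: (complex^'m^('m::finite)) set)"
proof -
  have "special_unitary_group = unitary_group \<inter> {W :: complex^'m^'m. det W = 1}"
    by (auto simp: special_unitary_group_def)
  moreover have "closed {W :: complex^'m^'m. det W = 1}"
    by (intro closed_Collect_eq continuous_intros)
  ultimately show ?thesis using compact_Int_closed[OF compact_unitary_group] by metis
qed

lemma scale_mat_0 [simp]: "scale_mat 0 P = 0"
  by (simp add: scale_mat_def vec_eq_iff)

lemma matrix_mult_add_left: "(P + Q) ** R = P ** R + Q ** R" for P :: "complex^'n^'k"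
  by (simp add: matrix_matrix_mult_def vec_eq_iff ring_distribs sum.distrib)

lemma matrix_mult_diff_left: "(P - Q) ** R = P ** R - Q ** R" for P :: "complex^'n^'k"
  by (simp add: matrix_matrix_mult_def vec_eq_iff left_diff_distrib sum_subtractf)

lemma matrix_mult_diff_right: "R ** (P - Q) = R ** P - R ** Q" for P :: "complex^'n^'k"
  by (simp add: matrix_matrix_mult_def vec_eq_iff right_diff_distrib sum_subtractf)

text \<open>Continuity of matrix inversion is avoided: near a point \<open>x0\<close> the Cayley transform \<open>W\<close> satisfies
  \<open>W B(x0) - T(x0) = W (B(x0) - B(x)) + (T(x) - T(x0))\<close> for its numerator \<open>T\<close> and denominator \<open>B\<close>, and the
  right-hand side is small because the entries of the unitary matrix \<open>W\<close> are bounded by one.\<close>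
lemma continuous_on_cayley:
  fixes S :: "'b::topological_space \<Rightarrow> complex^'m^('m::finite + 'm)"
  assumes S: "continuous_on D S" and iso: "\<And>x. x \<in> D \<Longrightarrow> isotropic_frame (S x)"
  shows "continuous_on D (\<lambda>x. cayley (S x))"
  unfolding continuous_on_def
proof
  fix x0 assume x0: "x0 \<in> D"
  let ?F = "at x0 within D" and ?R = "matrix_inv (minus_part (S x0))"
  define E where "E x = cayley (S x) ** (minus_part (S x0) - minus_part (S x)) + (plus_part (S x) - plus_part (S x0))" for x
  have inv: "invertible (minus_part (S x))" if "x \<in> D" for x using iso[OF that] by (simp add: isotropic_frame_def)
  have eq: "cayley (S x) = cayley (S x0) + E x ** ?R" if "x \<in> D" for x
  proof -
    have "E x = cayley (S x) ** minus_part (S x0) - cayley (S x) ** minus_part (S x) + plus_part (S x) - plus_part (S x0)"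
      by (simp add: E_def matrix_mult_diff_right)
    also have "cayley (S x) ** minus_part (S x) = plus_part (S x)" using inv[OF that] by (simp add: cayley_def matrix_inv_cancel)
    finally have "E x ** ?R = cayley (S x) ** minus_part (S x0) ** ?R - plus_part (S x0) ** ?R"
      by (simp add: matrix_mult_diff_left)
    then show ?thesis
      by (simp add: matrix_inv_cancel inv x0) (simp add: cayley_def)
  qed
  have tb: "((\<lambda>x. minus_part (S x)) \<longlongrightarrow> minus_part (S x0)) ?F" "((\<lambda>x. plus_part (S x)) \<longlongrightarrow> plus_part (S x0)) ?F"
    using continuous_on_minus_part[OF S] continuous_on_plus_part[OF S] x0 by (auto simp: continuous_on_def)
  have small: "((\<lambda>x. (cayley (S x) ** (minus_part (S x0) - minus_part (S x))) $ i $ j) \<longlongrightarrow> 0) ?F" for i j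
    unfolding matrix_matrix_mult_def vec_lambda_beta
  proof (rule tendsto_null_sum)
    fix k
    have "((\<lambda>x. (minus_part (S x0) - minus_part (S x)) $ k $ j) \<longlongrightarrow> (minus_part (S x0) - minus_part (S x0)) $ k $ j) ?F"
      by (intro tendsto_intros tb)
    then have "((\<lambda>x. (minus_part (S x0) - minus_part (S x)) $ k $ j) \<longlongrightarrow> 0) ?F" by simp
    moreover have "\<forall>\<^sub>F x in ?F. norm (cayley (S x) $ i $ k * (minus_part (S x0) - minus_part (S x)) $ k $ j)
        \<le> norm ((minus_part (S x0) - minus_part (S x)) $ k $ j)"
      unfolding eventually_at_filter
      by (intro always_eventually allI impI) (simp add: norm_mult mult_left_le_one_le unitary_group_entry_le cayley_unitary iso)
    ultimately show "((\<lambda>x. cayley (S x) $ i $ k * (minus_part (S x0) - minus_part (S x)) $ k $ j) \<longlongrightarrow> 0) ?F"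
      by (rule Lim_null_comparison[OF _ tendsto_norm_zero, rotated])
  qed
  have "(E \<longlongrightarrow> 0 + (plus_part (S x0) - plus_part (S x0))) ?F"
    unfolding E_def by (intro tendsto_add tendsto_diff tb tendsto_const vec_tendstoI) (use small in simp)
  then have E0: "(E \<longlongrightarrow> 0) ?F" by simp
  have "((\<lambda>x. E x ** ?R) \<longlongrightarrow> 0 ** ?R) ?F"
    unfolding matrix_matrix_mult_def by (intro tendsto_intros E0)
  then have "((\<lambda>x. cayley (S x0) + E x ** ?R) \<longlongrightarrow> cayley (S x0) + 0) ?F"
    by (intro tendsto_intros) simp
  then have "((\<lambda>x. cayley (S x0) + E x ** ?R) \<longlongrightarrow> cayley (S x0)) ?F" by simp
  then show "((\<lambda>x. cayley (S x)) \<longlongrightarrow> cayley (S x0)) ?F"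
    by (rule Lim_transform_eventually) (auto simp: eventually_at_filter eq intro!: always_eventually)
qed

lemma continuous_on_moebius:
  fixes M :: "'b::topological_space \<Rightarrow> complex^('m::finite + 'm)^('m + 'm)"
  assumes "continuous_on D M" "continuous_on D W"
    and "\<And>x. x \<in> D \<Longrightarrow> M x \<in> HSp" "\<And>x. x \<in> D \<Longrightarrow> W x \<in> unitary_group"
  shows "continuous_on D (\<lambda>x. moebius (M x) (W x))"
  unfolding moebius_def using assms
  by (intro continuous_on_cayley continuous_intros moebius_isotropic) auto

section \<open>The phase of the determinant along the Moebius action\<close>

lemma det_affine_poly:
  fixes P Q :: "complex^'m^'m"
  obtains p where "degree p \<le> CARD('m)" "\<And>z. poly p z = det (P + scale_mat z Q)"
proof
  define p where "p = det (\<chi> i j. [:P $ i $ j, Q $ i $ j:])"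
  have "degree (\<Prod>i\<in>(UNIV :: 'm set). [:P $ i $ \<sigma> i, Q $ i $ \<sigma> i:]) \<le> CARD('m)" for \<sigma> :: "'m \<Rightarrow> 'm"
  proof -
    have "(\<Sum>i\<in>(UNIV :: 'm set). degree [:P $ i $ \<sigma> i, Q $ i $ \<sigma> i:]) \<le> (\<Sum>i\<in>(UNIV :: 'm set). 1)"
      by (intro sum_mono) simp
    then show ?thesis by (intro order_trans[OF degree_prod_sum_le]) auto
  qed
  moreover have "degree (of_int k * q) \<le> degree q" for k and q :: "complex poly"
    by (simp add: of_int_poly)
  ultimately show "degree p \<le> CARD('m)"
    unfolding p_def det_def by (intro degree_sum_le) (auto intro: order_trans)
  show "poly p z = det (P + scale_mat z Q)" for z
    unfolding p_def det_def by (simp add: poly_sum poly_prod scale_mat_def)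
qed

lemma continuous_on_Ints_constant:
  fixes f :: "'b::topological_space \<Rightarrow> real"
  assumes "connected S" "continuous_on S f" "\<And>x. x \<in> S \<Longrightarrow> f x \<in> \<int>" "x \<in> S" "y \<in> S"
  shows "f x = f y"
proof -
  have "f constant_on S"
  proof (rule continuous_discrete_range_constant[OF assms(1,2)])
    fix x assume x: "x \<in> S"
    have "1 \<le> norm (f y - f x)" if "y \<in> S" "f y \<noteq> f x" for y
    proof -
      have "f y - f x \<in> \<int>" "f y - f x \<noteq> 0" using assms(3) x that by auto
      then show ?thesis using Ints_nonzero_abs_ge1[of "f y - f x"] by simp
    qed
    then show "\<exists>e>0. \<forall>y. y \<in> S \<and> f y \<noteq> f x \<longrightarrow> e \<le> norm (f y - f x)"
      by (intro exI[of _ 1]) auto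
  qed
  then show ?thesis using assms(4,5) by (auto simp: constant_on_def)
qed

text \<open>Every linear factor \<open>1 - t/z\<close> with \<open>|z| > 1\<close> stays in the right half plane for \<open>0 \<le> t \<le> 1\<close>, so it
  contributes less than \<open>pi/2\<close> to the variation of the argument. The bound depends on
  the degree alone.\<close>
lemma poly_log_variation:
  fixes p :: "complex poly" and L :: "real \<Rightarrow> complex"
  assumes "continuous_on {0..1} L" "\<And>t. t \<in> {0..1} \<Longrightarrow> exp (L t) = poly p (of_real t)"
    and "\<And>z. norm z \<le> 1 \<Longrightarrow> poly p z \<noteq> 0"
  shows "\<bar>Im (L 1) - Im (L 0)\<bar> \<le> pi * degree p"
  using assms
proof (induction "degree p" arbitrary: p L)
  case 0
  then obtain c where p: "p = [:c:]" by (metis degree_eq_zeroE)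
  define k where "k t = (Im (L t) - Im (L 0)) / (2 * pi)" for t
  have "k 1 = k 0"
  proof (rule continuous_on_Ints_constant[where S = "{0..1}" and f = k])
    show "continuous_on {0..1} k" unfolding k_def by (intro continuous_intros 0) auto
    show "k t \<in> \<int>" if "t \<in> {0..1}" for t
    proof -
      have "exp (L t) = exp (L 0)" using 0(3)[of t] 0(3)[of 0] that p by simp
      then obtain n :: int where "L t = L 0 + of_int (2 * n) * of_real pi * \<i>" by (auto simp: exp_eq)
      then have "k t = of_int n" by (simp add: k_def)
      then show ?thesis by simp
    qed
  qed auto
  then have "Im (L 1) - Im (L 0) = 0" by (simp add: k_def)
  then show ?case by simp
next
  case (Suc n)
  then obtain z where z: "poly p z = 0"
    using fundamental_theorem_of_algebra[of p] by (metis constant_degree old.nat.distinct(1))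
  then obtain q where q: "p = [:-z, 1:] * q" by (auto simp: poly_eq_0_iff_dvd)
  have nz: "norm z > 1" using z Suc.prems(3) by (metis not_le)
  then have z0: "z \<noteq> 0" by auto
  define r where "r = smult (-z) q"
  have "q \<noteq> 0" using Suc.hyps q by auto
  then have "degree p = degree [:-z, 1:] + degree q"
    unfolding q by (intro degree_mult_eq) auto
  then have deg: "degree r = n" using Suc.hyps(2) z0 by (simp add: r_def)
  have pr: "poly p w = (1 - w / z) * poly r w" for w
    using z0 by (simp add: q r_def field_simps)
  have Re: "Re (1 - of_real t / z) > 0" if "t \<in> {0..1}" for t :: real
  proof -
    have "Re (of_real t / z) \<le> norm (of_real t / z)" by (rule complex_Re_le_cmod)
    also have "\<dots> < 1" using that nz z0 by (simp add: norm_divide)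
    finally show ?thesis by simp
  qed
  define L' where "L' t = L t - Ln (1 - of_real t / z)" for t :: real
  have "\<bar>Im (L' 1) - Im (L' 0)\<bar> \<le> pi * degree r"
  proof (rule Suc.hyps(1))
    show "n = degree r" by (simp add: deg)
    show "continuous_on {0..1} L'" unfolding L'_def
    proof (intro continuous_intros Suc.prems)
      show "1 - complex_of_real t / z \<notin> \<real>\<^sub>\<le>\<^sub>0" if "t \<in> {0..1}" for t
        using Re[OF that] by (auto simp: complex_nonpos_Reals_iff)
    qed (use z0 in auto)
    show "exp (L' t) = poly r (of_real t)" if t: "t \<in> {0..1}" for t
    proof -
      have ne: "1 - of_real t / z \<noteq> 0" using Re[OF t] by auto
      then have "exp (L' t) = poly p (of_real t) / (1 - of_real t / z)"
        unfolding L'_def exp_diff using Suc.prems(2)[OF t] by simp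
      then show ?thesis using ne unfolding pr by (metis nonzero_mult_div_cancel_left)
    qed
    show "poly r w \<noteq> 0" if "norm w \<le> 1" for w
      using Suc.prems(3)[OF that] by (auto simp: pr)
  qed
  moreover have "\<bar>Im (Ln (1 - of_real t / z))\<bar> < pi / 2" if "t \<in> {0..1}" for t
    using Re[OF that] Re_Ln_pos_lt[of "1 - of_real t / z"] by (metis norm_zero order_less_irrefl zero_complex.simps(1))
  from this[of 0] this[of 1] have "\<bar>Im (Ln (1 - of_real 1 / z)) - Im (Ln (1 - of_real 0 / z))\<bar> \<le> pi" by auto
  ultimately have "\<bar>Im (L 1) - Im (L 0)\<bar> \<le> pi * n + pi" unfolding deg L'_def by simp
  then show ?case using Suc.hyps(2) by (simp flip: Suc.hyps(2) add: ring_distribs)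
qed

text \<open>This convex set contains the unitary group and is mapped into itself by multiplication with scalars
  from the closed unit disc, so it is reached from \<open>0\<close> along segments.\<close>
definition contractions :: "(complex^'m^'m) set" where
  "contractions = {Z. \<forall>v. norm (Z *v v) \<le> norm v}"

lemma convex_contractions: "convex (contractions :: (complex^'m^('m::finite)) set)"
proof (rule convexI)
  fix X Y :: "complex^'m^'m" and a b :: real
  assume XY: "X \<in> contractions" "Y \<in> contractions" and ab: "0 \<le> a" "0 \<le> b" "a + b = 1"
  show "a *\<^sub>R X + b *\<^sub>R Y \<in> contractions"
    unfolding contractions_def
  proof (intro CollectI allI)
    fix v
    have "(a *\<^sub>R X + b *\<^sub>R Y) *v v = a *\<^sub>R (X *v v) + b *\<^sub>R (Y *v v)"
      by (simp add: vec_eq_iff matrix_vector_mult_def sum.distrib ring_distribs scaleR_sum_right)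
    also have "norm \<dots> \<le> a * norm (X *v v) + b * norm (Y *v v)"
      using ab by (intro order_trans[OF norm_triangle_ineq]) simp
    also have "\<dots> \<le> a * norm v + b * norm v"
      using XY ab by (intro add_mono mult_left_mono) (auto simp: contractions_def)
    also have "\<dots> = norm v" using ab by (simp flip: distrib_right)
    finally show "norm ((a *\<^sub>R X + b *\<^sub>R Y) *v v) \<le> norm v" .
  qed
qed

lemma scale_mat_mult_vec: "scale_mat z Z *v v = z *s (Z *v v)"
  by (simp add: vec_eq_iff matrix_vector_mult_def scale_mat_def sum_distrib_left mult.assoc)

lemma norm_vector_smult: "norm (z *s v) = norm z * norm v" for v :: "complex^'n"
  by (simp add: norm_vec_def norm_mult L2_set_def power_mult_distrib real_sqrt_mult flip: sum_distrib_left)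

lemma contractions_scale: "Z \<in> contractions \<Longrightarrow> norm z \<le> 1 \<Longrightarrow> scale_mat z Z \<in> contractions"
  by (auto simp: contractions_def scale_mat_mult_vec norm_vector_smult intro!: order_trans[OF mult_left_le_one_le])

lemma unitary_contraction: "W \<in> unitary_group \<Longrightarrow> W \<in> contractions"
  by (simp add: contractions_def unitary_group_norm)

text \<open>Along the segment from \<open>0\<close> to \<open>Z\<close> the determinant is a polynomial of degree at most \<open>m\<close> in the
  parameter, and it has no zero in the closed unit disc because the disc multiples of \<open>Z\<close> are contractions.\<close>
lemma log_det_bounded_variation:
  fixes G :: "complex^'m^'m \<Rightarrow> complex^'m^('m::finite)"
  assumes cont: "continuous_on contractions G"
    and aff: "\<And>Z z. G (scale_mat z Z) = G 0 + scale_mat z (H Z)"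
    and nz: "\<And>Z. Z \<in> contractions \<Longrightarrow> det (G Z) \<noteq> 0"
  obtains L where "continuous_on contractions L"
    "\<And>Z. Z \<in> contractions \<Longrightarrow> det (G Z) = exp (L Z)"
    "\<And>Z. Z \<in> contractions \<Longrightarrow> \<bar>Im (L Z) - Im (L 0)\<bar> \<le> pi * CARD('m)"
proof -
  obtain L where L: "continuous_on contractions L" "\<And>Z. Z \<in> contractions \<Longrightarrow> det (G Z) = exp (L Z)"
    using continuous_logarithm_on_contractible[OF continuous_on_det[OF cont] convex_imp_contractible[OF convex_contractions] nz]
    by auto
  have "\<bar>Im (L Z) - Im (L 0)\<bar> \<le> pi * CARD('m)" if Z: "Z \<in> contractions" for Z
  proof -
    obtain p where p: "degree p \<le> CARD('m)" "\<And>z. poly p z = det (G 0 + scale_mat z (H Z))"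
      using det_affine_poly by blast
    have seg: "scale_mat (of_real t) Z \<in> contractions" if "t \<in> {0..1}" for t
      using contractions_scale[OF Z] that by auto
    have "\<bar>Im (L (scale_mat (of_real 1) Z)) - Im (L (scale_mat (of_real 0) Z))\<bar> \<le> pi * degree p"
    proof (rule poly_log_variation)
      show "continuous_on {0..1} (\<lambda>t. L (scale_mat (complex_of_real t) Z))"
        by (rule continuous_on_compose2[OF L(1)]) (auto intro!: continuous_intros seg)
      show "exp (L (scale_mat (of_real t) Z)) = poly p (of_real t)" if "t \<in> {0..1}" for t
        using L(2)[OF seg[OF that]] by (simp add: p(2) aff)
      show "poly p z \<noteq> 0" if "norm z \<le> 1" for z
        unfolding p(2) aff[symmetric] by (intro nz contractions_scale Z that)
    qed
    moreover have "scale_mat 0 Z = 0" by (simp add: scale_mat_def vec_eq_iff)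
    ultimately have "\<bar>Im (L Z) - Im (L 0)\<bar> \<le> pi * degree p" by simp
    also have "\<dots> \<le> pi * CARD('m)" using p(1) by simp
    finally show ?thesis .
  qed
  then show ?thesis using that L by blast
qed

lemma from_parts_scale: "from_parts (scale_mat z P) (scale_mat z Q) = scale_mat z (from_parts P Q)"
  by (simp add: from_parts_def scale_mat_def vec_eq_iff field_simps split: sum.split)
lemma plus_part_scale: "plus_part (scale_mat z S) = scale_mat z (plus_part S)"
  by (simp add: plus_part_def scale_mat_def vec_eq_iff field_simps)
lemma minus_part_scale: "minus_part (scale_mat z S) = scale_mat z (minus_part S)"
  by (simp add: minus_part_def scale_mat_def vec_eq_iff field_simps)

lemma from_parts_affine:
  "from_parts (scale_mat z Z) (mat 1) = from_parts 0 (mat 1) + scale_mat z (from_parts Z 0)"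
  "from_parts (mat 1) (scale_mat z Z) = from_parts (mat 1) 0 + scale_mat z (from_parts 0 Z)"
proof -
  have 0: "scale_mat z 0 = 0" by (simp add: scale_mat_def vec_eq_iff)
  show "from_parts (scale_mat z Z) (mat 1) = from_parts 0 (mat 1) + scale_mat z (from_parts Z 0)"
    "from_parts (mat 1) (scale_mat z Z) = from_parts (mat 1) 0 + scale_mat z (from_parts 0 Z)"
    by (simp_all flip: from_parts_scale from_parts_add add: 0)
qed

text \<open>Since \<open>aW + b = (a + b W^*) W\<close>, the determinant of \<open>(aW + b) (cW + d)^(-1)\<close> is \<open>det W\<close> times the
  quotient of \<open>det (a + b W^*)\<close> and \<open>det (cW + d)\<close>, and both have logarithms on contractions. What matters later is
  that the bound on the oscillation is the same for all elements of \<open>HSp\<close>: it is applied to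
  the iterates of the cocycle.\<close>
lemma moebius_det_phase:
  fixes M :: "complex^('m::finite + 'm)^('m + 'm)"
  assumes M: "M \<in> HSp"
  obtains \<phi> where "continuous_on unitary_group \<phi>"
    "\<And>W. W \<in> unitary_group \<Longrightarrow> det (moebius M W) = det W * cis (\<phi> W)"
    "\<And>W W'. W \<in> unitary_group \<Longrightarrow> W' \<in> unitary_group \<Longrightarrow> \<bar>\<phi> W - \<phi> W'\<bar> \<le> 4 * pi * CARD('m)"
proof -
  obtain L1 where L1: "continuous_on contractions L1"
    "\<And>Z. Z \<in> contractions \<Longrightarrow> det (plus_part (M ** from_parts (mat 1) Z)) = exp (L1 Z)"
    "\<And>Z. Z \<in> contractions \<Longrightarrow> \<bar>Im (L1 Z) - Im (L1 0)\<bar> \<le> pi * CARD('m)"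
  proof (rule log_det_bounded_variation)
    show "plus_part (M ** from_parts (mat 1) (scale_mat z Z))
        = plus_part (M ** from_parts (mat 1) 0) + scale_mat z (plus_part (M ** from_parts 0 Z))" for z Z
      by (simp add: from_parts_affine matrix_add_ldistrib plus_part_add scale_mat_mult_right plus_part_scale)
    show "det (plus_part (M ** from_parts (mat 1) Z)) \<noteq> 0" if "Z \<in> contractions" for Z
      using HSp_plus_part_invertible[OF M] that by (simp add: contractions_def flip: invertible_det_nz)
    show "continuous_on contractions (\<lambda>Z. plus_part (M ** from_parts (mat 1) Z))"
      by (intro continuous_intros)
  qed blast
  obtain L2 where L2: "continuous_on contractions L2"
    "\<And>Z. Z \<in> contractions \<Longrightarrow> det (minus_part (M ** from_parts Z (mat 1))) = exp (L2 Z)"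
    "\<And>Z. Z \<in> contractions \<Longrightarrow> \<bar>Im (L2 Z) - Im (L2 0)\<bar> \<le> pi * CARD('m)"
  proof (rule log_det_bounded_variation)
    show "minus_part (M ** from_parts (scale_mat z Z) (mat 1))
        = minus_part (M ** from_parts 0 (mat 1)) + scale_mat z (minus_part (M ** from_parts Z 0))" for z Z
      by (simp add: from_parts_affine matrix_add_ldistrib minus_part_add scale_mat_mult_right minus_part_scale)
    show "det (minus_part (M ** from_parts Z (mat 1))) \<noteq> 0" if "Z \<in> contractions" for Z
      using HSp_minus_part_invertible[OF M] that by (simp add: contractions_def flip: invertible_det_nz)
    show "continuous_on contractions (\<lambda>Z. minus_part (M ** from_parts Z (mat 1)))"
      by (intro continuous_intros)
  qed blast
  define \<phi> where "\<phi> W = Im (L1 (adj W)) - Im (L2 W)" for W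
  show thesis
  proof
    have adjc: "adj W \<in> contractions" if "W \<in> unitary_group" for W :: "complex^'m^'m"
      using that by (intro unitary_contraction adj_in_unitary_group)
    show "continuous_on unitary_group \<phi>"
      unfolding \<phi>_def
      by (intro continuous_intros continuous_on_compose2[OF L1(1)] continuous_on_subset[OF L2(1)])
         (auto intro: adjc unitary_contraction)
    show "\<bar>\<phi> W - \<phi> W'\<bar> \<le> 4 * pi * CARD('m)" if "W \<in> unitary_group" "W' \<in> unitary_group" for W W'
      using L1(3)[OF adjc[OF that(1)]] L1(3)[OF adjc[OF that(2)]]
        L2(3)[OF unitary_contraction[OF that(1)]] L2(3)[OF unitary_contraction[OF that(2)]]
      unfolding \<phi>_def by (simp add: abs_le_iff)
    show "det (moebius M W) = det W * cis (\<phi> W)" if W: "W \<in> unitary_group" for W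
    proof -
      let ?S = "M ** from_parts W (mat 1)"
      have inv: "invertible (minus_part ?S)" using moebius_isotropic[OF M W] by (simp add: isotropic_frame_def)
      have "?S = (M ** from_parts (mat 1) (adj W)) ** W"
        using W by (simp add: from_parts_mult unitary_group_def flip: matrix_mul_assoc)
      then have "plus_part ?S = plus_part (M ** from_parts (mat 1) (adj W)) ** W" by (metis plus_part_mult)
      then have "det (plus_part ?S) = exp (L1 (adj W)) * det W"
        by (simp add: det_mul L1(2) adjc W)
      moreover have "moebius M W ** minus_part ?S = plus_part ?S"
        using inv by (simp add: moebius_def cayley_def matrix_inv_cancel)
      then have "det (moebius M W) * det (minus_part ?S) = det (plus_part ?S)" by (metis det_mul)
      ultimately have "det (moebius M W) * exp (L2 W) = exp (L1 (adj W)) * det W"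
        by (simp add: L2(2) unitary_contraction W)
      then have *: "det (moebius M W) = det W * exp (L1 (adj W) - L2 W)"
        by (simp add: exp_diff field_simps)
      have "norm (det (moebius M W)) = 1" "norm (det W) = 1"
        using unitary_group_det moebius_unitary M W by blast+
      then have "norm (exp (L1 (adj W) - L2 W)) = 1" unfolding * by (simp add: norm_mult)
      then have "Re (L1 (adj W) - L2 W) = 0" by simp
      then have "exp (L1 (adj W) - L2 W) = cis (\<phi> W)"
        by (simp add: \<phi>_def exp_eq_polar)
      then show ?thesis using * by simp
    qed
  qed
qed

section \<open>Connectedness of the unitary groups\<close>

lemma path_component_image_interval:
  fixes h :: "real \<Rightarrow> 'b::topological_space"
  assumes "continuous_on {0..1} h" "\<And>t. t \<in> {0..1} \<Longrightarrow> h t \<in> U"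
  shows "path_component U (h 0) (h 1)"
  unfolding path_component_def path_def path_image_def pathstart_def pathfinish_def
  using assms by blast

text \<open>If \<open>-1\<close> is not an eigenvalue of \<open>W\<close>, then \<open>W\<close> is the Cayley transform of a skew-Hermitian
  matrix \<open>K\<close>, and the transforms of \<open>tK\<close> form a path from the identity to \<open>W\<close>. Clearing denominators gives
  \<open>((1 - t) + (1 + t) W) ((1 + t) + (1 - t) W)^(-1)\<close>, in which only the
  denominator at \<open>t = 0\<close> uses the condition on eigenvalues.\<close>
lemma unitary_path_to_1:
  fixes W :: "complex^'m^('m::finite)"
  assumes W: "W \<in> unitary_group" and inv: "invertible (mat 1 + W)"
  shows "path_component unitary_group (mat 1) W"
proof -
  define P where "P t = scale_mat (of_real (1 - t)) (mat 1) + scale_mat (of_real (1 + t)) W" for t :: real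
  define Q where "Q t = scale_mat (of_real (1 + t)) (mat 1) + scale_mat (of_real (1 - t)) W" for t :: real
  have invQ: "invertible (Q t)" if t: "t \<in> {0..1}" for t
  proof (cases "t = 0")
    case True
    then show ?thesis using inv by (simp add: Q_def)
  next
    case False
    show ?thesis
    proof (rule invertible_ker)
      fix v assume "Q t *v v = 0"
      then have "of_real (1 + t) *s v + of_real (1 - t) *s (W *v v) = 0"
        by (simp add: Q_def matrix_vector_mult_add_rdistrib scale_mat_mult_vec)
      then have "of_real (1 + t) *s v = - (of_real (1 - t) *s (W *v v))"
        by (rule eq_neg_iff_add_eq_0[THEN iffD2])
      then have "norm (of_real (1 + t) *s v) = norm (of_real (1 - t) *s (W *v v))"
        by (simp only: norm_minus_cancel)
      then have "(1 + t) * norm v = (1 - t) * norm v"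
        using t unfolding norm_vector_smult norm_of_real unitary_group_norm[OF W] by simp
      then show "v = 0" using False by simp
    qed
  qed
  have gram: "adj (P t) ** P t = adj (Q t) ** Q t" for t
  proof (rule matrix_eqI)
    have expand: "adj (scale_mat (of_real a) (mat 1) + scale_mat (of_real b) W)
        ** (scale_mat (of_real a) (mat 1) + scale_mat (of_real b) W)
      = scale_mat (of_real (a\<^sup>2 + b\<^sup>2)) (mat 1) + scale_mat (of_real (a * b)) (W + adj W)" for a b :: real
    proof -
      have ad: "adj (X + Y) = adj X + adj Y" for X Y :: "complex^'m^'m" by (simp add: adj_def vec_eq_iff)
      have "adj W ** W = mat 1" using W by (simp add: unitary_group_def)
      then show ?thesis
        by (simp add: ad adj_scale_mat matrix_add_ldistrib matrix_mult_add_left scale_mat_mult_left scale_mat_mult_right scale_mat_scale_mat)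
           (simp add: scale_mat_def vec_eq_iff algebra_simps power2_eq_square)
    qed
    fix i j
    show "(adj (P t) ** P t) $ i $ j = (adj (Q t) ** Q t) $ i $ j"
      unfolding P_def Q_def expand by (simp add: algebra_simps)
  qed
  have iso: "isotropic_frame (from_parts (P t) (Q t))" if "t \<in> {0..1}" for t
    using gram invQ[OF that] by (simp add: isotropic_frame_def)
  have "path_component unitary_group (cayley (from_parts (P 0) (Q 0))) (cayley (from_parts (P 1) (Q 1)))"
  proof (rule path_component_image_interval)
    show "continuous_on {0..1} (\<lambda>t. cayley (from_parts (P t) (Q t)))"
      unfolding P_def Q_def
      by (intro continuous_on_cayley continuous_intros) (use iso in \<open>simp add: P_def Q_def\<close>)
  qed (intro cayley_unitary iso)
  moreover have "cayley (from_parts (P 0) (Q 0)) = mat 1"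
    using invQ[of 0] by (simp add: cayley_eq_iff) (simp add: P_def Q_def)
  moreover have "cayley (from_parts (P 1) (Q 1)) = W"
    using invQ[of 1] by (simp add: cayley_eq_iff) (simp add: P_def Q_def scale_mat_mult_right)
  ultimately show ?thesis by simp
qed

text \<open>Only finitely many unit scalars \<open>z\<close> make \<open>1 + zW\<close> singular, so a rotation of \<open>W\<close> by a suitable
  scalar reaches the preceding case.\<close>
lemma connected_unitary_group: "connected (unitary_group :: (complex^'m^('m::finite)) set)"
proof -
  have "path_component unitary_group (mat 1) W" if W: "W \<in> unitary_group" for W :: "complex^'m^'m"
  proof -
    obtain p where p: "\<And>z. poly p z = det (mat 1 + scale_mat z W)"
      using det_affine_poly by metis
    have "poly p 0 = 1" by (simp add: p scale_mat_def det_I flip: zero_vec_def)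
    then have "p \<noteq> 0" by auto
    then have fin: "finite {z. poly p z = 0}" by (rule poly_roots_finite)
    have "inj_on cis {0<..<1}"
    proof (rule inj_onI)
      fix x y :: real assume xy: "x \<in> {0<..<1}" "y \<in> {0<..<1}" "cis x = cis y"
      then have "cos x = cos y" by (metis cis.simps(1))
      then show "x = y" using cos_inj_pi[of x y] xy pi_gt3 by auto
    qed
    then have "infinite (cis ` {0<..<1})"
      using finite_imageD[of cis "{0<..<1}"] infinite_Ioo[OF zero_less_one[where 'a = real]] by blast
    then obtain a where a: "poly p (cis a) \<noteq> 0"
      using fin finite_subset[of "cis ` {0<..<1}" "{z. poly p z = 0}"] by auto
    have "path_component unitary_group (mat 1) (scale_mat (cis a) W)"
      using a by (intro unitary_path_to_1 unitary_group_scale W) (simp_all add: p invertible_det_nz)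
    moreover have "path_component unitary_group (scale_mat (cis ((1 - 0) * a)) W) (scale_mat (cis ((1 - 1) * a)) W)"
    proof (rule path_component_image_interval)
      show "continuous_on {0..1} (\<lambda>t. scale_mat (cis ((1 - t) * a)) W)"
        by (intro continuous_intros)
    qed (intro unitary_group_scale W, simp)
    ultimately show ?thesis by (simp add: path_component_trans)
  qed
  then have "path_connected (unitary_group :: (complex^'m^'m) set)"
    unfolding path_connected_component by (meson path_component_sym path_component_trans)
  then show ?thesis by (rule path_connected_imp_connected)
qed

text \<open>Dividing one column by the determinant retracts the unitary group onto the special unitary group.\<close>
lemma connected_special_unitary_group: "connected (special_unitary_group :: (complex^'m^('m::finite)) set)"
proof -
  obtain i0 :: 'm where True by simp
  define D :: "complex^'m^'m \<Rightarrow> complex^'m^'m"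
    where "D W = (\<chi> i j. if i = j then (if i = i0 then cnj (det W) else 1) else 0)" for W
  have detW: "cnj (det W) * det W = 1" if "W \<in> unitary_group" for W :: "complex^'m^'m"
    using unitary_group_det[OF that] by (metis complex_norm_square mult.commute of_real_1 power_one)
  have detD: "det (D W) = cnj (det W)" for W
    by (subst det_diagonal) (auto simp: D_def prod.delta)
  have DD: "D W \<in> unitary_group" if "W \<in> unitary_group" for W
  proof (rule unitary_groupI, rule matrix_eqI)
    fix i j
    have "(adj (D W) ** D W) $ i $ j = (\<Sum>k\<in>UNIV. if k = i then (if i = j then (if i = i0 then cnj (det W) * det W else 1) else 0) else 0)"
      unfolding matrix_matrix_mult_def adj_def vec_lambda_beta by (intro sum.cong refl) (auto simp: D_def)
    then show "(adj (D W) ** D W) $ i $ j = mat 1 $ i $ j"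
      using detW[OF that] by (simp add: mat_def)
  qed
  have "continuous_on unitary_group (\<lambda>W. W ** D W)"
  proof -
    have "continuous_on unitary_group (\<lambda>W. D W)"
      unfolding D_def
    proof (intro continuous_on_vec_lambda)
      show "continuous_on unitary_group (\<lambda>W. if i = j then (if i = i0 then cnj (det W) else 1) else (0::complex))" for i j
        by (cases "i = j"; cases "i = i0") (auto intro!: continuous_intros)
    qed
    then show ?thesis by (intro continuous_intros)
  qed
  then have "connected ((\<lambda>W. W ** D W) ` unitary_group)"
    by (rule connected_continuous_image) (rule connected_unitary_group)
  also have "(\<lambda>W. W ** D W) ` unitary_group = special_unitary_group"
  proof (intro equalityI subsetI)
    fix S assume "S \<in> (\<lambda>W. W ** D W) ` unitary_group"
    then show "S \<in> special_unitary_group"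
      using detW DD by (auto simp: special_unitary_group_def unitary_group_mult det_mul detD mult.commute)
  next
    fix S :: "complex^'m^'m" assume S: "S \<in> special_unitary_group"
    then have "D S = mat 1" by (simp add: D_def special_unitary_group_def mat_def vec_eq_iff)
    then show "S \<in> (\<lambda>W. W ** D W) ` unitary_group"
      using S by (intro image_eqI[of _ _ S]) (auto simp: special_unitary_group_def)
  qed
  finally show ?thesis .
qed

section \<open>Weak sequential compactness of probability measures\<close>

text \<open>The indicator of a closed set is a decreasing limit of continuous functions of the distance to it.\<close>
lemma prob_measure_eqI_continuous:
  fixes M N :: "'b::metric_space measure"
  assumes M: "prob_space M" "sets M = sets borel" and N: "prob_space N" "sets N = sets borel"
    and eq: "\<And>h :: 'b \<Rightarrow> real. continuous_on UNIV h \<Longrightarrow> (\<And>x. h x \<in> {0..1}) \<Longrightarrow> (\<integral>x. h x \<partial>M) = (\<integral>x. h x \<partial>N)"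
  shows "M = N"
proof -
  interpret M: prob_space M by fact
  interpret N: prob_space N by fact
  have lim: "(\<lambda>n. \<integral>x. max 0 (1 - real n * infdist x C) \<partial>L) \<longlonglongrightarrow> measure L C"
    if L: "prob_space L" "sets L = sets borel" and C: "closed C" "C \<noteq> {}" for L :: "'b measure" and C
  proof -
    interpret L: prob_space L by fact
    have sp: "space L = UNIV" using L(2) by (metis sets_eq_imp_space_eq space_borel)
    have CL: "C \<in> sets L" using C L(2) by auto
    have "(\<lambda>n. \<integral>x. max 0 (1 - real n * infdist x C) \<partial>L) \<longlonglongrightarrow> (\<integral>x. indicator C x \<partial>L)"
    proof (rule integral_dominated_convergence)
      show "(\<lambda>x. indicator C x :: real) \<in> borel_measurable L" using CL by simp
      show "(\<lambda>x. max 0 (1 - real n * infdist x C)) \<in> borel_measurable L" for n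
        unfolding measurable_cong_sets[OF L(2) refl]
        by (intro borel_measurable_continuous_onI continuous_intros)
      show "integrable L (\<lambda>x. 1 :: real)" by simp
      show "AE x in L. norm (max 0 (1 - real n * infdist x C)) \<le> 1" for n
        by (auto simp: infdist_nonneg)
      show "AE x in L. (\<lambda>n. max 0 (1 - real n * infdist x C)) \<longlonglongrightarrow> indicator C x"
      proof (rule AE_I2)
        fix x
        show "(\<lambda>n. max 0 (1 - real n * infdist x C)) \<longlonglongrightarrow> indicator C x"
        proof (cases "x \<in> C")
          case True
          then show ?thesis by simp
        next
          case False
          then have pos: "infdist x C > 0"
            using C by (metis in_closed_iff_infdist_zero infdist_nonneg order_le_imp_less_or_eq)
          obtain n0 :: nat where n0: "1 / infdist x C \<le> n0" using real_arch_simple by blast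
          have "max 0 (1 - real n * infdist x C) = 0" if "n \<ge> n0" for n
          proof -
            have "1 / infdist x C \<le> real n" using n0 that by linarith
            then show ?thesis using pos by (simp add: field_simps)
          qed
          then show ?thesis using False by (intro tendsto_eventually eventually_sequentiallyI[of n0]) simp
        qed
      qed
    qed
    then show ?thesis using CL sp by simp
  qed
  have closed_eq: "measure M C = measure N C" if C: "closed C" for C
  proof (cases "C = {}")
    case False
    have "(\<integral>x. max 0 (1 - real n * infdist x C) \<partial>M) = (\<integral>x. max 0 (1 - real n * infdist x C) \<partial>N)" for n
      by (intro eq continuous_intros) (auto simp: infdist_nonneg)
    then show ?thesis
      using lim[OF M C False] lim[OF N C False] LIMSEQ_unique by simp
  qed simp
  show ?thesis
  proof (rule measure_eqI_generator_eq[of "Collect closed" UNIV _ _ "\<lambda>_. UNIV"])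
    show "Int_stable (Collect closed :: 'b set set)" by (auto simp: Int_stable_def)
    show "emeasure M C = emeasure N C" if "C \<in> Collect closed" for C
      using closed_eq that by (simp add: M.emeasure_eq_measure N.emeasure_eq_measure)
    show "sets M = sigma_sets UNIV (Collect closed)" "sets N = sigma_sets UNIV (Collect closed)"
      unfolding M(2) N(2) by (subst borel_eq_closed, simp)+
  qed (auto simp: M.emeasure_eq_measure)
qed

lemma prob_measure_eqI_continuous_on:
  fixes M N :: "'b::metric_space measure"
  assumes M: "prob_space M" "sets M = sets (restrict_space borel X)"
    and N: "prob_space N" "sets N = sets (restrict_space borel X)"
    and eq: "\<And>h :: 'b \<Rightarrow> real. continuous_on X h \<Longrightarrow> (\<integral>x. h x \<partial>M) = (\<integral>x. h x \<partial>N)"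
  shows "M = N"
proof -
  have id: "(\<lambda>x. x) \<in> L \<rightarrow>\<^sub>M borel" if "sets L = sets (restrict_space borel X)" for L :: "'b measure"
    unfolding measurable_cong_sets[OF that refl] by (intro measurable_restrict_space1) simp
  have d: "distr M borel (\<lambda>x. x) = distr N borel (\<lambda>x. x)"
  proof (rule prob_measure_eqI_continuous)
    show "(\<integral>x. h x \<partial>distr M borel (\<lambda>x. x)) = (\<integral>x. h x \<partial>distr N borel (\<lambda>x. x))"
      if h: "continuous_on UNIV h" for h :: "'b \<Rightarrow> real"
      using eq[OF continuous_on_subset[OF h subset_UNIV]] borel_measurable_continuous_onI[OF h]
      by (simp add: integral_distr id M N)
  qed (auto intro!: prob_space.prob_space_distr id M N)
  show ?thesis
  proof (rule measure_eqI)
    fix A assume "A \<in> sets M"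
    then obtain B where B: "A = X \<inter> B" "B \<in> sets borel" by (auto simp: M(2) sets_restrict_space)
    have "emeasure (distr L borel (\<lambda>x. x)) B = emeasure L A"
      if "sets L = sets (restrict_space borel X)" for L :: "'b measure"
    proof -
      have "space L = X" using sets_eq_imp_space_eq[OF that] by (simp add: space_restrict_space)
      then show ?thesis using B by (simp add: emeasure_distr id that Int_commute)
    qed
    from this[OF M(2)] this[OF N(2)] show "emeasure M A = emeasure N A" by (simp add: d)
  qed (simp add: M N)
qed

text \<open>The point of the Cantor set whose ternary digits record which of the sets \<open>B n\<close> contain \<open>x\<close>.\<close>
definition ternary_code :: "(nat \<Rightarrow> 'b set) \<Rightarrow> 'b \<Rightarrow> real" where
  "ternary_code B x = (\<Sum>n. 2 * indicator (B n) x * (1/3) ^ Suc n)"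

lemma ternary_geometric: "(\<lambda>n. 2 * (1/3::real) ^ Suc n) sums 1"
  using sums_mult[OF geometric_sums[of "1/3::real"], of "2/3"] by simp

lemma ternary_code_summable: "summable (\<lambda>n. 2 * indicator (B n) x * (1/3::real) ^ Suc n)"
  by (rule summable_comparison_test'[OF sums_summable[OF ternary_geometric], of 0])
     (simp add: indicator_def)

lemma ternary_code_bounds: "0 \<le> ternary_code B x" "ternary_code B x \<le> 1"
proof -
  show "0 \<le> ternary_code B x"
    unfolding ternary_code_def by (intro suminf_nonneg ternary_code_summable) simp
  have "ternary_code B x \<le> (\<Sum>n. 2 * (1/3::real) ^ Suc n)"
    unfolding ternary_code_def
    by (intro suminf_le ternary_code_summable sums_summable[OF ternary_geometric]) (simp add: indicator_def)
  then show "ternary_code B x \<le> 1" using sums_unique[OF ternary_geometric] by simp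
qed

text \<open>With the digits \<open>0\<close> and \<open>2\<close> the first disagreement outweighs all later digits.\<close>
lemma ternary_code_close:
  assumes "\<bar>ternary_code B x - ternary_code B y\<bar> < (1/3) ^ n" "j < n"
  shows "x \<in> B j \<longleftrightarrow> y \<in> B j"
proof (rule ccontr)
  assume "(x \<in> B j) \<noteq> (y \<in> B j)"
  then obtain i where i: "(x \<in> B i) \<noteq> (y \<in> B i)" "\<And>k. k < i \<Longrightarrow> (x \<in> B k) = (y \<in> B k)" "i \<le> j"
    using exists_least_iff[of "\<lambda>j. (x \<in> B j) \<noteq> (y \<in> B j)"] by (metis not_le)
  define d where "d k = 2 * indicator (B k) x * (1/3::real) ^ Suc k - 2 * indicator (B k) y * (1/3) ^ Suc k" for k
  have sd: "summable d" unfolding d_def by (intro summable_diff ternary_code_summable)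
  have dle: "\<bar>d k\<bar> \<le> 2 * (1/3) ^ Suc k" for k by (simp add: d_def indicator_def)
  have "ternary_code B x - ternary_code B y = suminf d"
    unfolding ternary_code_def d_def by (rule suminf_diff[OF ternary_code_summable ternary_code_summable])
  also have "\<dots> = (\<Sum>k. d (k + Suc i)) + sum d {..<Suc i}"
    by (rule suminf_split_initial_segment[OF sd])
  also have "sum d {..<Suc i} = d i" using i(2) by (simp add: d_def indicator_def)
  finally have eq: "ternary_code B x - ternary_code B y = (\<Sum>k. d (k + Suc i)) + d i" .
  have tail: "(\<lambda>k. (1/3) ^ Suc i * (2 * (1/3::real) ^ Suc k)) sums ((1/3) ^ Suc i * 1)"
    by (rule sums_mult[OF ternary_geometric])
  have "\<bar>\<Sum>k. d (k + Suc i)\<bar> \<le> (\<Sum>k. (1/3) ^ Suc i * (2 * (1/3::real) ^ Suc k))"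
  proof -
    have le: "norm (d (k + Suc i)) \<le> (1/3) ^ Suc i * (2 * (1/3::real) ^ Suc k)" for k
      using dle[of "k + Suc i"] by (simp add: power_add mult_ac)
    have "norm (\<Sum>k. d (k + Suc i)) \<le> (\<Sum>k. (1/3) ^ Suc i * (2 * (1/3::real) ^ Suc k))"
      by (rule norm_suminf_le[OF le sums_summable[OF tail]])
    then show ?thesis by simp
  qed
  then have "\<bar>\<Sum>k. d (k + Suc i)\<bar> \<le> (1/3) ^ Suc i" using sums_unique[OF tail] by simp
  moreover have "\<bar>d i\<bar> = 2 * (1/3) ^ Suc i" using i(1) by (auto simp: d_def indicator_def)
  ultimately have "\<bar>ternary_code B x - ternary_code B y\<bar> \<ge> (1/3) ^ Suc i" unfolding eq by linarith
  moreover have "(1/3::real) ^ n \<le> (1/3) ^ Suc i" using i(3) assms(2) by (intro power_decreasing) auto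
  ultimately show False using assms(1) by linarith
qed

lemma ternary_code_measurable:
  assumes "\<And>n. B n \<in> sets M"
  shows "ternary_code B \<in> borel_measurable M"
  unfolding ternary_code_def by (intro borel_measurable_suminf) (use assms in measurable)

lemma compact_separating_sets:
  fixes X :: "'b::metric_space set"
  assumes "compact X"
  obtains B :: "nat \<Rightarrow> 'b set" where "\<And>n. open (B n)"
    "\<And>e. e > 0 \<Longrightarrow> \<exists>n. \<forall>x\<in>X. \<exists>j<n. x \<in> B j \<and> (\<forall>y\<in>B j. dist x y < e)"
proof -
  have "\<exists>C. finite C \<and> X \<subseteq> (\<Union>c\<in>C. ball c (1 / real (Suc k)))" for k
    by (rule compactE_image[OF assms, of X "\<lambda>c. ball c (1 / real (Suc k))"]) force+
  then obtain C where C: "\<And>k. finite (C k)" "\<And>k. X \<subseteq> (\<Union>c\<in>C k. ball c (1 / real (Suc k)))" by metis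
  define \<B> where "\<B> = insert {} (\<Union>k. (\<lambda>c. ball c (1 / real (Suc k))) ` C k)"
  have cnt: "countable \<B>" unfolding \<B>_def
    by (simp only: countable_insert_eq) (intro countable_UN countable_image countable_finite C(1) countableI_type)
  have ne: "\<B> \<noteq> {}" by (simp add: \<B>_def)
  define B where "B = from_nat_into \<B>"
  show thesis
  proof
    show "open (B n)" for n
    proof -
      have "B n \<in> \<B>" unfolding B_def by (rule from_nat_into[OF ne])
      then show ?thesis by (auto simp: \<B>_def)
    qed
    fix e :: real assume "e > 0"
    then obtain k where k: "1 / real (Suc k) < e / 2" using nat_approx_posE half_gt_zero by metis
    define F where "F = (\<lambda>c. ball c (1 / real (Suc k))) ` C k"
    define n where "n = Suc (Max (insert 0 (to_nat_on \<B> ` F)))"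
    have "\<exists>j<n. x \<in> B j \<and> (\<forall>y\<in>B j. dist x y < e)" if x: "x \<in> X" for x
    proof -
      obtain c where c: "c \<in> C k" "x \<in> ball c (1 / real (Suc k))" using C(2)[of k] x by auto
      let ?b = "ball c (1 / real (Suc k))"
      have b: "?b \<in> F" "?b \<in> \<B>" using c(1) by (auto simp: F_def \<B>_def)
      have "to_nat_on \<B> ?b \<le> Max (insert 0 (to_nat_on \<B> ` F))"
        using b(1) C(1) by (intro Max_ge) (auto simp: F_def)
      then have "to_nat_on \<B> ?b < n" by (simp add: n_def)
      moreover have "B (to_nat_on \<B> ?b) = ?b" unfolding B_def by (rule from_nat_into_to_nat_on[OF cnt b(2)])
      moreover have "dist x y < e" if "y \<in> ?b" for y
      proof -
        have "dist x y \<le> dist c x + dist c y" by (metis dist_commute dist_triangle)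
        then show ?thesis using c(2) that k by auto
      qed
      ultimately show ?thesis using c(2) by metis
    qed
    then show "\<exists>n. \<forall>x\<in>X. \<exists>j<n. x \<in> B j \<and> (\<forall>y\<in>B j. dist x y < e)" by blast
  qed
qed

text \<open>The coding \<open>s\<close> need not be continuous, but its inverse is uniformly continuous on \<open>s ` X\<close>, and hence extends to
  the closure by compactness of \<open>X\<close>.\<close>
lemma coding_inverse:
  fixes X :: "'b::metric_space set" and s :: "'b \<Rightarrow> real"
  assumes X: "compact X"
    and sep: "\<And>e. e > 0 \<Longrightarrow> \<exists>d>0. \<forall>x\<in>X. \<forall>y\<in>X. \<bar>s x - s y\<bar> < d \<longrightarrow> dist x y < e"
  obtains g where "continuous_on (closure (s ` X)) g" "g ` closure (s ` X) \<subseteq> X" "\<And>x. x \<in> X \<Longrightarrow> g (s x) = x"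
proof -
  \<comment> \<open>\<open>x\<close> is a limit of points whose codes converge to \<open>t\<close>.\<close>
  define R where "R t x \<longleftrightarrow> x \<in> X \<and> (\<exists>u. (\<forall>n. u n \<in> X) \<and> (\<lambda>n. s (u n)) \<longlonglongrightarrow> t \<and> u \<longlonglongrightarrow> x)" for t x
  have ex: "\<exists>x. R t x" if t: "t \<in> closure (s ` X)" for t
  proof -
    obtain v where v: "\<forall>n. v n \<in> s ` X" "v \<longlonglongrightarrow> t" using t unfolding closure_sequential by blast
    then have "\<forall>n. \<exists>x. x \<in> X \<and> v n = s x" by auto
    then obtain u where u: "\<And>n. u n \<in> X" "\<And>n. v n = s (u n)" by metis
    obtain x r where r: "x \<in> X" "strict_mono r" "(u \<circ> r) \<longlonglongrightarrow> x"
      using X u(1) unfolding compact_def by metis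
    have "(\<lambda>n. s ((u \<circ> r) n)) \<longlonglongrightarrow> t"
      using LIMSEQ_subseq_LIMSEQ[OF v(2) r(2)] by (simp add: o_def u(2))
    then have "R t x" unfolding R_def using r u(1) by (auto intro!: exI[of _ "u \<circ> r"])
    then show ?thesis ..
  qed
  have close: "dist x x' \<le> e"
    if d: "\<forall>x\<in>X. \<forall>y\<in>X. \<bar>s x - s y\<bar> < d \<longrightarrow> dist x y < e" and Rx: "R t x" and Rx': "R t' x'" and tt: "\<bar>t - t'\<bar> < d" for x x' t t' d e
  proof -
    obtain u where u: "\<And>n. u n \<in> X" "(\<lambda>n. s (u n)) \<longlonglongrightarrow> t" "u \<longlonglongrightarrow> x" using Rx R_def by auto
    obtain u' where u': "\<And>n. u' n \<in> X" "(\<lambda>n. s (u' n)) \<longlonglongrightarrow> t'" "u' \<longlonglongrightarrow> x'" using Rx' R_def by auto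
    have "(\<lambda>n. \<bar>s (u n) - s (u' n)\<bar>) \<longlonglongrightarrow> \<bar>t - t'\<bar>" by (intro tendsto_intros u u')
    then have "\<forall>\<^sub>F n in sequentially. \<bar>s (u n) - s (u' n)\<bar> < d" using tt by (rule order_tendstoD)
    then have "\<forall>\<^sub>F n in sequentially. dist (u n) (u' n) \<le> e"
      by (rule eventually_mono) (use d u(1) u'(1) in \<open>auto intro: less_imp_le\<close>)
    then show ?thesis
      by (intro tendsto_upperbound[OF tendsto_dist[OF u(3) u'(3)]]) auto
  qed
  define g where "g t = (SOME x. R t x)" for t
  have Rg: "R t (g t)" if "t \<in> closure (s ` X)" for t
    unfolding g_def by (rule someI_ex[OF ex[OF that]])
  show thesis
  proof
    show "g ` closure (s ` X) \<subseteq> X" using Rg R_def by auto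
    show "continuous_on (closure (s ` X)) g"
      unfolding continuous_on_iff
    proof (intro ballI allI impI)
      fix t and e :: real assume t: "t \<in> closure (s ` X)" and e: "e > 0"
      obtain d where d: "d > 0" "\<forall>x\<in>X. \<forall>y\<in>X. \<bar>s x - s y\<bar> < d \<longrightarrow> dist x y < e / 2"
        using sep[of "e / 2"] e by auto
      have "dist (g t') (g t) < e" if "t' \<in> closure (s ` X)" "dist t' t < d" for t'
        using close[OF d(2) Rg[OF that(1)] Rg[OF t]] that(2) e by (simp add: dist_real_def)
      then show "\<exists>d>0. \<forall>t'\<in>closure (s ` X). dist t' t < d \<longrightarrow> dist (g t') (g t) < e" using d(1) by blast
    qed
    show "g (s x) = x" if x: "x \<in> X" for x
    proof -
      have "R (s x) x" unfolding R_def using x by (auto intro!: exI[of _ "\<lambda>_. x"])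
      moreover have "R (s x) (g (s x))" by (intro Rg closure_subset[THEN subsetD] imageI x)
      ultimately have "dist (g (s x)) x \<le> e" if "e > 0" for e
        using sep[OF that] close[of _ e "s x" "g (s x)" "s x" x] by auto
      then have "dist (g (s x)) x \<le> 0" by (rule field_le_epsilon[of _ 0, simplified])
      then show ?thesis by simp
    qed
  qed
qed

lemma compact_coding:
  fixes X :: "'b::metric_space set"
  assumes "compact X"
  obtains s :: "'b \<Rightarrow> real" and g where "s \<in> borel_measurable borel" "\<And>x. s x \<in> {0..1}"
    "continuous_on (closure (s ` X)) g" "g ` closure (s ` X) \<subseteq> X" "\<And>x. x \<in> X \<Longrightarrow> g (s x) = x"
proof -
  obtain B :: "nat \<Rightarrow> 'b set" where B: "\<And>n. open (B n)"
    "\<And>e. e > 0 \<Longrightarrow> \<exists>n. \<forall>x\<in>X. \<exists>j<n. x \<in> B j \<and> (\<forall>y\<in>B j. dist x y < e)"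
    using compact_separating_sets[OF assms] by blast
  have "\<exists>d>0. \<forall>x\<in>X. \<forall>y\<in>X. \<bar>ternary_code B x - ternary_code B y\<bar> < d \<longrightarrow> dist x y < e" if e: "e > 0" for e
  proof -
    obtain n where n: "\<And>x. x \<in> X \<Longrightarrow> \<exists>j<n. x \<in> B j \<and> (\<forall>y\<in>B j. dist x y < e)" using B(2)[OF e] by blast
    have "dist x y < e" if "x \<in> X" "y \<in> X" "\<bar>ternary_code B x - ternary_code B y\<bar> < (1/3) ^ n" for x y
      using n[OF that(1)] ternary_code_close[OF that(3)] by blast
    then show ?thesis by (intro exI[of _ "(1/3) ^ n"]) auto
  qed
  then obtain g where "continuous_on (closure (ternary_code B ` X)) g" "g ` closure (ternary_code B ` X) \<subseteq> X"
      "\<And>x. x \<in> X \<Longrightarrow> g (ternary_code B x) = x"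
    using coding_inverse[OF assms] by blast
  moreover have "ternary_code B \<in> borel_measurable borel" using B(1) by (intro ternary_code_measurable) auto
  ultimately show thesis using that ternary_code_bounds by (metis atLeastAtMost_iff)
qed

text \<open>The coding moves the measures to the unit interval, where Helly's theorem applies, and the continuous
  inverse moves the limit back. Its domain is closed and carries all the coded
  measures, so the limit measure lives there as well.\<close>
lemma weak_sequential_compactness:
  fixes P :: "nat \<Rightarrow> 'b::metric_space measure"
  assumes X: "compact X" and P: "\<And>n. prob_space (P n)" "\<And>n. sets (P n) = sets (restrict_space borel X)"
  obtains r N where "strict_mono (r :: nat \<Rightarrow> nat)" "prob_space N" "sets N = sets (restrict_space borel X)"
    "\<And>h :: 'b \<Rightarrow> real. continuous_on X h \<Longrightarrow> (\<lambda>n. \<integral>x. h x \<partial>P (r n)) \<longlonglongrightarrow> (\<integral>x. h x \<partial>N)"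
proof -
  interpret P: prob_space "P n" for n by (rule P)
  have spP: "space (P n) = X" for n using sets_eq_imp_space_eq[OF P(2)] by (simp add: space_restrict_space)
  obtain x0 where x0: "x0 \<in> X" using P.not_empty[of 0] spP by auto
  obtain s :: "'b \<Rightarrow> real" and g where s: "s \<in> borel_measurable borel" "\<And>x. s x \<in> {0..1}"
    and g: "continuous_on (closure (s ` X)) g" "g ` closure (s ` X) \<subseteq> X" "\<And>x. x \<in> X \<Longrightarrow> g (s x) = x"
    using compact_coding[OF X] by blast
  let ?K = "closure (s ` X)"
  have sP: "s \<in> borel_measurable (P n)" for n
    unfolding measurable_cong_sets[OF P(2) refl] by (intro measurable_restrict_space1 s)
  define Q where "Q n = distr (P n) borel s" for n
  have rd: "real_distribution (Q n)" for n unfolding Q_def by (rule P.real_distribution_distr[OF sP])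
  have "tight Q"
    unfolding tight_def
  proof (intro conjI allI impI rd)
    fix e :: real assume e: "e > 0"
    have "measure (Q n) {-1<..1} = 1" for n
    proof -
      have "s -` {-1<..1} \<inter> space (P n) = space (P n)" using s(2) by force
      then show ?thesis unfolding Q_def by (simp add: measure_distr sP P.prob_space)
    qed
    then show "\<exists>a b. a < b \<and> (\<forall>n. 1 - e < measure (Q n) {a<..b})"
      using e by (intro exI[of _ "-1"] exI[of _ 1]) simp
  qed
  then obtain r L where r: "strict_mono r" and L: "real_distribution L" "weak_conv_m (Q \<circ> id \<circ> r) L"
    using tight_imp_convergent_subsubsequence[of Q id] strict_mono_id by auto
  interpret L: real_distribution L by (rule L)
  have conv: "(\<lambda>n. \<integral>x. H (s x) \<partial>P (r n)) \<longlonglongrightarrow> (\<integral>t. H t \<partial>L)"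
    if H: "continuous_on UNIV H" "\<And>t. norm (H t) \<le> C" for H :: "real \<Rightarrow> real" and C
  proof -
    have iso: "isCont H t" for t using H(1) by (simp add: continuous_on_eq_continuous_at)
    have "(\<lambda>n. \<integral>t. H t \<partial>((Q \<circ> id \<circ> r) n)) \<longlonglongrightarrow> (\<integral>t. H t \<partial>L)"
      by (rule weak_conv_imp_integral_bdd_continuous_conv[OF _ L(1) L(2) iso H(2)]) (simp add: rd)
    moreover have "(\<integral>t. H t \<partial>Q n) = (\<integral>x. H (s x) \<partial>P n)" for n
      unfolding Q_def using borel_measurable_continuous_onI[OF H(1)] by (intro integral_distr sP) simp
    ultimately show ?thesis by simp
  qed
  have AEK: "AE t in L. t \<in> ?K"
  proof -
    \<comment> \<open>A bounded continuous function that vanishes exactly on the domain of the inverse.\<close>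
    let ?H = "\<lambda>t. min 1 (infdist t ?K)"
    have Hc: "continuous_on UNIV ?H" by (intro continuous_intros)
    have "(\<lambda>n. \<integral>x. ?H (s x) \<partial>P (r n)) \<longlonglongrightarrow> (\<integral>t. ?H t \<partial>L)"
      by (rule conv[OF Hc, of 1]) (auto simp: infdist_nonneg)
    moreover have "(\<integral>x. ?H (s x) \<partial>P n) = 0" for n
    proof -
      have "?H (s x) = 0" if "x \<in> space (P n)" for x
      proof -
        have "s x \<in> ?K" using that spP by (intro closure_subset[THEN subsetD] imageI) simp
        then show ?thesis by simp
      qed
      then have "(\<integral>x. ?H (s x) \<partial>P n) = (\<integral>x. 0 \<partial>P n)" by (intro Bochner_Integration.integral_cong) auto
      then show ?thesis by simp
    qed
    ultimately have "(\<integral>t. ?H t \<partial>L) = 0" by (simp add: LIMSEQ_const_iff)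
    moreover have "integrable L ?H"
      using borel_measurable_continuous_onI[OF Hc]
      by (intro L.integrable_const_bound[of _ 1]) (auto simp: infdist_nonneg)
    ultimately have "AE t in L. ?H t = 0"
      by (subst (asm) integral_nonneg_eq_0_iff_AE) (auto simp: infdist_nonneg)
    then show ?thesis
    proof eventually_elim
      case (elim t)
      then have "infdist t ?K = 0" by (simp add: min_def split: if_splits)
      moreover have "?K \<noteq> {}" using x0 by auto
      ultimately show ?case by (simp add: in_closed_iff_infdist_zero)
    qed
  qed
  define g' where "g' t = (if t \<in> ?K then g t else x0)" for t
  have g'm: "g' \<in> L \<rightarrow>\<^sub>M restrict_space borel X"
  proof (rule measurable_restrict_space2)
    show "g' \<in> space L \<rightarrow> X" using g(2) x0 by (auto simp: g'_def image_subset_iff)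
    have "g \<in> borel_measurable (restrict_space borel ?K)"
      using g(1) by (rule borel_measurable_continuous_on_restrict)
    then have "g' \<in> borel_measurable borel"
      unfolding g'_def by (subst (asm) measurable_restrict_space_iff) auto
    then show "g' \<in> borel_measurable L" by simp
  qed
  define N where "N = distr L (restrict_space borel X) g'"
  show thesis
  proof (rule that[OF r])
    show "prob_space N" unfolding N_def by (rule L.prob_space_distr[OF g'm])
    show "sets N = sets (restrict_space borel X)" by (simp add: N_def)
    fix h :: "'b \<Rightarrow> real" assume h: "continuous_on X h"
    have "bounded (h ` X)" by (rule compact_imp_bounded[OF compact_continuous_image[OF h X]])
    then obtain C where C: "\<And>x. x \<in> X \<Longrightarrow> norm (h x) \<le> C" by (auto simp: bounded_iff)
    have C0: "0 \<le> C" using C[OF x0] norm_ge_zero order_trans by blast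
    obtain H where H: "continuous_on UNIV H" "\<And>t. t \<in> ?K \<Longrightarrow> H t = h (g t)" "\<And>t. norm (H t) \<le> C"
    proof (rule Tietze[of ?K "\<lambda>t. h (g t)" UNIV C])
      show "continuous_on ?K (\<lambda>t. h (g t))" by (rule continuous_on_compose2[OF h g(1,2)])
      show "norm (h (g t)) \<le> C" if "t \<in> ?K" for t using that g(2) C by blast
    qed (use C0 in auto)
    have "(\<integral>x. H (s x) \<partial>P n) = (\<integral>x. h x \<partial>P n)" for n
      using closure_subset[of "s ` X"] by (intro Bochner_Integration.integral_cong) (auto simp: spP H(2) g(3))
    moreover have "(\<integral>t. H t \<partial>L) = (\<integral>x. h x \<partial>N)"
    proof -
      have "(\<integral>x. h x \<partial>N) = (\<integral>t. h (g' t) \<partial>L)"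
        unfolding N_def by (rule integral_distr[OF g'm borel_measurable_continuous_on_restrict[OF h]])
      also have "\<dots> = (\<integral>t. H t \<partial>L)"
      proof (rule integral_cong_AE)
        show "(\<lambda>t. h (g' t)) \<in> borel_measurable L"
          by (rule measurable_compose[OF g'm borel_measurable_continuous_on_restrict[OF h]])
        show "H \<in> borel_measurable L" using borel_measurable_continuous_onI[OF H(1)] by simp
        show "AE t in L. h (g' t) = H t" using AEK by eventually_elim (simp add: g'_def H(2))
      qed
      finally show ?thesis ..
    qed
    ultimately show "(\<lambda>n. \<integral>x. h x \<partial>P (r n)) \<longlonglongrightarrow> (\<integral>x. h x \<partial>N)"
      using conv[OF H(1,3)] by simp
  qed
qed

section \<open>Invariant measures as limits of averages along orbits\<close>

lemma funpow_maps_into: "\<Phi> ` X \<subseteq> X \<Longrightarrow> x \<in> X \<Longrightarrow> (\<Phi> ^^ j) x \<in> X"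
  by (induction j) auto

lemma continuous_on_funpow:
  fixes \<Phi> :: "'b::topological_space \<Rightarrow> 'b"
  assumes "continuous_on X \<Phi>" "\<Phi> ` X \<subseteq> X"
  shows "continuous_on X (\<Phi> ^^ j)"
proof (induction j)
  case (Suc j)
  have "continuous_on X (\<Phi> \<circ> (\<Phi> ^^ j))"
    using Suc assms funpow_maps_into[OF assms(2)]
    by (intro continuous_on_compose continuous_on_subset[OF assms(1)]) auto
  then show ?case by simp
qed (simp add: id_def)

text \<open>The average is the law of \<open>(\<Phi> ^^ j) x\<close> for independent \<open>x\<close> distributed by \<open>P\<close> and \<open>j\<close> uniform in \<open>{..<k}\<close>.\<close>
lemma average_along_orbits:
  fixes P :: "'b::metric_space measure" and \<Phi> :: "'b \<Rightarrow> 'b"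
  assumes X: "compact X" and \<Phi>: "continuous_on X \<Phi>" "\<Phi> ` X \<subseteq> X"
    and P: "prob_space P" "sets P = sets (restrict_space borel X)" and k: "k > (0::nat)"
  obtains R where "prob_space R" "sets R = sets (restrict_space borel X)"
    "\<And>h :: 'b \<Rightarrow> real. continuous_on X h \<Longrightarrow> (\<integral>x. h x \<partial>R) = (\<Sum>j<k. \<integral>x. h ((\<Phi> ^^ j) x) \<partial>P) / real k"
proof -
  interpret P: prob_space P by (rule P)
  interpret U: prob_space "uniform_count_measure {..<k}" using k by (intro prob_space_uniform_count_measure) auto
  interpret UP: pair_prob_space "uniform_count_measure {..<k}" P ..
  have spP: "space P = X" using sets_eq_imp_space_eq[OF P(2)] by (simp add: space_restrict_space)
  let ?\<Psi> = "\<lambda>(j, x). (\<Phi> ^^ j) x"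
  have \<Phi>m: "(\<Phi> ^^ j) \<in> P \<rightarrow>\<^sub>M restrict_space borel X" for j
    unfolding measurable_cong_sets[OF P(2) refl]
  proof (rule measurable_restrict_space2)
    show "(\<Phi> ^^ j) \<in> space (restrict_space borel X) \<rightarrow> X"
      using funpow_maps_into[OF \<Phi>(2)] by (auto simp: space_restrict_space)
    show "(\<Phi> ^^ j) \<in> borel_measurable (restrict_space borel X)"
      by (intro borel_measurable_continuous_on_restrict continuous_on_funpow \<Phi>)
  qed
  have m: "?\<Psi> \<in> uniform_count_measure {..<k} \<Otimes>\<^sub>M P \<rightarrow>\<^sub>M restrict_space borel X"
  proof -
    have "?\<Psi> \<in> count_space {..<k} \<Otimes>\<^sub>M P \<rightarrow>\<^sub>M restrict_space borel X"
      by (rule measurable_pair_measure_countable1) (use \<Phi>m in auto)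
    then show ?thesis
      by (subst measurable_cong_sets[OF sets_pair_measure_cong[OF _ refl] refl, of _ "count_space {..<k}"])
         (auto simp: sets_uniform_count_measure)
  qed
  define R where "R = distr (uniform_count_measure {..<k} \<Otimes>\<^sub>M P) (restrict_space borel X) ?\<Psi>"
  show thesis
  proof
    show "prob_space R" unfolding R_def by (rule UP.prob_space_distr[OF m])
    show "sets R = sets (restrict_space borel X)" by (simp add: R_def)
    fix h :: "'b \<Rightarrow> real" assume h: "continuous_on X h"
    have hm: "h \<in> borel_measurable (restrict_space borel X)" by (rule borel_measurable_continuous_on_restrict[OF h])
    have "bounded (h ` X)" by (rule compact_imp_bounded[OF compact_continuous_image[OF h X]])
    then obtain C where C: "\<And>x. x \<in> X \<Longrightarrow> norm (h x) \<le> C" by (auto simp: bounded_iff)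
    have "(\<integral>x. h x \<partial>R) = (\<integral>z. h (?\<Psi> z) \<partial>(uniform_count_measure {..<k} \<Otimes>\<^sub>M P))"
      unfolding R_def by (rule integral_distr[OF m hm])
    also have "\<dots> = (\<integral>j. \<integral>x. h (?\<Psi> (j, x)) \<partial>P \<partial>uniform_count_measure {..<k})"
    proof (rule UP.integral_fst'[symmetric], rule UP.integrable_const_bound)
      show "(\<lambda>z. h (?\<Psi> z)) \<in> borel_measurable (uniform_count_measure {..<k} \<Otimes>\<^sub>M P)"
        by (rule measurable_compose[OF m hm])
      show "AE z in uniform_count_measure {..<k} \<Otimes>\<^sub>M P. norm (h (?\<Psi> z)) \<le> C"
        using funpow_maps_into[OF \<Phi>(2)] C by (intro AE_I2) (auto simp: space_pair_measure spP)
    qed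
    also have "\<dots> = (\<Sum>j<k. \<integral>x. h ((\<Phi> ^^ j) x) \<partial>P) / real k"
      by (subst integral_uniform_count_measure) auto
    finally show "(\<integral>x. h x \<partial>R) = (\<Sum>j<k. \<integral>x. h ((\<Phi> ^^ j) x) \<partial>P) / real k" .
  qed
qed

text \<open>Averages of length \<open>k\<close> are invariant up to an error \<open>2C/k\<close> on functions bounded by \<open>C\<close>. The measures \<open>P n\<close> and
  the lengths are arbitrary, so that the lemma yields both an invariant measure over a given one and a limit of
  empirical measures along a prescribed sequence of points.\<close>
lemma krylov_bogoliubov:
  fixes P :: "nat \<Rightarrow> 'b::metric_space measure" and \<Phi> :: "'b \<Rightarrow> 'b" and k :: "nat \<Rightarrow> nat"
  assumes X: "compact X" and \<Phi>: "continuous_on X \<Phi>" "\<Phi> ` X \<subseteq> X"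
    and P: "\<And>n. prob_space (P n)" "\<And>n. sets (P n) = sets (restrict_space borel X)"
    and k: "\<And>n. k n > 0" "filterlim k at_top sequentially"
  obtains r \<nu> where "strict_mono (r :: nat \<Rightarrow> nat)" "sets \<nu> = sets (restrict_space borel X)" "invariant_prob \<nu> \<Phi>"
    "\<And>h :: 'b \<Rightarrow> real. continuous_on X h \<Longrightarrow>
       (\<lambda>n. (\<Sum>j<k (r n). \<integral>x. h ((\<Phi> ^^ j) x) \<partial>P (r n)) / real (k (r n))) \<longlonglongrightarrow> (\<integral>x. h x \<partial>\<nu>)"
proof -
  interpret P: prob_space "P n" for n by (rule P)
  have spP: "space (P n) = X" for n using sets_eq_imp_space_eq[OF P(2)] by (simp add: space_restrict_space)
  have "\<exists>R. \<forall>n. prob_space (R n) \<and> sets (R n) = sets (restrict_space borel X) \<and>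
    (\<forall>h :: 'b \<Rightarrow> real. continuous_on X h \<longrightarrow> (\<integral>x. h x \<partial>R n) = (\<Sum>j<k n. \<integral>x. h ((\<Phi> ^^ j) x) \<partial>P n) / real (k n))"
    by (intro choice allI) (rule average_along_orbits[OF X \<Phi> P k(1)], blast)
  then obtain R where R: "\<And>n. prob_space (R n)" "\<And>n. sets (R n) = sets (restrict_space borel X)"
    "\<And>n (h :: 'b \<Rightarrow> real). continuous_on X h \<Longrightarrow> (\<integral>x. h x \<partial>R n) = (\<Sum>j<k n. \<integral>x. h ((\<Phi> ^^ j) x) \<partial>P n) / real (k n)"
    by blast
  obtain r \<nu> where r: "strict_mono (r :: nat \<Rightarrow> nat)" and \<nu>: "prob_space \<nu>" "sets \<nu> = sets (restrict_space borel X)"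
    and lim: "\<And>h :: 'b \<Rightarrow> real. continuous_on X h \<Longrightarrow> (\<lambda>n. \<integral>x. h x \<partial>R (r n)) \<longlonglongrightarrow> (\<integral>x. h x \<partial>\<nu>)"
    by (rule weak_sequential_compactness[where P = R, OF X R(1,2)]) (rule that)
  have sp\<nu>: "space \<nu> = X" using sets_eq_imp_space_eq[OF \<nu>(2)] by (simp add: space_restrict_space)
  have \<Phi>m: "\<Phi> \<in> \<nu> \<rightarrow>\<^sub>M \<nu>"
    unfolding measurable_cong_sets[OF \<nu>(2) \<nu>(2)] using \<Phi>
    by (intro measurable_restrict_space2 borel_measurable_continuous_on_restrict) (auto simp: space_restrict_space)
  have hinv: "(\<integral>x. h (\<Phi> x) \<partial>\<nu>) = (\<integral>x. h x \<partial>\<nu>)" if h: "continuous_on X h" for h :: "'b \<Rightarrow> real"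
  proof -
    have "bounded (h ` X)" by (rule compact_imp_bounded[OF compact_continuous_image[OF h X]])
    then obtain C where C: "\<And>x. x \<in> X \<Longrightarrow> norm (h x) \<le> C" by (auto simp: bounded_iff)
    have hc: "continuous_on X (\<lambda>x. h (\<Phi> x))" by (rule continuous_on_compose2[OF h \<Phi>])
    define I where "I n j = (\<integral>x. h ((\<Phi> ^^ j) x) \<partial>P n)" for n j
    have I: "norm (I n j) \<le> C" for n j
    proof -
      have bnd: "norm (h ((\<Phi> ^^ j) x)) \<le> C" if "x \<in> space (P n)" for x
        using that C funpow_maps_into[OF \<Phi>(2)] by (simp add: spP)
      have "continuous_on X (\<lambda>x. h ((\<Phi> ^^ j) x))"
        using funpow_maps_into[OF \<Phi>(2)]
        by (intro continuous_on_compose2[OF h continuous_on_funpow[OF \<Phi>]]) auto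
      then have "integrable (P n) (\<lambda>x. h ((\<Phi> ^^ j) x))"
        using bnd by (intro P.integrable_const_bound[of _ C])
          (auto simp: measurable_cong_sets[OF P(2) refl] intro: borel_measurable_continuous_on_restrict)
      then have "(\<integral>x. norm (h ((\<Phi> ^^ j) x)) \<partial>P n) \<le> C"
        using bnd by (intro P.integral_le_const integrable_norm AE_I2)
      then show ?thesis
        unfolding I_def by (intro order_trans[OF Bochner_Integration.integral_norm_bound])
    qed
    have eq: "(\<integral>x. h (\<Phi> x) \<partial>R n) - (\<integral>x. h x \<partial>R n) = (I n (k n) - I n 0) / real (k n)" for n
    proof -
      have "(\<integral>x. h (\<Phi> x) \<partial>R n) = (\<Sum>j<k n. I n (Suc j)) / real (k n)"
        unfolding R(3)[OF hc] by (simp add: I_def)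
      moreover have "(\<integral>x. h x \<partial>R n) = (\<Sum>j<k n. I n j) / real (k n)" unfolding R(3)[OF h] by (simp add: I_def)
      moreover have "(\<Sum>j<k n. I n (Suc j)) - (\<Sum>j<k n. I n j) = I n (k n) - I n 0"
        by (simp add: sum_lessThan_telescope flip: sum_subtractf)
      ultimately show ?thesis by (simp flip: diff_divide_distrib)
    qed
    have "(\<lambda>n. (\<integral>x. h (\<Phi> x) \<partial>R (r n)) - (\<integral>x. h x \<partial>R (r n))) \<longlonglongrightarrow> 0"
    proof (rule Lim_null_comparison)
      show "\<forall>\<^sub>F n in sequentially. norm ((\<integral>x. h (\<Phi> x) \<partial>R (r n)) - (\<integral>x. h x \<partial>R (r n))) \<le> (2 * C) / real (k (r n))"
      proof (intro always_eventually allI)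
        fix n
        have "\<bar>I (r n) (k (r n)) - I (r n) 0\<bar> \<le> 2 * C"
          using I[of "r n" "k (r n)"] I[of "r n" 0] unfolding real_norm_def by linarith
        then show "norm ((\<integral>x. h (\<Phi> x) \<partial>R (r n)) - (\<integral>x. h x \<partial>R (r n))) \<le> (2 * C) / real (k (r n))"
          unfolding eq by (simp add: divide_right_mono)
      qed
      have "filterlim (\<lambda>n. real (k (r n))) at_top sequentially"
        by (intro filterlim_compose[OF filterlim_real_sequentially] filterlim_compose[OF k(2)] filterlim_subseq r)
      then show "(\<lambda>n. (2 * C) / real (k (r n))) \<longlonglongrightarrow> 0"
        by (rule tendsto_divide_0[OF tendsto_const filterlim_at_top_imp_at_infinity])
    qed
    moreover have "(\<lambda>n. (\<integral>x. h (\<Phi> x) \<partial>R (r n)) - (\<integral>x. h x \<partial>R (r n))) \<longlonglongrightarrow> (\<integral>x. h (\<Phi> x) \<partial>\<nu>) - (\<integral>x. h x \<partial>\<nu>)"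
      by (intro tendsto_intros lim h hc)
    ultimately show ?thesis using LIMSEQ_unique by fastforce
  qed
  interpret \<nu>: prob_space \<nu> by (rule \<nu>)
  have "distr \<nu> \<nu> \<Phi> = \<nu>"
  proof (rule prob_measure_eqI_continuous_on[OF _ _ \<nu>])
    show "prob_space (distr \<nu> \<nu> \<Phi>)" by (rule \<nu>.prob_space_distr[OF \<Phi>m])
    show "sets (distr \<nu> \<nu> \<Phi>) = sets (restrict_space borel X)" by (simp add: \<nu>)
    show "(\<integral>x. h x \<partial>distr \<nu> \<nu> \<Phi>) = (\<integral>x. h x \<partial>\<nu>)" if h: "continuous_on X h" for h :: "'b \<Rightarrow> real"
      using hinv[OF h] borel_measurable_continuous_on_restrict[OF h]
      by (subst integral_distr[OF \<Phi>m]) (simp_all add: measurable_cong_sets[OF \<nu>(2) refl])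
  qed
  then have "invariant_prob \<nu> \<Phi>" using \<nu> \<Phi>m by (simp add: invariant_prob_def)
  then show thesis using that[OF r \<nu>(2)] lim R(3) by simp
qed

section \<open>Unbounded sums over an invariant measure\<close>

text \<open>For the maximum \<open>M n\<close> of the first \<open>n + 1\<close> nonempty sums, \<open>M (n + 1) - M n \<circ> G\<close> has nonnegative integral by invariance
  and monotonicity. As soon as \<open>M n \<circ> G\<close> is positive this difference equals \<open>\<phi>\<close>, which happens
  eventually wherever the sums are unbounded.\<close>
lemma integral_nonneg_if_sums_unbounded:
  fixes \<phi> :: "'b \<Rightarrow> real"
  assumes inv: "invariant_prob N G" and \<phi>: "\<phi> \<in> borel_measurable N" "\<And>z. z \<in> space N \<Longrightarrow> \<bar>\<phi> z\<bar> \<le> B"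
    and unb: "AE z in N. \<not> bdd_above (range (\<lambda>n. \<Sum>k<n. \<phi> ((G ^^ k) z)))"
  shows "0 \<le> (\<integral>z. \<phi> z \<partial>N)"
proof -
  interpret prob_space N using inv by (simp add: invariant_prob_def)
  have G: "G \<in> N \<rightarrow>\<^sub>M N" "distr N N G = N" using inv by (simp_all add: invariant_prob_def)
  have Gsp: "G z \<in> space N" if "z \<in> space N" for z using measurable_space[OF G(1) that] .
  have sumS: "(\<Sum>k<Suc n. \<phi> ((G ^^ k) z)) = \<phi> z + (\<Sum>k<n. \<phi> ((G ^^ k) (G z)))" for n z
    by (simp add: sum.lessThan_Suc_shift funpow_swap1 del: sum.lessThan_Suc)
  \<comment> \<open>\<open>M n\<close> is the maximum of the sums of length \<open>1, ..., n + 1\<close>, written recursively.\<close>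
  define M where "M n = ((\<lambda>m z. \<phi> z + max 0 (m (G z))) ^^ n) \<phi>" for n
  have M0: "M 0 = \<phi>" and MS: "\<And>n z. M (Suc n) z = \<phi> z + max 0 (M n (G z))" by (simp_all add: M_def)
  have Mm: "M n \<in> borel_measurable N" for n
  proof (induction n)
    case (Suc n)
    have "(\<lambda>z. M n (G z)) \<in> borel_measurable N" by (rule measurable_compose[OF G(1) Suc])
    then have "(\<lambda>z. \<phi> z + max 0 (M n (G z))) \<in> borel_measurable N" using \<phi>(1) by measurable
    then show ?case by (simp add: MS[abs_def])
  qed (simp add: M0 \<phi>)
  have Mlow: "\<phi> z \<le> M n z" for n z by (cases n) (simp_all add: M0 MS)
  have Mb: "\<bar>M n z\<bar> \<le> real (Suc n) * B" if "z \<in> space N" for n z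
    using that
  proof (induction n arbitrary: z)
    case (Suc n)
    have "\<bar>max 0 (M n (G z))\<bar> \<le> real (Suc n) * B" using Suc.IH[OF Gsp[OF Suc.prems]] by linarith
    moreover have "real (Suc (Suc n)) * B = B + real (Suc n) * B" by (simp add: algebra_simps)
    ultimately show ?case using \<phi>(2)[OF Suc.prems] unfolding MS by linarith
  qed (simp add: M0 \<phi>)
  have Mmono: "M n z \<le> M (Suc n) z" for n z
  proof (induction n arbitrary: z)
    case (Suc n)
    show ?case unfolding MS[of n z] MS[of "Suc n" z] using Suc[of "G z"] by linarith
  qed (simp add: M0 MS)
  have Msum: "(\<Sum>k<Suc j. \<phi> ((G ^^ k) z)) \<le> M n z" if "j \<le> n" for j n z
    using that
  proof (induction n arbitrary: j z)
    case (Suc n)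
    show ?case
    proof (cases j)
      case (Suc i)
      have "(\<Sum>k<Suc i. \<phi> ((G ^^ k) (G z))) \<le> M n (G z)" using Suc.IH Suc.prems Suc by simp
      then show ?thesis unfolding Suc sumS[of z "Suc i"] MS by linarith
    qed (use Mlow[of z "Suc n"] in simp)
  qed (simp add: M0)
  have Mint: "integrable N (M n)" for n
    using Mb by (intro integrable_const_bound[of _ "real (Suc n) * B"] Mm) auto
  have Gint: "(\<integral>z. M n (G z) \<partial>N) = (\<integral>z. M n z \<partial>N)" for n
    using integral_distr[OF G(1) Mm, of n] G(2) by simp
  have MGint: "integrable N (\<lambda>z. M n (G z))" for n
    using integrable_distr[OF G(1), of "M n"] G(2) Mint by simp
  define D where "D n z = M (Suc n) z - M n (G z)" for n z
  have Dnonneg: "0 \<le> (\<integral>z. D n z \<partial>N)" for n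
  proof -
    have "(\<integral>z. D n z \<partial>N) = (\<integral>z. M (Suc n) z \<partial>N) - (\<integral>z. M n z \<partial>N)"
      unfolding D_def by (simp add: Bochner_Integration.integral_diff Mint MGint Gint)
    moreover have "(\<integral>z. M n z \<partial>N) \<le> (\<integral>z. M (Suc n) z \<partial>N)" by (intro integral_mono Mint Mmono)
    ultimately show ?thesis by simp
  qed
  have "(\<lambda>n. \<integral>z. D n z \<partial>N) \<longlonglongrightarrow> (\<integral>z. \<phi> z \<partial>N)"
  proof (rule integral_dominated_convergence)
    show "D n \<in> borel_measurable N" for n
      unfolding D_def using Mint MGint by (intro borel_measurable_diff borel_measurable_integrable)
    show "integrable N (\<lambda>_. 2 * B)" by simp
    show "AE z in N. norm (D n z) \<le> 2 * B" for n
    proof (rule AE_I2)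
      fix z assume z: "z \<in> space N"
      show "norm (D n z) \<le> 2 * B"
        using \<phi>(2)[OF z] \<phi>(2)[OF Gsp[OF z]] Mlow[of "G z" n] unfolding D_def MS real_norm_def by linarith
    qed
    show "AE z in N. (\<lambda>n. D n z) \<longlonglongrightarrow> \<phi> z"
      using unb AE_space
    proof eventually_elim
      case (elim z)
      obtain j where j: "B < (\<Sum>k<j. \<phi> ((G ^^ k) z))"
        using elim(1) by (auto simp: bdd_above_def not_le)
      have B0: "0 \<le> B" "\<phi> z \<le> B" using \<phi>(2)[OF elim(2)] by auto
      have "j \<noteq> 0" "j \<noteq> 1" using j B0 by (intro notI; simp)+
      then obtain i where i: "j = Suc (Suc i)" by (metis One_nat_def not0_implies_Suc)
      have "0 < (\<Sum>k<Suc i. \<phi> ((G ^^ k) (G z)))" using j B0(2) unfolding i sumS[of z "Suc i"] by linarith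
      then have "0 < M n (G z)" if "n \<ge> i" for n using Msum[OF that, of "G z"] by linarith
      then have "D n z = \<phi> z" if "n \<ge> i" for n using that unfolding D_def MS by fastforce
      then show ?case by (intro tendsto_eventually eventually_sequentiallyI[of i])
    qed
  qed (rule \<phi>)
  then show ?thesis by (rule LIMSEQ_le_const) (use Dnonneg in blast)
qed

lemma continuous_on_compact_quotient:
  fixes q :: "'b::topological_space \<Rightarrow> 'c::t2_space" and f :: "'c \<Rightarrow> 'd::topological_space"
  assumes "compact K" "continuous_on K q" "continuous_on K (\<lambda>x. f (q x))"
  shows "continuous_on (q ` K) f"
  unfolding continuous_on_closed_invariant
proof (intro allI impI)
  fix C :: "'d set" assume C: "closed C"
  let ?Z = "K \<inter> (\<lambda>x. f (q x)) -` C"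
  have "compact ?Z"
    using closedin_compact[OF assms(1) continuous_closedin_preimage[OF assms(3) C]] .
  then have "compact (q ` ?Z)"
    by (intro compact_continuous_image continuous_on_subset[OF assms(2)]) auto
  then show "\<exists>A. closed A \<and> A \<inter> q ` K = f -` C \<inter> q ` K"
    by (intro exI[of _ "q ` ?Z"] conjI compact_imp_closed) auto
qed

text \<open>By the bound on the oscillation, unboundedness of the sums is a property of the base point alone, and it is
  invariant under \<open>T\<close>. So it has measure \<open>0\<close> or \<open>1\<close> by ergodicity of the base, and the sign of the integral excludes \<open>1\<close>.\<close>
lemma sums_bounded_above_if_integral_neg:
  fixes T :: "'a::metric_space \<Rightarrow> 'a" and \<Phi> :: "'a \<times> (complex^'m^'m) \<Rightarrow> 'a \<times> (complex^'m^('m::finite))"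
    and \<phi> :: "'a \<times> (complex^'m^'m) \<Rightarrow> real"
  assumes comp: "compact (UNIV :: 'a set)" and \<mu>: "sets \<mu> = sets borel" "ergodic_prob \<mu> T"
    and \<Phi>: "continuous_on (UNIV \<times> unitary_group) \<Phi>" "\<Phi> ` (UNIV \<times> unitary_group) \<subseteq> UNIV \<times> unitary_group"
      "\<And>z. z \<in> UNIV \<times> unitary_group \<Longrightarrow> fst (\<Phi> z) = T (fst z)"
    and \<nu>: "\<nu> \<in> invariant_over \<mu> \<Phi>"
    and \<phi>: "continuous_on (UNIV \<times> unitary_group) \<phi>"
    and osc: "\<And>n \<theta> W W'. W \<in> unitary_group \<Longrightarrow> W' \<in> unitary_group \<Longrightarrow>
      \<bar>(\<Sum>k<n. \<phi> ((\<Phi> ^^ k) (\<theta>, W))) - (\<Sum>k<n. \<phi> ((\<Phi> ^^ k) (\<theta>, W')))\<bar> \<le> C"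
    and neg: "(\<integral>z. \<phi> z \<partial>\<nu>) < 0"
  shows "AE \<theta> in \<mu>. \<forall>W\<in>unitary_group. bdd_above (range (\<lambda>n. \<Sum>k<n. \<phi> ((\<Phi> ^^ k) (\<theta>, W))))"
proof -
  let ?X = "UNIV \<times> unitary_group :: ('a \<times> (complex^'m^'m)) set"
  have \<nu>s: "sets \<nu> = sets (restrict_space borel ?X)" and \<nu>i: "invariant_prob \<nu> \<Phi>" and \<nu>p: "distr \<nu> borel fst = \<mu>"
    using \<nu> by (auto simp: invariant_over_def)
  have sp\<nu>: "space \<nu> = ?X" using sets_eq_imp_space_eq[OF \<nu>s] by (simp add: space_restrict_space)
  have sp\<mu>: "space \<mu> = UNIV" using sets_eq_imp_space_eq[OF \<mu>(1)] by simp
  interpret \<mu>: prob_space \<mu> using \<mu>(2) by (simp add: ergodic_prob_def invariant_prob_def)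
  define S where "S n z = (\<Sum>k<n. \<phi> ((\<Phi> ^^ k) z))" for n z
  have SS: "S (Suc n) z = \<phi> z + S n (\<Phi> z)" for n z
    unfolding S_def by (simp add: sum.lessThan_Suc_shift funpow_swap1 del: sum.lessThan_Suc)
  have bdd_transfer: "bdd_above (range (\<lambda>n. S n (\<theta>, W')))"
    if b: "bdd_above (range (\<lambda>n. S n (\<theta>, W)))" and W: "W \<in> unitary_group" "W' \<in> unitary_group" for \<theta> W W'
  proof -
    obtain b where b: "\<And>n. S n (\<theta>, W) \<le> b" using b by (auto simp: bdd_above_def)
    have "S n (\<theta>, W') \<le> b + C" for n using b[of n] osc[OF W, of \<theta> n] unfolding S_def by linarith
    then show ?thesis by (intro bdd_aboveI[of _ "b + C"]) auto
  qed
  have bdd_\<Phi>: "bdd_above (range (\<lambda>n. S n (\<Phi> z))) \<longleftrightarrow> bdd_above (range (\<lambda>n. S n z))" for z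
  proof
    assume "bdd_above (range (\<lambda>n. S n (\<Phi> z)))"
    then obtain b where b: "\<And>n. S n (\<Phi> z) \<le> b" by (auto simp: bdd_above_def)
    have "S n z \<le> max 0 (\<phi> z + b)" for n
    proof (cases n)
      case (Suc k)
      then show ?thesis using b[of k] by (simp add: SS le_max_iff_disj)
    qed (simp add: S_def)
    then show "bdd_above (range (\<lambda>n. S n z))" by (intro bdd_aboveI[of _ "max 0 (\<phi> z + b)"]) auto
  next
    assume "bdd_above (range (\<lambda>n. S n z))"
    then obtain b where b: "\<And>n. S n z \<le> b" by (auto simp: bdd_above_def)
    have "S n (\<Phi> z) \<le> b - \<phi> z" for n using b[of "Suc n"] by (simp add: SS)
    then show "bdd_above (range (\<lambda>n. S n (\<Phi> z)))" by (intro bdd_aboveI[of _ "b - \<phi> z"]) auto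
  qed
  define E where "E = {\<theta>. \<not> bdd_above (range (\<lambda>n. S n (\<theta>, mat 1 :: complex^'m^'m)))}"
  have E_iff: "\<theta> \<in> E \<longleftrightarrow> \<not> bdd_above (range (\<lambda>n. S n (\<theta>, W)))" if "W \<in> unitary_group" for \<theta> W
    unfolding E_def using bdd_transfer[of \<theta> W "mat 1"] bdd_transfer[of \<theta> "mat 1" W] that by auto
  have Sc: "continuous_on UNIV (\<lambda>\<theta>. S n (\<theta>, mat 1 :: complex^'m^'m))" for n
    unfolding S_def
  proof (intro continuous_on_sum)
    fix k
    have "continuous_on ?X (\<lambda>z. \<phi> ((\<Phi> ^^ k) z))"
      by (rule continuous_on_compose2[OF \<phi> continuous_on_funpow[OF \<Phi>(1,2)]])
         (intro image_subsetI funpow_maps_into[OF \<Phi>(2)])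
    then show "continuous_on UNIV (\<lambda>\<theta>. \<phi> ((\<Phi> ^^ k) (\<theta>, mat 1)))"
      by (rule continuous_on_compose2) (auto intro!: continuous_intros)
  qed
  have Em: "E \<in> sets \<mu>"
  proof -
    have "E = - (\<Union>b::nat. \<Inter>n. {\<theta>. S n (\<theta>, mat 1 :: complex^'m^'m) \<le> real b})"
    proof (intro set_eqI)
      fix \<theta>
      have "bdd_above (range (\<lambda>n. S n (\<theta>, mat 1 :: complex^'m^'m))) \<longleftrightarrow> (\<exists>b::nat. \<forall>n. S n (\<theta>, mat 1 :: complex^'m^'m) \<le> real b)"
        unfolding bdd_above_def by (auto, meson order_trans real_arch_simple)
      then show "\<theta> \<in> E \<longleftrightarrow> \<theta> \<in> - (\<Union>b::nat. \<Inter>n. {\<theta>. S n (\<theta>, mat 1 :: complex^'m^'m) \<le> real b})"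
        by (simp add: E_def)
    qed
    moreover have "closed {\<theta>. S n (\<theta>, mat 1 :: complex^'m^'m) \<le> real b}" for n b
      by (intro closed_Collect_le Sc continuous_on_const)
    ultimately show ?thesis unfolding \<mu>(1) by (simp add: borel_closed closed_INT)
  qed
  have "T -` E \<inter> space \<mu> = E"
  proof -
    have "T \<theta> \<in> E \<longleftrightarrow> \<theta> \<in> E" for \<theta>
    proof -
      have 1: "(\<theta>, mat 1) \<in> ?X" by simp
      obtain W where W: "\<Phi> (\<theta>, mat 1) = (T \<theta>, W)" using \<Phi>(3)[OF 1] by (metis fst_conv surj_pair)
      then have "W \<in> unitary_group" using \<Phi>(2) 1 by (metis SigmaD2 image_subset_iff)
      then show ?thesis
        using bdd_\<Phi>[of "(\<theta>, mat 1)"] unfolding W by (simp add: E_iff[of W "T \<theta>"] E_iff[of "mat 1" \<theta>])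
    qed
    then show ?thesis by (auto simp: sp\<mu>)
  qed
  then have "measure \<mu> E = 0 \<or> measure \<mu> E = 1" using \<mu>(2) Em by (simp add: ergodic_prob_def)
  moreover have "measure \<mu> E \<noteq> 1"
  proof
    assume "measure \<mu> E = 1"
    then have "AE \<theta> in \<mu>. \<theta> \<in> E" using Em by (simp add: \<mu>.prob_eq_1)
    then have "AE \<theta> in distr \<nu> borel fst. \<theta> \<in> E" unfolding \<nu>p .
    moreover have fm: "fst \<in> borel_measurable \<nu>"
      unfolding measurable_cong_sets[OF \<nu>s refl]
      by (intro borel_measurable_continuous_on_restrict continuous_intros)
    ultimately have "AE z in \<nu>. fst z \<in> E" by (rule AE_distrD[rotated])
    then have "AE z in \<nu>. \<not> bdd_above (range (\<lambda>n. S n z))"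
      using AE_space by eventually_elim (auto simp: sp\<nu> E_iff)
    moreover have "\<phi> \<in> borel_measurable \<nu>"
      unfolding measurable_cong_sets[OF \<nu>s refl] by (rule borel_measurable_continuous_on_restrict[OF \<phi>])
    moreover have "compact ?X" by (intro compact_Times comp compact_unitary_group)
    then have "bounded (\<phi> ` ?X)" by (intro compact_imp_bounded compact_continuous_image \<phi>)
    then obtain B where "\<And>z. z \<in> ?X \<Longrightarrow> norm (\<phi> z) \<le> B" unfolding bounded_iff by blast
    ultimately have "0 \<le> (\<integral>z. \<phi> z \<partial>\<nu>)"
      by (intro integral_nonneg_if_sums_unbounded[OF \<nu>i, of \<phi> B]) (auto simp: sp\<nu> S_def)
    then show False using neg by simp
  qed
  ultimately have "measure \<mu> E = 0" by simp
  then have "AE \<theta> in \<mu>. \<theta> \<notin> E" using Em by (simp add: \<mu>.prob_eq_0)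
  then show ?thesis by eventually_elim (auto simp: E_iff S_def)
qed

section \<open>The displacement function of a lift\<close>

lemma cis_eq_imp_Ints: "cis (2 * pi * x) = cis (2 * pi * y) \<Longrightarrow> x - y \<in> \<int>"
proof -
  assume "cis (2 * pi * x) = cis (2 * pi * y)"
  then have "cis (2 * pi * x) / cis (2 * pi * y) = 1" by simp
  then have "cis (2 * pi * (x - y)) = 1" by (simp add: cis_divide algebra_simps)
  then have "cos (2 * pi * (x - y)) = 1" by (metis cis.simps(1) one_complex.simps(1))
  then obtain n :: int where "2 * pi * (x - y) = real_of_int n * 2 * pi" by (auto simp: cos_one_2pi_int)
  then have "x - y = of_int n" by simp
  then show ?thesis by simp
qed

lemma det_covering:
  fixes S :: "complex^'m^('m::finite)" and x :: real
  assumes "S \<in> special_unitary_group"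
  shows "det (scale_mat (cis (2 * pi * x)) S) = cis (2 * pi * (CARD('m) * x))"
  using assms by (simp add: det_scale_mat special_unitary_group_def Complex.DeMoivre mult_ac)

lemma covering_eq: "covering (\<theta>, x, S) = (\<theta>, scale_mat (cis (2 * pi * x)) S)"
  by (simp add: covering_def cis_conv_exp mult_ac)

lemma covering_unitary: "S \<in> special_unitary_group \<Longrightarrow> scale_mat (cis x) S \<in> unitary_group"
  by (simp add: special_unitary_group_def unitary_group_scale)

text \<open>Already \<open>x \<in> {0..1}\<close> suffices, which makes the unitary bundle a continuous image of a compact space.\<close>
lemma unitary_eq_covering:
  fixes W :: "complex^'m^('m::finite)"
  assumes "W \<in> unitary_group"
  obtains x S where "x \<in> {0..1}" "S \<in> special_unitary_group" "W = scale_mat (cis (2 * pi * x)) S"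
proof -
  define x where "x = Arg2pi (det W) / (2 * pi * CARD('m))"
  define S where "S = scale_mat (cis (- (2 * pi * x))) W"
  have "det W = cis (Arg2pi (det W))"
    using Arg2pi_eq[of "det W"] unitary_group_det[OF assms] by (simp add: cis_conv_exp)
  also have "Arg2pi (det W) = CARD('m) * (2 * pi * x)" by (simp add: x_def)
  finally have d: "det W = cis (2 * pi * x) ^ CARD('m)" by (simp add: Complex.DeMoivre)
  have "det S = (cis (- (2 * pi * x)) * cis (2 * pi * x)) ^ CARD('m)"
    by (simp add: S_def det_scale_mat d power_mult_distrib)
  then have "det S = 1" by (simp add: cis_mult)
  then have "S \<in> special_unitary_group"
    using assms by (simp add: special_unitary_group_def S_def unitary_group_scale)
  moreover have "W = scale_mat (cis (2 * pi * x)) S" by (simp add: S_def scale_mat_scale_mat cis_mult)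
  moreover have "x \<in> {0..1}"
  proof -
    have "Arg2pi (det W) \<le> 2 * pi" using Arg2pi_lt_2pi by (rule less_imp_le)
    also have "\<dots> \<le> 2 * pi * CARD('m)" by simp
    finally show ?thesis using Arg2pi_ge_0[of "det W"] by (simp add: x_def)
  qed
  ultimately show thesis using that by blast
qed

text \<open>The displacement before it is known to depend only on the image under the covering.\<close>
definition lift_displacement :: "('a \<times> real \<times> (complex^'m^'m) \<Rightarrow> 'a \<times> real \<times> (complex^'m^'m)) \<Rightarrow>
    'a \<Rightarrow> real \<Rightarrow> complex^'m^'m \<Rightarrow> real" where
  "lift_displacement F \<theta> x S = real CARD('m) * (fst (snd (F (\<theta>, x, S))) - x)"

text \<open>Comparing determinants on both sides of the lifting equation shows that the displacement and the phase of the
  Moebius map differ by an integer. The difference is constant because \<open>\<real> \<times> SU(m)\<close> is connected, and the phase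
  is a function on \<open>U(m)\<close>; hence so is the displacement.\<close>
lemma lift_displacement_factors:
  fixes F :: "'a::metric_space \<times> real \<times> (complex^'m^'m) \<Rightarrow> 'a \<times> real \<times> (complex^'m^('m::finite))"
  assumes A: "range A \<subseteq> HSp" and F: "is_lift T A F"
  obtains \<psi> where "continuous_on unitary_group \<psi>"
    "\<And>x S. S \<in> special_unitary_group \<Longrightarrow> lift_displacement F \<theta> x S = \<psi> (scale_mat (cis (2 * pi * x)) S)"
    "\<And>W. W \<in> unitary_group \<Longrightarrow> det (moebius (A \<theta>) W) = det W * cis (2 * pi * \<psi> W)"
proof -
  let ?E = "UNIV \<times> UNIV \<times> special_unitary_group :: ('a \<times> real \<times> (complex^'m^'m)) set"
  let ?W = "\<lambda>p. scale_mat (cis (2 * pi * fst p)) (snd p) :: complex^'m^'m"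
  have Fc: "continuous_on ?E F" and FE: "F ` ?E \<subseteq> ?E" and Fq: "\<And>e. e \<in> ?E \<Longrightarrow> covering (F e) = cocycle T A (covering e)"
    using F unfolding is_lift_def Let_def by auto
  have M: "A \<theta> \<in> HSp" using A by auto
  obtain \<phi> where \<phi>: "continuous_on unitary_group \<phi>"
    "\<And>W. W \<in> unitary_group \<Longrightarrow> det (moebius (A \<theta>) W) = det W * cis (\<phi> W)"
    by (rule moebius_det_phase[OF M]) (rule that; assumption)
  define k where "k p = lift_displacement F \<theta> (fst p) (snd p) - \<phi> (?W p) / (2 * pi)" for p
  have kZ: "k (x, S) \<in> \<int>" if S: "S \<in> special_unitary_group" for x S
  proof -
    obtain \<theta>' x' S' where F': "F (\<theta>, x, S) = (\<theta>', x', S')" by (metis surj_pair)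
    have "F (\<theta>, x, S) \<in> ?E" by (rule FE[THEN subsetD, OF imageI]) (use S in auto)
    then have S': "S' \<in> special_unitary_group" by (simp add: F')
    have W: "?W (x, S) \<in> unitary_group" using covering_unitary[OF S] by simp
    have "scale_mat (cis (2 * pi * x')) S' = moebius (A \<theta>) (?W (x, S))"
      using Fq[of "(\<theta>, x, S)"] S W by (simp add: F' covering_eq cocycle_eq[OF A])
    then have "cis (2 * pi * (CARD('m) * x')) = cis (2 * pi * (CARD('m) * x)) * cis (\<phi> (?W (x, S)))"
      using \<phi>(2)[OF W] det_covering[OF S', of x'] det_covering[OF S, of x] by simp
    also have "\<dots> = cis (2 * pi * (CARD('m) * x + \<phi> (?W (x, S)) / (2 * pi)))"
      by (simp add: cis_mult ring_distribs)
    finally have "CARD('m) * x' - (CARD('m) * x + \<phi> (?W (x, S)) / (2 * pi)) \<in> \<int>" by (rule cis_eq_imp_Ints)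
    then show ?thesis by (simp add: k_def lift_displacement_def F' algebra_simps)
  qed
  have kc: "continuous_on (UNIV \<times> special_unitary_group) k"
    unfolding k_def lift_displacement_def
    by (intro continuous_intros continuous_on_compose2[OF Fc] continuous_on_compose2[OF \<phi>(1)])
       (auto intro: covering_unitary)
  have conn: "connected ((UNIV :: real set) \<times> (special_unitary_group :: (complex^'m^'m) set))"
    by (intro connected_Times connected_UNIV connected_special_unitary_group)
  have 1: "mat 1 \<in> (special_unitary_group :: (complex^'m^'m) set)" by (simp add: special_unitary_group_def)
  have kconst: "k (x, S) = k (0, mat 1)" if "S \<in> special_unitary_group" for x S
    by (rule continuous_on_Ints_constant[OF conn kc]) (use kZ that 1 in auto)
  define \<psi> where "\<psi> W = \<phi> W / (2 * pi) + k (0, mat 1)" for W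
  show thesis
  proof
    show "continuous_on unitary_group \<psi>" unfolding \<psi>_def by (intro continuous_intros \<phi>) simp
    show "lift_displacement F \<theta> x S = \<psi> (scale_mat (cis (2 * pi * x)) S)" if "S \<in> special_unitary_group" for x S
      using kconst[OF that, of x] unfolding \<psi>_def by (simp add: k_def[of "(x, S)"])
    obtain n :: int where n: "k (0, mat 1) = of_int n" using kZ[OF 1] by (auto elim: Ints_cases)
    show "det (moebius (A \<theta>) W) = det W * cis (2 * pi * \<psi> W)" if "W \<in> unitary_group" for W
    proof -
      have "cis (2 * pi * \<psi> W) = cis (\<phi> W + 2 * pi * of_int n)" by (simp add: \<psi>_def n ring_distribs)
      also have "\<dots> = cis (\<phi> W)" by (simp add: cis_mult[symmetric] cis_multiple_2pi)
      finally show ?thesis using \<phi>(2)[OF that] by simp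
    qed
  qed
qed

lemma displacement_covering:
  fixes F :: "'a::metric_space \<times> real \<times> (complex^'m^'m) \<Rightarrow> 'a \<times> real \<times> (complex^'m^('m::finite))"
  assumes A: "range A \<subseteq> HSp" and F: "is_lift T A F" and S: "S \<in> special_unitary_group"
  shows "displacement F (covering (\<theta>, x, S)) = lift_displacement F \<theta> x S"
proof -
  obtain \<psi> where \<psi>: "\<And>x S. S \<in> special_unitary_group \<Longrightarrow> lift_displacement F \<theta> x S = \<psi> (scale_mat (cis (2 * pi * x)) S)"
    using lift_displacement_factors[OF A F, of \<theta>] by metis
  show ?thesis
    unfolding displacement_def covering_eq case_prod_conv lift_displacement_def[symmetric]
  proof (rule the_equality)
    show "\<exists>x'. \<exists>S'\<in>special_unitary_group. (\<theta>, scale_mat (cis (2 * pi * x)) S) = (\<theta>, scale_mat (cis (2 * pi * x')) S') \<and>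
        lift_displacement F \<theta> x S = lift_displacement F \<theta> x' S'"
      using S by blast
  next
    fix y
    assume "\<exists>x'. \<exists>S'\<in>special_unitary_group. (\<theta>, scale_mat (cis (2 * pi * x)) S) = (\<theta>, scale_mat (cis (2 * pi * x')) S') \<and>
        y = lift_displacement F \<theta> x' S'"
    then show "y = lift_displacement F \<theta> x S" using S by (auto simp: \<psi>)
  qed
qed

lemma displacement_fiber:
  fixes F :: "'a::metric_space \<times> real \<times> (complex^'m^'m) \<Rightarrow> 'a \<times> real \<times> (complex^'m^('m::finite))"
  assumes A: "range A \<subseteq> HSp" and F: "is_lift T A F" and W: "W \<in> unitary_group"
  shows "det (moebius (A \<theta>) W) = det W * cis (2 * pi * displacement F (\<theta>, W))"
proof -
  obtain \<psi> where \<psi>: "\<And>x S. S \<in> special_unitary_group \<Longrightarrow> lift_displacement F \<theta> x S = \<psi> (scale_mat (cis (2 * pi * x)) S)"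
    "\<And>W. W \<in> unitary_group \<Longrightarrow> det (moebius (A \<theta>) W) = det W * cis (2 * pi * \<psi> W)"
    using lift_displacement_factors[OF A F, of \<theta>] by metis
  obtain x S where S: "S \<in> special_unitary_group" "W = scale_mat (cis (2 * pi * x)) S"
    using unitary_eq_covering[OF W] by metis
  have "displacement F (\<theta>, W) = \<psi> W"
    using displacement_covering[OF A F S(1), of \<theta> x] \<psi>(1)[OF S(1), of x] by (simp add: covering_eq S(2))
  then show ?thesis using \<psi>(2)[OF W] by simp
qed

lemma continuous_on_displacement:
  fixes F :: "'a::metric_space \<times> real \<times> (complex^'m^'m) \<Rightarrow> 'a \<times> real \<times> (complex^'m^('m::finite))"
  assumes comp: "compact (UNIV :: 'a set)" and A: "range A \<subseteq> HSp" and F: "is_lift T A F"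
  shows "continuous_on (UNIV \<times> unitary_group) (displacement F)"
proof -
  let ?K = "UNIV \<times> {0..1} \<times> special_unitary_group :: ('a \<times> real \<times> (complex^'m^'m)) set"
  have Fc: "continuous_on (UNIV \<times> UNIV \<times> special_unitary_group) F"
    using F unfolding is_lift_def Let_def by auto
  have eq: "covering = (\<lambda>e :: 'a \<times> real \<times> (complex^'m^'m). (fst e, scale_mat (cis (2 * pi * fst (snd e))) (snd (snd e))))"
    by (auto simp: fun_eq_iff covering_eq)
  have im: "covering ` ?K = UNIV \<times> unitary_group"
  proof (intro equalityI subsetI)
    fix z assume "z \<in> covering ` ?K"
    then show "z \<in> UNIV \<times> unitary_group" by (auto simp: eq covering_unitary)
  next
    fix z :: "'a \<times> (complex^'m^'m)" assume "z \<in> UNIV \<times> unitary_group"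
    then obtain \<theta> W where z: "z = (\<theta>, W)" "W \<in> unitary_group" by auto
    obtain x S where "x \<in> {0..1}" "S \<in> special_unitary_group" "W = scale_mat (cis (2 * pi * x)) S"
      using unitary_eq_covering[OF z(2)] by metis
    then show "z \<in> covering ` ?K" unfolding z(1) by (intro image_eqI[of _ _ "(\<theta>, x, S)"]) (auto simp: covering_eq)
  qed
  have "continuous_on (covering ` ?K) (displacement F)"
  proof (rule continuous_on_compact_quotient)
    show "compact ?K" by (intro compact_Times comp compact_special_unitary_group compact_Icc)
    show "continuous_on ?K covering" unfolding eq by (intro continuous_intros)
    have "continuous_on ?K (\<lambda>e. real CARD('m) * (fst (snd (F e)) - fst (snd e)))"
      by (intro continuous_intros continuous_on_subset[OF Fc]) auto
    moreover have "displacement F (covering e) = real CARD('m) * (fst (snd (F e)) - fst (snd e))" if "e \<in> ?K" for e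
      using that displacement_covering[OF A F] by (auto simp: lift_displacement_def)
    ultimately show "continuous_on ?K (\<lambda>e. displacement F (covering e))" by (simp cong: continuous_on_cong)
  qed
  then show ?thesis by (simp only: im)
qed

lemma cocycle_maps:
  fixes A :: "'a \<Rightarrow> complex^('m::finite + 'm)^('m + 'm)"
  assumes A: "range A \<subseteq> HSp"
  shows "cocycle T A ` (UNIV \<times> unitary_group) \<subseteq> UNIV \<times> unitary_group"
  using A by (auto simp: cocycle_eq[OF A] moebius_unitary range_subsetD)

lemma continuous_on_cocycle:
  fixes A :: "'a::metric_space \<Rightarrow> complex^('m::finite + 'm)^('m + 'm)"
  assumes T: "continuous_on UNIV T" and Ac: "continuous_on UNIV A" and A: "range A \<subseteq> HSp"
  shows "continuous_on (UNIV \<times> unitary_group) (cocycle T A)"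
proof -
  have "continuous_on (UNIV \<times> unitary_group) (\<lambda>z. (T (fst z), moebius (A (fst z)) (snd z)))"
    using A by (intro continuous_intros continuous_on_moebius continuous_on_compose2[OF T] continuous_on_compose2[OF Ac]) auto
  then show ?thesis
    by (rule continuous_on_cong[THEN iffD1, OF refl, rotated]) (auto simp: cocycle_eq[OF A])
qed

lemma cocycle_iterate:
  fixes A :: "'a \<Rightarrow> complex^('m::finite + 'm)^('m + 'm)"
  assumes A: "range A \<subseteq> HSp"
  shows "\<exists>M\<in>HSp. \<forall>W\<in>unitary_group. (cocycle T A ^^ n) (\<theta>, W) = ((T ^^ n) \<theta>, moebius M W)"
proof (induction n)
  case 0
  then show ?case by (intro bexI[of _ "mat 1"]) auto
next
  case (Suc n)
  then obtain M where M: "M \<in> HSp" "\<And>W. W \<in> unitary_group \<Longrightarrow> (cocycle T A ^^ n) (\<theta>, W) = ((T ^^ n) \<theta>, moebius M W)"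
    by blast
  let ?M = "A ((T ^^ n) \<theta>) ** M"
  have A': "A ((T ^^ n) \<theta>) \<in> HSp" using A by auto
  have "(cocycle T A ^^ Suc n) (\<theta>, W) = ((T ^^ Suc n) \<theta>, moebius ?M W)" if "W \<in> unitary_group" for W
    using M that A' by (simp add: cocycle_eq[OF A] moebius_unitary moebius_comp)
  then show ?case using HSp_mult[OF M(1) A'] by blast
qed

text \<open>On a fibre, the sum over \<open>n\<close> steps and the phase of the \<open>n\<close>-th iterate divided by \<open>2 pi\<close> are both continuous
  logarithms of the same function, so they differ by a constant. The oscillation of the phase is
  bounded independently of the matrix, hence of \<open>n\<close>.\<close>
lemma displacement_sum_oscillation:
  fixes F :: "'a::metric_space \<times> real \<times> (complex^'m^'m) \<Rightarrow> 'a \<times> real \<times> (complex^'m^('m::finite))"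
  assumes comp: "compact (UNIV :: 'a set)" and T: "continuous_on UNIV T" and Ac: "continuous_on UNIV A"
    and A: "range A \<subseteq> HSp" and F: "is_lift T A F" and W: "W \<in> unitary_group" "W' \<in> unitary_group"
  shows "\<bar>(\<Sum>k<n. displacement F ((cocycle T A ^^ k) (\<theta>, W))) - (\<Sum>k<n. displacement F ((cocycle T A ^^ k) (\<theta>, W')))\<bar>
      \<le> 2 * CARD('m)"
proof -
  let ?\<Phi> = "cocycle T A" and ?f = "displacement F"
  let ?X = "UNIV \<times> unitary_group :: ('a \<times> (complex^'m^'m)) set"
  define S where "S V = (\<Sum>k<n. ?f ((?\<Phi> ^^ k) (\<theta>, V)))" for V
  have det_step: "det (snd (?\<Phi> z)) = det (snd z) * cis (2 * pi * ?f z)" if "z \<in> ?X" for z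
    using that displacement_fiber[OF A F] by (auto simp: cocycle_eq[OF A])
  have det_n: "det (snd ((?\<Phi> ^^ n) (\<theta>, V))) = det V * cis (2 * pi * (\<Sum>k<n. ?f ((?\<Phi> ^^ k) (\<theta>, V))))"
    if "V \<in> unitary_group" for V n
  proof (induction n)
    case (Suc n)
    have "(?\<Phi> ^^ n) (\<theta>, V) \<in> ?X" by (rule funpow_maps_into[OF cocycle_maps[OF A]]) (use that in simp)
    then show ?case using Suc by (simp add: det_step cis_mult ring_distribs mult.assoc)
  qed simp
  obtain M where M: "M \<in> HSp" "\<And>V. V \<in> unitary_group \<Longrightarrow> (?\<Phi> ^^ n) (\<theta>, V) = ((T ^^ n) \<theta>, moebius M V)"
    using cocycle_iterate[OF A] by metis
  obtain \<phi> where \<phi>: "continuous_on unitary_group \<phi>"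
    "\<And>V. V \<in> unitary_group \<Longrightarrow> det (moebius M V) = det V * cis (\<phi> V)"
    "\<And>V V'. V \<in> unitary_group \<Longrightarrow> V' \<in> unitary_group \<Longrightarrow> \<bar>\<phi> V - \<phi> V'\<bar> \<le> 4 * pi * CARD('m)"
    by (rule moebius_det_phase[OF M(1)]) (rule that)
  have "S W - \<phi> W / (2 * pi) = S W' - \<phi> W' / (2 * pi)"
  proof (rule continuous_on_Ints_constant[where f = "\<lambda>V. S V - \<phi> V / (2 * pi)", OF connected_unitary_group _ _ W])
    have "continuous_on unitary_group (\<lambda>V. ?f ((?\<Phi> ^^ k) (\<theta>, V)))" for k
    proof -
      have "continuous_on ?X (\<lambda>z. ?f ((?\<Phi> ^^ k) z))"
        by (rule continuous_on_compose2[OF continuous_on_displacement[OF comp A F]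
              continuous_on_funpow[OF continuous_on_cocycle[OF T Ac A] cocycle_maps[OF A]]])
           (intro image_subsetI funpow_maps_into[OF cocycle_maps[OF A]])
      then show ?thesis by (rule continuous_on_compose2) (auto intro!: continuous_intros)
    qed
    then show "continuous_on unitary_group (\<lambda>V. S V - \<phi> V / (2 * pi))"
      unfolding S_def by (intro continuous_intros \<phi>) auto
    show "S V - \<phi> V / (2 * pi) \<in> \<int>" if V: "V \<in> unitary_group" for V
    proof (rule cis_eq_imp_Ints)
      have "det V * cis (2 * pi * S V) = det V * cis (\<phi> V)"
        unfolding S_def det_n[OF V, symmetric] \<phi>(2)[OF V, symmetric] M(2)[OF V] by simp
      moreover have "det V \<noteq> 0" using unitary_group_det[OF V] by auto
      ultimately show "cis (2 * pi * S V) = cis (2 * pi * (\<phi> V / (2 * pi)))" by simp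
    qed
  qed
  then have "S W - S W' = (\<phi> W - \<phi> W') / (2 * pi)" by (simp add: diff_divide_distrib)
  then have "\<bar>S W - S W'\<bar> = \<bar>\<phi> W - \<phi> W'\<bar> / (2 * pi)" by (simp add: abs_divide)
  also have "\<dots> \<le> (4 * pi * CARD('m)) / (2 * pi)" by (intro divide_right_mono \<phi>(3) W) simp
  also have "\<dots> = 2 * CARD('m)" by simp
  finally show ?thesis by (simp add: S_def)
qed

section \<open>Convergence of the averages\<close>

lemma mod_periods_shift:
  fixes \<mu> :: "'a::topological_space measure"
  assumes comp: "compact (UNIV :: 'a set)" and \<mu>: "finite_measure \<mu>" "sets \<mu> = sets borel"
    and d: "d \<in> integer_periods \<mu>"
  shows "mod_periods \<mu> (c + d) = mod_periods \<mu> c"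
proof -
  interpret finite_measure \<mu> by (rule \<mu>)
  have int: "integrable \<mu> (\<lambda>\<theta>. real_of_int (p \<theta>))" if p: "continuous_on UNIV p" for p :: "'a \<Rightarrow> int"
  proof -
    have rp: "continuous_on UNIV (\<lambda>\<theta>. real_of_int (p \<theta>))" by (intro continuous_intros p)
    obtain B where B: "\<And>\<theta>. norm (real_of_int (p \<theta>)) \<le> B"
      using compact_imp_bounded[OF compact_continuous_image[OF rp comp]] unfolding bounded_iff by blast
    show ?thesis
      using B borel_measurable_continuous_onI[OF rp]
      by (intro integrable_const_bound[of _ B]) (auto simp: measurable_cong_sets[OF \<mu>(2) refl])
  qed
  have add: "a + b \<in> integer_periods \<mu>" if ab: "a \<in> integer_periods \<mu>" "b \<in> integer_periods \<mu>" for a b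
  proof -
    obtain p q :: "'a \<Rightarrow> int" where p: "continuous_on UNIV p" "a = (\<integral>\<theta>. real_of_int (p \<theta>) \<partial>\<mu>)"
      and q: "continuous_on UNIV q" "b = (\<integral>\<theta>. real_of_int (q \<theta>) \<partial>\<mu>)"
      using ab unfolding integer_periods_def by auto
    have "a + b = (\<integral>\<theta>. real_of_int (p \<theta> + q \<theta>) \<partial>\<mu>)"
      by (simp add: p q Bochner_Integration.integral_add[OF int[OF p(1)] int[OF q(1)]])
    moreover have "continuous_on UNIV (\<lambda>\<theta>. p \<theta> + q \<theta>)" by (intro continuous_intros p q)
    ultimately show ?thesis
      unfolding integer_periods_def by (intro CollectI exI[of _ "\<lambda>\<theta>. p \<theta> + q \<theta>"] conjI)
  qed
  have neg: "- a \<in> integer_periods \<mu>" if a: "a \<in> integer_periods \<mu>" for a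
  proof -
    obtain p :: "'a \<Rightarrow> int" where p: "continuous_on UNIV p" "a = (\<integral>\<theta>. real_of_int (p \<theta>) \<partial>\<mu>)"
      using a unfolding integer_periods_def by auto
    have "- a = (\<integral>\<theta>. real_of_int (- p \<theta>) \<partial>\<mu>)" by (simp add: p)
    moreover have "continuous_on UNIV (\<lambda>\<theta>. - p \<theta>)"
      using continuous_on_mult'[OF continuous_on_const[of _ "-1"] p(1)] by simp
    ultimately show ?thesis
      unfolding integer_periods_def by (intro CollectI exI[of _ "\<lambda>\<theta>. - p \<theta>"] conjI)
  qed
  show ?thesis
    unfolding mod_periods_def
  proof (intro equalityI subsetI)
    fix y assume "y \<in> (+) (c + d) ` integer_periods \<mu>"
    then obtain e where "e \<in> integer_periods \<mu>" "y = c + (d + e)" by auto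
    then show "y \<in> (+) c ` integer_periods \<mu>" using add[OF d] by blast
  next
    fix y assume "y \<in> (+) c ` integer_periods \<mu>"
    then obtain e where "e \<in> integer_periods \<mu>" "y = (c + d) + (- d + e)" by auto
    then show "y \<in> (+) (c + d) ` integer_periods \<mu>" using add[OF neg[OF d]] by blast
  qed
qed

lemma continuous_Ints_valued:
  fixes q :: "'a::topological_space \<Rightarrow> real"
  assumes q: "continuous_on UNIV q" and Z: "\<And>\<theta>. q \<theta> \<in> \<int>"
  obtains p :: "'a \<Rightarrow> int" where "continuous_on UNIV p" "\<And>\<theta>. q \<theta> = real_of_int (p \<theta>)"
proof
  show eq: "q \<theta> = real_of_int \<lfloor>q \<theta>\<rfloor>" for \<theta> using Z[of \<theta>] by (auto elim: Ints_cases)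
  show "continuous_on UNIV (\<lambda>\<theta>. \<lfloor>q \<theta>\<rfloor>)"
    unfolding continuous_on_def
  proof
    fix x
    have "(q \<longlongrightarrow> q x) (at x)" using q by (simp add: continuous_on_def)
    then have "\<forall>\<^sub>F y in at x. dist (q y) (q x) < 1" by (rule tendstoD) simp
    then have "\<forall>\<^sub>F y in at x. \<lfloor>q y\<rfloor> = \<lfloor>q x\<rfloor>"
    proof eventually_elim
      case (elim y)
      then have "\<bar>real_of_int (\<lfloor>q y\<rfloor> - \<lfloor>q x\<rfloor>)\<bar> < 1" using eq[of y] eq[of x] by (simp add: dist_real_def)
      then show ?case by linarith
    qed
    then show "((\<lambda>\<theta>. \<lfloor>q \<theta>\<rfloor>) \<longlongrightarrow> \<lfloor>q x\<rfloor>) (at x within UNIV)" by (simp add: tendsto_eventually)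
  qed
qed

lemma LIMSEQ_average_if_sums_bounded:
  fixes S :: "nat \<Rightarrow> real"
  assumes up: "\<And>j. bdd_above (range (\<lambda>n. S n - real n * (c + 1 / real (Suc j))))"
    and lo: "\<And>j. bdd_above (range (\<lambda>n. real n * (c - 1 / real (Suc j)) - S n))"
  shows "(\<lambda>n. S n / real n) \<longlonglongrightarrow> c"
proof (rule LIMSEQ_I)
  fix e :: real assume e: "e > 0"
  obtain j where j: "1 / real (Suc j) < e / 2" using nat_approx_posE e half_gt_zero by metis
  obtain b1 where b1: "\<And>n. S n - real n * (c + 1 / real (Suc j)) \<le> b1" using up[of j] by (auto simp: bdd_above_def)
  obtain b2 where b2: "\<And>n. real n * (c - 1 / real (Suc j)) - S n \<le> b2" using lo[of j] by (auto simp: bdd_above_def)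
  define b where "b = max 1 (max b1 b2)"
  obtain n0 :: nat where n0: "2 * b / e < n0" using reals_Archimedean2 by blast
  have b0: "b > 0" by (simp add: b_def)
  have "norm (S n / real n - c) < e" if n: "n \<ge> n0" for n
  proof -
    have "2 * b / e < real n" using n0 n by linarith
    moreover have "0 < 2 * b / e" using b0 e by simp
    ultimately have "real n > 0" "2 * b / e < real n" by linarith+
    then have n1: "real n > 0" "b < real n * (e / 2)" using e by (simp_all add: field_simps)
    have "real n * (1 / real (Suc j)) < real n * (e / 2)" using n1 j by (intro mult_strict_left_mono) auto
    moreover have "S n - real n * c \<le> b + real n * (1 / real (Suc j))"
      using b1[of n] unfolding b_def distrib_left by linarith
    moreover have "real n * c - S n \<le> b + real n * (1 / real (Suc j))"
      using b2[of n] unfolding b_def right_diff_distrib by linarith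
    moreover have "real n * (e / 2) + real n * (e / 2) = real n * e" by simp
    ultimately have "\<bar>S n - real n * c\<bar> < real n * e" using n1 by linarith
    moreover have "S n / real n - c = (S n - real n * c) / real n" using n1 by (simp add: field_simps)
    ultimately show ?thesis using n1 by (simp add: abs_divide divide_less_eq mult.commute)
  qed
  then show "\<exists>n0. \<forall>n\<ge>n0. norm (S n / real n - c) < e" by blast
qed

text \<open>With \<open>c\<close> the integral of \<open>f\<close>, applying \<open>sums_bounded_above_if_integral_neg\<close> to \<open>f - c - \<epsilon>\<close> and to \<open>c - \<epsilon> - f\<close> bounds the
  sums from both sides up to an arbitrarily small linear error.\<close>
lemma birkhoff_average_converges:
  fixes T :: "'a::metric_space \<Rightarrow> 'a" and \<Phi> :: "'a \<times> (complex^'m^'m) \<Rightarrow> 'a \<times> (complex^'m^('m::finite))"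
    and f :: "'a \<times> (complex^'m^'m) \<Rightarrow> real"
  assumes comp: "compact (UNIV :: 'a set)" and \<mu>: "sets \<mu> = sets borel" "ergodic_prob \<mu> T"
    and \<Phi>: "continuous_on (UNIV \<times> unitary_group) \<Phi>" "\<Phi> ` (UNIV \<times> unitary_group) \<subseteq> UNIV \<times> unitary_group"
      "\<And>z. z \<in> UNIV \<times> unitary_group \<Longrightarrow> fst (\<Phi> z) = T (fst z)"
    and \<nu>: "\<nu> \<in> invariant_over \<mu> \<Phi>"
    and f: "continuous_on (UNIV \<times> unitary_group) f"
    and osc: "\<And>n \<theta> W W'. W \<in> unitary_group \<Longrightarrow> W' \<in> unitary_group \<Longrightarrow>
      \<bar>(\<Sum>k<n. f ((\<Phi> ^^ k) (\<theta>, W))) - (\<Sum>k<n. f ((\<Phi> ^^ k) (\<theta>, W')))\<bar> \<le> C"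
  shows "AE \<theta> in \<mu>. \<forall>W\<in>unitary_group. (\<lambda>n. birkhoff_average \<Phi> f n (\<theta>, W)) \<longlonglongrightarrow> (\<integral>z. f z \<partial>\<nu>)"
proof -
  let ?X = "UNIV \<times> unitary_group :: ('a \<times> (complex^'m^'m)) set" and ?c = "\<integral>z. f z \<partial>\<nu>"
  have \<nu>s: "sets \<nu> = sets (restrict_space borel ?X)" and \<nu>i: "prob_space \<nu>"
    using \<nu> by (auto simp: invariant_over_def invariant_prob_def)
  have sp\<nu>: "space \<nu> = ?X" using sets_eq_imp_space_eq[OF \<nu>s] by (simp add: space_restrict_space)
  interpret \<nu>: prob_space \<nu> by (rule \<nu>i)
  have "compact ?X" by (intro compact_Times comp compact_unitary_group)
  then have "bounded (f ` ?X)" by (intro compact_imp_bounded compact_continuous_image f)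
  then obtain B where B: "\<And>z. z \<in> ?X \<Longrightarrow> norm (f z) \<le> B" unfolding bounded_iff by blast
  have fm: "f \<in> borel_measurable \<nu>"
    unfolding measurable_cong_sets[OF \<nu>s refl] by (rule borel_measurable_continuous_on_restrict[OF f])
  have fi: "integrable \<nu> f" using B by (intro \<nu>.integrable_const_bound[of _ B] fm) (auto simp: sp\<nu>)
  have main: "AE \<theta> in \<mu>. \<forall>W\<in>unitary_group. bdd_above (range (\<lambda>n. \<Sum>k<n. s * f ((\<Phi> ^^ k) (\<theta>, W)) + a))"
    if s: "\<bar>s\<bar> = 1" and neg: "s * ?c + a < 0" for s a :: real
  proof (rule sums_bounded_above_if_integral_neg[where \<phi> = "\<lambda>z. s * f z + a", OF comp \<mu> \<Phi> \<nu>])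
    show "continuous_on ?X (\<lambda>z. s * f z + a)" by (intro continuous_intros f)
    show "(\<integral>z. s * f z + a \<partial>\<nu>) < 0" using neg fi by (simp add: \<nu>.prob_space)
    fix n \<theta> and W W' :: "complex^'m^'m" assume W: "W \<in> unitary_group" "W' \<in> unitary_group"
    let ?S = "\<lambda>W. \<Sum>k<n. f ((\<Phi> ^^ k) (\<theta>, W))"
    have "(\<Sum>k<n. s * f ((\<Phi> ^^ k) (\<theta>, V)) + a) = s * ?S V + real n * a" for V
      by (simp add: sum.distrib sum_distrib_left)
    then have "(\<Sum>k<n. s * f ((\<Phi> ^^ k) (\<theta>, W)) + a) - (\<Sum>k<n. s * f ((\<Phi> ^^ k) (\<theta>, W')) + a) = s * (?S W - ?S W')"
      by (simp add: right_diff_distrib)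
    then show "\<bar>(\<Sum>k<n. s * f ((\<Phi> ^^ k) (\<theta>, W)) + a) - (\<Sum>k<n. s * f ((\<Phi> ^^ k) (\<theta>, W')) + a)\<bar> \<le> C"
      using osc[OF W, where n = n and \<theta> = \<theta>] s by (simp add: abs_mult)
  qed
  have "AE \<theta> in \<mu>. \<forall>j. \<forall>W\<in>unitary_group. bdd_above (range (\<lambda>n. \<Sum>k<n. 1 * f ((\<Phi> ^^ k) (\<theta>, W)) + - (?c + 1 / real (Suc j))))"
    unfolding AE_all_countable by (intro allI main) (simp_all add: field_simps)
  moreover have "AE \<theta> in \<mu>. \<forall>j. \<forall>W\<in>unitary_group. bdd_above (range (\<lambda>n. \<Sum>k<n. - 1 * f ((\<Phi> ^^ k) (\<theta>, W)) + (?c - 1 / real (Suc j))))"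
    unfolding AE_all_countable by (intro allI main) (simp_all add: field_simps)
  ultimately show ?thesis
  proof eventually_elim
    case (elim \<theta>)
    show ?case
    proof
      fix W :: "complex^'m^'m" assume W: "W \<in> unitary_group"
      show "(\<lambda>n. birkhoff_average \<Phi> f n (\<theta>, W)) \<longlonglongrightarrow> ?c"
        unfolding birkhoff_average_def
      proof (rule LIMSEQ_average_if_sums_bounded)
        show "bdd_above (range (\<lambda>n. (\<Sum>k<n. f ((\<Phi> ^^ k) (\<theta>, W))) - real n * (?c + 1 / real (Suc j))))" for j
          using elim(1) W by (simp add: sum_subtractf sum.distrib algebra_simps)
        show "bdd_above (range (\<lambda>n. real n * (?c - 1 / real (Suc j)) - (\<Sum>k<n. f ((\<Phi> ^^ k) (\<theta>, W)))))" for j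
          using elim(2) W by (simp add: sum_subtractf sum.distrib sum_negf algebra_simps)
      qed
    qed
  qed
qed

lemma fst_funpow_skew:
  assumes "\<Phi> ` X \<subseteq> X" "\<And>z. z \<in> X \<Longrightarrow> fst (\<Phi> z) = T (fst z)" "z \<in> X"
  shows "fst ((\<Phi> ^^ j) z) = (T ^^ j) (fst z)"
  by (induction j) (simp_all add: assms funpow_maps_into[OF assms(1)])

lemma integral_funpow_invariant:
  fixes h :: "'b \<Rightarrow> real"
  assumes inv: "invariant_prob N G" and h: "h \<in> borel_measurable N"
  shows "(\<integral>z. h ((G ^^ j) z) \<partial>N) = (\<integral>z. h z \<partial>N)"
proof -
  have G: "G \<in> N \<rightarrow>\<^sub>M N" "distr N N G = N" using inv by (simp_all add: invariant_prob_def)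
  have Gj: "(G ^^ j) \<in> N \<rightarrow>\<^sub>M N" for j
  proof (induction j)
    case (Suc j)
    then show ?case using measurable_compose[OF Suc G(1)] by (simp add: o_def)
  qed (simp add: id_def)
  show ?thesis
  proof (induction j)
    case (Suc j)
    have "(\<integral>z. h ((G ^^ Suc j) z) \<partial>N) = (\<integral>z. h ((G ^^ j) (G z)) \<partial>N)" by (simp add: funpow_swap1)
    also have "\<dots> = (\<integral>z. h ((G ^^ j) z) \<partial>distr N N G)"
      by (rule integral_distr[OF G(1), symmetric]) (rule measurable_compose[OF Gj h])
    finally show ?case using Suc G(2) by simp
  qed simp
qed

text \<open>The averages start from the image of \<open>\<mu>\<close> on the constant section, and all of them project to \<open>\<mu>\<close>.\<close>
lemma invariant_over_nonempty:
  fixes T :: "'a::metric_space \<Rightarrow> 'a" and \<Phi> :: "'a \<times> (complex^'m^'m) \<Rightarrow> 'a \<times> (complex^'m^('m::finite))"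
  assumes comp: "compact (UNIV :: 'a set)" and \<mu>: "sets \<mu> = sets borel" "invariant_prob \<mu> T"
    and \<Phi>: "continuous_on (UNIV \<times> unitary_group) \<Phi>" "\<Phi> ` (UNIV \<times> unitary_group) \<subseteq> UNIV \<times> unitary_group"
      "\<And>z. z \<in> UNIV \<times> unitary_group \<Longrightarrow> fst (\<Phi> z) = T (fst z)"
  shows "invariant_over \<mu> \<Phi> \<noteq> {}"
proof -
  let ?X = "UNIV \<times> unitary_group :: ('a \<times> (complex^'m^'m)) set" and ?i = "\<lambda>\<theta> :: 'a. (\<theta>, mat 1 :: complex^'m^'m)"
  interpret \<mu>: prob_space \<mu> using \<mu>(2) by (simp add: invariant_prob_def)
  have X: "compact ?X" by (intro compact_Times comp compact_unitary_group)
  have im: "?i \<in> \<mu> \<rightarrow>\<^sub>M restrict_space borel ?X"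
    unfolding measurable_cong_sets[OF \<mu>(1) refl]
    by (intro measurable_restrict_space2 borel_measurable_continuous_onI continuous_intros) auto
  define P where "P = distr \<mu> (restrict_space borel ?X) ?i"
  have P: "prob_space P" "sets P = sets (restrict_space borel ?X)"
    unfolding P_def by (simp_all add: \<mu>.prob_space_distr[OF im])
  obtain r \<nu> where "strict_mono (r :: nat \<Rightarrow> nat)"
    and \<nu>: "sets \<nu> = sets (restrict_space borel ?X)" "invariant_prob \<nu> \<Phi>"
    and lim: "\<And>h :: _ \<Rightarrow> real. continuous_on ?X h \<Longrightarrow>
       (\<lambda>n. (\<Sum>j<Suc (r n). \<integral>x. h ((\<Phi> ^^ j) x) \<partial>P) / real (Suc (r n))) \<longlonglongrightarrow> (\<integral>x. h x \<partial>\<nu>)"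
    by (rule krylov_bogoliubov[where P = "\<lambda>_. P" and k = Suc, OF X \<Phi>(1,2) P zero_less_Suc filterlim_Suc]) (rule that)
  have fm: "fst \<in> borel_measurable \<nu>"
    unfolding measurable_cong_sets[OF \<nu>(1) refl]
    by (intro borel_measurable_continuous_on_restrict continuous_intros)
  interpret \<nu>: prob_space \<nu> using \<nu>(2) by (simp add: invariant_prob_def)
  have "distr \<nu> borel fst = \<mu>"
  proof (rule prob_measure_eqI_continuous)
    fix h :: "'a \<Rightarrow> real" assume h: "continuous_on UNIV h"
    have hm: "h \<in> borel_measurable borel" by (rule borel_measurable_continuous_onI[OF h])
    have hf: "continuous_on ?X (\<lambda>z. h (fst z))"
      by (rule continuous_on_compose2[OF h]) (auto intro!: continuous_intros)
    have "(\<integral>x. h (fst ((\<Phi> ^^ j) x)) \<partial>P) = (\<integral>\<theta>. h \<theta> \<partial>\<mu>)" for j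
    proof -
      have "continuous_on ?X (\<lambda>z. h (fst ((\<Phi> ^^ j) z)))"
        by (rule continuous_on_compose2[OF hf continuous_on_funpow[OF \<Phi>(1,2)]])
           (intro image_subsetI funpow_maps_into[OF \<Phi>(2)])
      then have "(\<integral>x. h (fst ((\<Phi> ^^ j) x)) \<partial>P) = (\<integral>\<theta>. h (fst ((\<Phi> ^^ j) (?i \<theta>))) \<partial>\<mu>)"
        unfolding P_def by (intro integral_distr im borel_measurable_continuous_on_restrict)
      also have "\<dots> = (\<integral>\<theta>. h ((T ^^ j) \<theta>) \<partial>\<mu>)"
        using fst_funpow_skew[OF \<Phi>(2,3)] by simp
      also have "\<dots> = (\<integral>\<theta>. h \<theta> \<partial>\<mu>)"
        by (rule integral_funpow_invariant[OF \<mu>(2)]) (simp add: measurable_cong_sets[OF \<mu>(1) refl] hm)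
      finally show ?thesis .
    qed
    then have "(\<integral>z. h (fst z) \<partial>\<nu>) = (\<integral>\<theta>. h \<theta> \<partial>\<mu>)"
      using lim[OF hf] by (simp add: LIMSEQ_const_iff del: of_nat_Suc)
    then show "(\<integral>\<theta>. h \<theta> \<partial>distr \<nu> borel fst) = (\<integral>\<theta>. h \<theta> \<partial>\<mu>)" by (simp add: integral_distr[OF fm hm])
  qed (simp_all add: \<nu>.prob_space_distr[OF fm] \<mu>(1) \<mu>.prob_space_axioms)
  then have "\<nu> \<in> invariant_over \<mu> \<Phi>" using \<nu> by (simp add: invariant_over_def)
  then show ?thesis by blast
qed

text \<open>If the convergence were not uniform, the empirical measures along bad orbit segments would have a limit that is
  invariant, lies over the only invariant measure of the base, and gives \<open>f\<close> a different integral.\<close>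
lemma uniform_limit_birkhoff_average:
  fixes T :: "'a::metric_space \<Rightarrow> 'a" and \<Phi> :: "'a \<times> (complex^'m^'m) \<Rightarrow> 'a \<times> (complex^'m^('m::finite))"
    and f :: "'a \<times> (complex^'m^'m) \<Rightarrow> real"
  assumes comp: "compact (UNIV :: 'a set)" and T: "continuous_on UNIV T" and ue: "uniquely_ergodic \<mu> T"
    and \<Phi>: "continuous_on (UNIV \<times> unitary_group) \<Phi>" "\<Phi> ` (UNIV \<times> unitary_group) \<subseteq> UNIV \<times> unitary_group"
      "\<And>z. z \<in> UNIV \<times> unitary_group \<Longrightarrow> fst (\<Phi> z) = T (fst z)"
    and f: "continuous_on (UNIV \<times> unitary_group) f"
    and c: "\<And>\<nu>. \<nu> \<in> invariant_over \<mu> \<Phi> \<Longrightarrow> (\<integral>z. f z \<partial>\<nu>) = c"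
  shows "uniform_limit (UNIV \<times> unitary_group) (birkhoff_average \<Phi> f) (\<lambda>_. c) sequentially"
proof (rule ccontr)
  let ?X = "UNIV \<times> unitary_group :: ('a \<times> (complex^'m^'m)) set"
  have X: "compact ?X" by (intro compact_Times comp compact_unitary_group)
  assume "\<not> uniform_limit ?X (birkhoff_average \<Phi> f) (\<lambda>_. c) sequentially"
  then obtain e where e: "e > 0" "\<And>N. \<exists>n\<ge>N. \<exists>z\<in>?X. e \<le> dist (birkhoff_average \<Phi> f n z) c"
    unfolding uniform_limit_sequentially_iff by (auto simp: not_less)
  then have "\<forall>N. \<exists>p. Suc N \<le> fst p \<and> snd p \<in> ?X \<and> e \<le> dist (birkhoff_average \<Phi> f (fst p) (snd p)) c"
    by (metis fst_conv snd_conv)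
  then obtain p where p: "\<And>N. Suc N \<le> fst (p N)" "\<And>N. snd (p N) \<in> ?X"
    "\<And>N. e \<le> dist (birkhoff_average \<Phi> f (fst (p N)) (snd (p N))) c" by metis
  define k z where "k N = fst (p N)" and "z N = snd (p N)" for N
  let ?P = "\<lambda>N. return (restrict_space borel ?X) (z N)"
  have zX: "z N \<in> ?X" for N using p(2) by (simp add: z_def)
  have kS: "Suc N \<le> k N" for N using p(1) by (simp add: k_def)
  have P: "prob_space (?P N)" "sets (?P N) = sets (restrict_space borel ?X)" for N
    using zX by (auto intro!: prob_space_return simp: space_restrict_space)
  have k0: "k N > 0" for N using kS[of N] by simp
  have kinf: "filterlim k at_top sequentially"
    by (rule filterlim_at_top_mono[OF filterlim_ident]) (rule always_eventually, rule allI, rule Suc_leD, rule kS)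
  obtain r \<nu> where "strict_mono (r :: nat \<Rightarrow> nat)"
    and \<nu>: "sets \<nu> = sets (restrict_space borel ?X)" "invariant_prob \<nu> \<Phi>"
    and lim: "\<And>h :: _ \<Rightarrow> real. continuous_on ?X h \<Longrightarrow>
       (\<lambda>n. (\<Sum>j<k (r n). \<integral>x. h ((\<Phi> ^^ j) x) \<partial>?P (r n)) / real (k (r n))) \<longlonglongrightarrow> (\<integral>x. h x \<partial>\<nu>)"
    by (rule krylov_bogoliubov[where P = ?P and k = k, OF X \<Phi>(1,2) P k0 kinf]) (rule that)
  have fm: "fst \<in> borel_measurable \<nu>"
    unfolding measurable_cong_sets[OF \<nu>(1) refl]
    by (intro borel_measurable_continuous_on_restrict continuous_intros)
  have sp\<nu>: "space \<nu> = ?X" using sets_eq_imp_space_eq[OF \<nu>(1)] by (simp add: space_restrict_space)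
  interpret \<nu>: prob_space \<nu> using \<nu>(2) by (simp add: invariant_prob_def)
  have "distr \<nu> borel fst = \<mu>"
  proof -
    let ?d = "distr \<nu> borel fst"
    have Tm: "T \<in> borel_measurable borel" by (rule borel_measurable_continuous_onI[OF T])
    have \<Phi>m: "\<Phi> \<in> \<nu> \<rightarrow>\<^sub>M \<nu>" "distr \<nu> \<nu> \<Phi> = \<nu>" using \<nu>(2) by (simp_all add: invariant_prob_def)
    have "distr ?d ?d T = distr ?d borel T" by (intro distr_cong) simp_all
    also have "\<dots> = distr \<nu> borel (T \<circ> fst)" by (rule distr_distr[OF Tm fm])
    also have "\<dots> = distr \<nu> borel (fst \<circ> \<Phi>)" by (intro distr_cong) (simp_all add: sp\<nu> \<Phi>(3))
    also have "\<dots> = distr (distr \<nu> \<nu> \<Phi>) borel fst" by (rule distr_distr[OF fm \<Phi>m(1), symmetric])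
    also have "\<dots> = ?d" unfolding \<Phi>m(2) ..
    finally have "invariant_prob ?d T"
      using Tm \<nu>.prob_space_distr[OF fm] by (simp add: invariant_prob_def)
    then have "sets ?d = sets borel \<and> invariant_prob ?d T" by simp
    then show ?thesis using ue unfolding uniquely_ergodic_def by blast
  qed
  then have "\<nu> \<in> invariant_over \<mu> \<Phi>" using \<nu> by (simp add: invariant_over_def)
  then have \<nu>c: "(\<integral>z. f z \<partial>\<nu>) = c" by (rule c)
  have "(\<integral>x. f ((\<Phi> ^^ j) x) \<partial>?P n) = f ((\<Phi> ^^ j) (z n))" for j n
  proof (rule integral_return)
    show "z n \<in> space (restrict_space borel ?X)" using zX by (simp add: space_restrict_space)
    have "continuous_on ?X (\<lambda>z. f ((\<Phi> ^^ j) z))"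
      by (rule continuous_on_compose2[OF f continuous_on_funpow[OF \<Phi>(1,2)]])
         (intro image_subsetI funpow_maps_into[OF \<Phi>(2)])
    then show "(\<lambda>x. f ((\<Phi> ^^ j) x)) \<in> borel_measurable (restrict_space borel ?X)"
      by (rule borel_measurable_continuous_on_restrict)
  qed
  then have "(\<lambda>n. birkhoff_average \<Phi> f (k (r n)) (z (r n))) \<longlonglongrightarrow> c"
    using lim[OF f] unfolding birkhoff_average_def \<nu>c by simp
  then have "(\<lambda>n. dist (birkhoff_average \<Phi> f (k (r n)) (z (r n))) c) \<longlonglongrightarrow> 0" by (rule tendsto_dist_iff[THEN iffD1])
  then have "e \<le> 0" by (rule LIMSEQ_le_const) (use p(3) in \<open>auto simp: k_def z_def\<close>)
  then show False using e(1) by simp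
qed

text \<open>On each fibre both displacements lift the same phase, so they differ by an integer that is constant on the fibre
  by connectedness of \<open>U(m)\<close>.\<close>
lemma displacement_difference:
  fixes F F' :: "'a::metric_space \<times> real \<times> (complex^'m^'m) \<Rightarrow> 'a \<times> real \<times> (complex^'m^('m::finite))"
  assumes comp: "compact (UNIV :: 'a set)" and A: "range A \<subseteq> HSp" and F: "is_lift T A F" and F': "is_lift T A F'"
  obtains p :: "'a \<Rightarrow> int" where "continuous_on UNIV p"
    "\<And>\<theta> W. W \<in> unitary_group \<Longrightarrow> displacement F' (\<theta>, W) = displacement F (\<theta>, W) + real_of_int (p \<theta>)"
proof -
  define d where "d \<theta> W = displacement F' (\<theta>, W) - displacement F (\<theta>, W)" for \<theta> W
  have dc: "continuous_on (UNIV \<times> unitary_group) (\<lambda>z. d (fst z) (snd z))"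
    unfolding d_def
    using continuous_on_displacement[OF comp A F] continuous_on_displacement[OF comp A F']
    by (simp add: continuous_on_diff)
  have dZ: "d \<theta> W \<in> \<int>" if W: "W \<in> unitary_group" for \<theta> W
    unfolding d_def
  proof (rule cis_eq_imp_Ints)
    have "det W \<noteq> 0" using unitary_group_det[OF W] by auto
    then show "cis (2 * pi * displacement F' (\<theta>, W)) = cis (2 * pi * displacement F (\<theta>, W))"
      using displacement_fiber[OF A F W, of \<theta>] displacement_fiber[OF A F' W, of \<theta>] by simp
  qed
  have "d \<theta> W = d \<theta> (mat 1)" if "W \<in> unitary_group" for \<theta> W
  proof (rule continuous_on_Ints_constant[where f = "d \<theta>", OF connected_unitary_group])
    show "continuous_on unitary_group (d \<theta>)"
      by (rule continuous_on_compose2[OF dc, of _ "Pair \<theta>", simplified]) (auto intro!: continuous_intros)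
  qed (use dZ that in auto)
  moreover have "continuous_on UNIV (\<lambda>\<theta>. d \<theta> (mat 1))"
    by (rule continuous_on_compose2[OF dc, of _ "\<lambda>\<theta>. (\<theta>, mat 1)", simplified]) (auto intro!: continuous_intros)
  then obtain p :: "'a \<Rightarrow> int" where "continuous_on UNIV p" "\<And>\<theta>. d \<theta> (mat 1) = real_of_int (p \<theta>)"
    using continuous_Ints_valued dZ[OF mat_1_in_unitary_group] by metis
  ultimately show thesis using that[of p] by (simp add: d_def algebra_simps)
qed



theorem mainTheorem4:
  fixes T :: "'a::metric_space \<Rightarrow> 'a"
    and \<mu> :: "'a measure"
    and A :: "'a \<Rightarrow> complex^('m::finite + 'm)^('m + 'm)"
    and F :: "'a \<times> real \<times> (complex^'m^'m) \<Rightarrow> 'a \<times> real \<times> (complex^'m^'m)"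
    and f :: "'a \<times> (complex^'m^'m) \<Rightarrow> real"
  assumes "compact (UNIV :: 'a set)"
    and "homeomorphic_map euclidean euclidean T"
    and "sets \<mu> = sets borel" and "ergodic_prob \<mu> T"
    and "continuous_on UNIV A" and "range A \<subseteq> HSp"
    and "homotopic_with_canon (\<lambda>_. True) UNIV HSp A (\<lambda>_. mat 1)"
    and "is_lift T A F"
    and "f = displacement F"
  shows "\<exists>rot :: real set.
     invariant_over \<mu> (cocycle T A) \<noteq> {} \<and>
     (\<forall>\<nu>\<in>invariant_over \<mu> (cocycle T A). mod_periods \<mu> (\<integral>z. f z \<partial>\<nu>) = rot) \<and>
     (AE \<theta> in \<mu>. \<forall>W\<in>unitary_group. \<exists>l.
        (\<lambda>n. birkhoff_average (cocycle T A) f n (\<theta>, W)) \<longlonglongrightarrow> l \<and> mod_periods \<mu> l = rot) \<and>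
     (\<forall>F'. is_lift T A F' \<longrightarrow>
        (\<forall>\<nu>\<in>invariant_over \<mu> (cocycle T A).
           mod_periods \<mu> (\<integral>z. displacement F' z \<partial>\<nu>) = rot)) \<and>
     (uniquely_ergodic \<mu> T \<longrightarrow>
        (\<exists>g. uniform_limit (UNIV \<times> unitary_group) (birkhoff_average (cocycle T A) f) g sequentially \<and>
             (\<forall>z\<in>UNIV \<times> unitary_group. mod_periods \<mu> (g z) = rot)))"
proof -
  let ?X = "UNIV \<times> unitary_group :: ('a \<times> (complex^'m^'m)) set" and ?\<Phi> = "cocycle T A"
  note comp = assms(1) and \<mu> = assms(3,4) and Ac = assms(5) and A = assms(6) and F = assms(8) and f = assms(9)
  have T: "continuous_on UNIV T"
    using homeomorphic_imp_continuous_map[OF assms(2)] by simp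
  have inv\<mu>: "invariant_prob \<mu> T" using \<mu>(2) by (simp add: ergodic_prob_def)
  interpret \<mu>: prob_space \<mu> using inv\<mu> by (simp add: invariant_prob_def)
  have \<Phi>: "continuous_on ?X ?\<Phi>" "?\<Phi> ` ?X \<subseteq> ?X" "\<And>z. z \<in> ?X \<Longrightarrow> fst (?\<Phi> z) = T (fst z)"
    using continuous_on_cocycle[OF T Ac A] cocycle_maps[OF A] by (auto simp: cocycle_eq[OF A])
  have fc: "continuous_on ?X f" unfolding f by (rule continuous_on_displacement[OF comp A F])
  obtain \<nu>0 where \<nu>0: "\<nu>0 \<in> invariant_over \<mu> ?\<Phi>"
    using invariant_over_nonempty[OF comp \<mu>(1) inv\<mu> \<Phi>] by auto
  define c where "c = (\<integral>z. f z \<partial>\<nu>0)"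
  have conv: "AE \<theta> in \<mu>. \<forall>W\<in>unitary_group. (\<lambda>n. birkhoff_average ?\<Phi> f n (\<theta>, W)) \<longlonglongrightarrow> (\<integral>z. f z \<partial>\<nu>)"
    if "\<nu> \<in> invariant_over \<mu> ?\<Phi>" for \<nu>
    by (rule birkhoff_average_converges[where C = "real (2 * CARD('m))", OF comp \<mu> \<Phi> that fc])
       (assumption, unfold f, rule displacement_sum_oscillation[OF comp T Ac A F])
  have c: "(\<integral>z. f z \<partial>\<nu>) = c" if \<nu>: "\<nu> \<in> invariant_over \<mu> ?\<Phi>" for \<nu>
  proof -
    have "AE \<theta> in \<mu>. (\<integral>z. f z \<partial>\<nu>) = c"
      using conv[OF \<nu>] conv[OF \<nu>0]
      by eventually_elim (unfold c_def, meson LIMSEQ_unique mat_1_in_unitary_group)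
    then show ?thesis using \<mu>.AE_const by simp
  qed
  have lift: "mod_periods \<mu> (\<integral>z. displacement F' z \<partial>\<nu>) = mod_periods \<mu> c"
    if F': "is_lift T A F'" and \<nu>: "\<nu> \<in> invariant_over \<mu> ?\<Phi>" for F' \<nu>
  proof -
    have \<nu>s: "sets \<nu> = sets (restrict_space borel ?X)" and \<nu>i: "prob_space \<nu>" and \<nu>p: "distr \<nu> borel fst = \<mu>"
      using \<nu> by (auto simp: invariant_over_def invariant_prob_def)
    have sp\<nu>: "space \<nu> = ?X" using sets_eq_imp_space_eq[OF \<nu>s] by (simp add: space_restrict_space)
    interpret \<nu>: prob_space \<nu> by (rule \<nu>i)
    have fm: "fst \<in> borel_measurable \<nu>"
      unfolding measurable_cong_sets[OF \<nu>s refl]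
      by (intro borel_measurable_continuous_on_restrict continuous_intros)
    have int: "integrable \<nu> g" if g: "continuous_on ?X g" for g :: "'a \<times> (complex^'m^'m) \<Rightarrow> real"
    proof -
      have "compact ?X" by (intro compact_Times comp compact_unitary_group)
      then have "bounded (g ` ?X)" by (intro compact_imp_bounded compact_continuous_image g)
      then obtain B where B: "\<And>z. z \<in> ?X \<Longrightarrow> norm (g z) \<le> B" unfolding bounded_iff by blast
      have "g \<in> borel_measurable \<nu>"
        unfolding measurable_cong_sets[OF \<nu>s refl] by (rule borel_measurable_continuous_on_restrict[OF g])
      then show ?thesis using B by (intro \<nu>.integrable_const_bound[of _ B]) (auto simp: sp\<nu>)
    qed
    obtain p :: "'a \<Rightarrow> int" where p: "continuous_on UNIV p"
      "\<And>\<theta> W. W \<in> unitary_group \<Longrightarrow> displacement F' (\<theta>, W) = displacement F (\<theta>, W) + real_of_int (p \<theta>)"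
      by (rule displacement_difference[OF comp A F F']) (rule that; assumption)
    have rp: "continuous_on UNIV (\<lambda>\<theta>. real_of_int (p \<theta>))" by (intro continuous_intros p)
    have pf: "continuous_on ?X (\<lambda>z. real_of_int (p (fst z)))"
      by (rule continuous_on_compose2[OF rp]) (auto intro!: continuous_intros)
    have "(\<integral>z. displacement F' z \<partial>\<nu>) = (\<integral>z. f z + real_of_int (p (fst z)) \<partial>\<nu>)"
      by (intro Bochner_Integration.integral_cong refl) (auto simp: sp\<nu> p(2) f)
    also have "\<dots> = c + (\<integral>z. real_of_int (p (fst z)) \<partial>\<nu>)"
      by (simp add: Bochner_Integration.integral_add[OF int[OF fc] int[OF pf]] c[OF \<nu>])
    also have "(\<integral>z. real_of_int (p (fst z)) \<partial>\<nu>) = (\<integral>\<theta>. real_of_int (p \<theta>) \<partial>\<mu>)"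
      unfolding \<nu>p[symmetric] by (rule integral_distr[OF fm borel_measurable_continuous_onI[OF rp], symmetric])
    finally have eq: "(\<integral>z. displacement F' z \<partial>\<nu>) = c + (\<integral>\<theta>. real_of_int (p \<theta>) \<partial>\<mu>)" .
    show ?thesis
      unfolding eq
      by (rule mod_periods_shift[OF comp \<mu>.finite_measure_axioms \<mu>(1)]) (use p(1) in \<open>auto simp: integer_periods_def\<close>)
  qed
  have uni: "uniform_limit ?X (birkhoff_average ?\<Phi> f) (\<lambda>_. c) sequentially" if "uniquely_ergodic \<mu> T"
    by (rule uniform_limit_birkhoff_average[OF comp T that \<Phi> fc c])
  show ?thesis
  proof (intro exI[of _ "mod_periods \<mu> c"] conjI ballI allI impI)
    show "invariant_over \<mu> ?\<Phi> \<noteq> {}" using \<nu>0 by blast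
    show "mod_periods \<mu> (\<integral>z. f z \<partial>\<nu>) = mod_periods \<mu> c" if "\<nu> \<in> invariant_over \<mu> ?\<Phi>" for \<nu>
      using c[OF that] by simp
    show "AE \<theta> in \<mu>. \<forall>W\<in>unitary_group. \<exists>l.
        (\<lambda>n. birkhoff_average ?\<Phi> f n (\<theta>, W)) \<longlonglongrightarrow> l \<and> mod_periods \<mu> l = mod_periods \<mu> c"
      using conv[OF \<nu>0] by eventually_elim (auto simp: c_def)
    show "mod_periods \<mu> (\<integral>z. displacement F' z \<partial>\<nu>) = mod_periods \<mu> c"
      if "is_lift T A F'" "\<nu> \<in> invariant_over \<mu> ?\<Phi>" for F' \<nu>
      by (rule lift[OF that])
    show "\<exists>g. uniform_limit ?X (birkhoff_average ?\<Phi> f) g sequentially \<and>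
             (\<forall>z\<in>?X. mod_periods \<mu> (g z) = mod_periods \<mu> c)" if "uniquely_ergodic \<mu> T"
      using uni[OF that] by (intro exI[of _ "\<lambda>_. c"]) simp
  qed
qed

end
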